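(* Let $G=\mathrm{SO}(2,n)$ with $n\ge 3$, realized as in the context. A closed, connected subgroup $H$ of $N$, with Lie algebra $\mathfrak h$, is a Cartan-decomposition subgroup of $G$ if and only if either (1) $\dim H=2$, $\mathfrak u_{\alpha+2\beta}\subset\mathfrak h$, and there is an element of $\mathfrak h$ such that $\phi\ne0$ and $y\ne0$; or (2) $\dim H\ge2$ and both of the following hold: (a) there is an element of $\mathfrak h$ such that the linear span $\langle(\phi,x),(0,y)\rangle$ is one-dimensional in $\mathbb{R}^{n-1}$; and (b) there is a nonzero element of $\mathfrak h$ such that either (i) $\langle(\phi,x),(0,y)\rangle$ is two-dimensional in $\mathbb{R}^{n-1}$, or (ii) $y=0$ and $\|x\|^2=-2\phi\eta$.
   Context: A closed subgroup $H$ of $G$ is a Cartan-decomposition subgroup of $G$ if $H$ is connected and there is a compact subset $C$ of $G$ with $CHC=G$. $\mathrm{SO}(2,n)$ is the group of determinant-one linear isometries of the quadratic form $\langle v\mid v\rangle=2v_1v_{n+2}+2v_2v_{n+1}+\sum_{i=3}^n v_i^2$ on $\mathbb{R}^{n+2}$. $N$ is the group of upper-triangular matrices in $\mathrm{SO}(2,n)$ with all diagonal entries $1$. Its Lie algebra $\mathfrak n$ consists of the matrices (block sizes $1,1,n-2,1,1$) $$\begin{pmatrix}0&\phi&x&\eta&0\\0&0&y&0&-\eta\\0&0&0&-y^T&-x^T\\0&0&0&0&-\phi\\0&0&0&0&0\end{pmatrix},\qquad \phi,\eta\in\mathbb{R},\ x,y\in\mathbb{R}^{n-2}\text{ (row vectors)},$$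 so each element of $\mathfrak n$ determines values of $\phi,x,y,\eta$. $\mathfrak u_{\alpha+2\beta}$ is the $\eta$-axis in $\mathfrak n$ (i.e. $\phi=0,x=0,y=0$). Here $(\phi,x),(0,y)\in\mathbb{R}\times\mathbb{R}^{n-2}=\mathbb{R}^{n-1}$, and $\|\cdot\|$ is the Euclidean norm on $\mathbb{R}^{n-2}$. *)

theory Defs
  imports "HOL-Analysis.Analysis" "HOL-Algebra.Coset"
begin

text \<open>
  Rows and columns of the \<open>(n+2) \<times> (n+2)\<close> matrices are indexed by \<open>'k idx\<close>, which follows the block
  sizes \<open>1, 1, n-2, 1, 1\<close>: the coordinates \<open>1, 2, 3..n, n+1, n+2\<close> are \<open>First\<close>, \<open>Second\<close>, \<open>Mid i\<close>,
  \<open>Penult\<close>, \<open>Last\<close>, where \<open>'k\<close> is a finite linearly ordered type with \<open>n-2\<close> elements. The order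
  is only needed to speak of upper-triangular matrices.
\<close>

datatype 'k idx = First | Second | Mid 'k | Penult | Last

lemma UNIV_idx: "UNIV = {First, Second, Penult, Last} \<union> range Mid"
  by (auto intro: idx.exhaust)

instance idx :: (finite) finite
  by standard (simp add: UNIV_idx)

lemma card_idx: "CARD('k::finite idx) = CARD('k) + 4"
proof -
  have "card (range (Mid :: 'k \<Rightarrow> 'k idx)) = CARD('k)"
    by (intro card_image) (simp add: inj_on_def)
  moreover have "card ({First, Second, Penult, Last} \<union> range (Mid :: 'k \<Rightarrow> 'k idx))
      = card {First, Second, Penult, Last :: 'k idx} + card (range (Mid :: 'k \<Rightarrow> 'k idx))"
    by (intro card_Un_disjoint) auto
  ultimately show ?thesis
    unfolding UNIV_idx by simp
qed

fun block :: "'k idx \<Rightarrow> nat" where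
  "block First = 0"
| "block Second = 1"
| "block (Mid i) = 2"
| "block Penult = 3"
| "block Last = 4"

instantiation idx :: (linorder) linorder
begin

definition less_idx :: "'a idx \<Rightarrow> 'a idx \<Rightarrow> bool" where
  "i < j \<longleftrightarrow> block i < block j \<or> (\<exists>a b. i = Mid a \<and> j = Mid b \<and> a < b)"

definition less_eq_idx :: "'a idx \<Rightarrow> 'a idx \<Rightarrow> bool" where
  "i \<le> j \<longleftrightarrow> i < j \<or> i = (j :: 'a idx)"

instance
proof
  fix i j k :: "'a idx"
  show "(i < j) = (i \<le> j \<and> \<not> j \<le> i)"
    by (cases i; cases j) (auto simp: less_idx_def less_eq_idx_def)
  show "i \<le> i"
    by (simp add: less_eq_idx_def)
  show "i \<le> j \<Longrightarrow> j \<le> k \<Longrightarrow> i \<le> k"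
    by (cases i; cases j; cases k) (auto simp: less_idx_def less_eq_idx_def)
  show "i \<le> j \<Longrightarrow> j \<le> i \<Longrightarrow> i = j"
    by (cases i; cases j) (auto simp: less_idx_def less_eq_idx_def)
  show "i \<le> j \<or> j \<le> i"
    by (cases i; cases j) (auto simp: less_idx_def less_eq_idx_def)
qed

end

type_synonym 'k mat2n = "real ^ 'k idx ^ 'k idx"

definition qform :: "real ^ 'k::finite idx \<Rightarrow> real" where
  "qform v = 2 * v $ First * v $ Last + 2 * v $ Second * v $ Penult + (\<Sum>i\<in>UNIV. (v $ Mid i)\<^sup>2)"

definition SO2n :: "('k::finite mat2n) monoid" where
  "SO2n = \<lparr>carrier = {A. det A = 1 \<and> (\<forall>v. qform (A *v v) = qform v)}, mult = (**), one = mat 1\<rparr>"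

definition upper_unipotent :: "'k::{finite,linorder} mat2n set" where
  "upper_unipotent = {A. (\<forall>i j. j < i \<longrightarrow> A $ i $ j = 0) \<and> (\<forall>i. A $ i $ i = 1)}"

definition N2n :: "('k::{finite,linorder} mat2n) monoid" where
  "N2n = SO2n\<lparr>carrier := carrier SO2n \<inter> upper_unipotent\<rparr>"

text \<open>Matrix groups carry the subspace topology from the space of all matrices.\<close>

definition closed_subgroup :: "'a::topological_space set \<Rightarrow> 'a monoid \<Rightarrow> bool" where
  "closed_subgroup H G \<longleftrightarrow> subgroup H G \<and> closedin (top_of_set (carrier G)) H"

definition Cartan_decomposition_subgroup :: "'a::topological_space set \<Rightarrow> 'a monoid \<Rightarrow> bool" where
  "Cartan_decomposition_subgroup H G \<longleftrightarrow> closed_subgroup H G \<and> connected H \<and>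
     (\<exists>C. C \<subseteq> carrier G \<and> compact C \<and> C <#>\<^bsub>G\<^esub> H <#>\<^bsub>G\<^esub> C = carrier G)"

text \<open>
  The multiplication of the type class \<open>times\<close> on \<open>real ^ 'm ^ 'm\<close> is componentwise, so neither
  \<open>exp\<close> nor \<open>(^)\<close> of the library is the matrix operation.
\<close>

definition mat_exp :: "real ^ 'm ^ 'm::finite \<Rightarrow> real ^ 'm ^ 'm" where
  "mat_exp X = (\<Sum>k. (1 / fact k) *\<^sub>R (((**) X ^^ k) (mat 1)))"

definition Lie_algebra :: "(real ^ 'm ^ 'm::finite) set \<Rightarrow> (real ^ 'm ^ 'm) set" where
  "Lie_algebra H = {X. \<forall>t. mat_exp (t *\<^sub>R X) \<in> H}"

text \<open>The dimension of a closed matrix group is the vector-space dimension of its Lie algebra.\<close>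

definition Lie_dim :: "(real ^ 'm ^ 'm::finite) set \<Rightarrow> nat" where
  "Lie_dim H = dim (Lie_algebra H)"

definition n_elt :: "real \<Rightarrow> real ^ 'k \<Rightarrow> real ^ 'k \<Rightarrow> real \<Rightarrow> 'k::finite mat2n" where
  "n_elt \<phi> x y \<eta> = (\<chi> i j. case (i, j) of
       (First, Second) \<Rightarrow> \<phi>
     | (First, Mid k) \<Rightarrow> x $ k
     | (First, Penult) \<Rightarrow> \<eta>
     | (Second, Mid k) \<Rightarrow> y $ k
     | (Second, Last) \<Rightarrow> - \<eta>
     | (Mid k, Penult) \<Rightarrow> - y $ k
     | (Mid k, Last) \<Rightarrow> - x $ k
     | (Penult, Last) \<Rightarrow> - \<phi>
     | _ \<Rightarrow> 0)"

definition u_alpha_2beta :: "'k::finite mat2n set" where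
  "u_alpha_2beta = range (n_elt 0 0 0)"

end

theory Submission
  imports Defs
begin

text \<open>
  By the Cartan decomposition \<open>G = K A K\<close>, the double coset \<open>K g K\<close> is determined by two numbers \<open>a \<ge> b \<ge> 1\<close>,
  and \<open>C H C = G\<close> holds for some compact \<open>C\<close> iff every pair \<open>a \<ge> b \<ge> 1\<close> is attained on \<open>H\<close> up to bounded
  factors. Up to bounded factors, \<open>a\<close> is the size and \<open>a * b\<close> the determinant of the \<open>2 \<times> 2\<close> block of \<open>g\<close> on
  the negative definite plane. On \<open>N\<close> this determinant is, in exponential coordinates, a polynomial that is a sum
  of squares and of a Gram determinant, so both quantities are easy to estimate.

  Von Neumann's argument shows that \<open>H\<close> is the exponential of a subalgebra. If a subalgebra has an element of type
  (a) and one of type (b), brackets reduce it to a few two-dimensional families; in each of them there is a curve of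
  nearly constant size \<open>a\<close> along which \<open>a * b\<close> runs from the order of \<open>a\<close> to the order of \<open>a\<^sup>2\<close>, and the intermediate
  value theorem gives all pairs. Conversely, if there is no element of type (b), then \<open>a * b = O(a)\<close> on \<open>H\<close>; if there
  is none of type (a), then either \<open>a\<^sup>2 = O(a * b)\<close>, or (1) holds, or \<open>H\<close> is a one-parameter group with \<open>a\<close> of
  order \<open>t ^ 4\<close> and \<open>a * b\<close> of order \<open>t ^ 6\<close>.
\<close>

section \<open>The form and the maximal compact subgroup\<close>

text \<open>The 2 x 2 block can stand for the exterior square of the whole matrix because
  \<open>KO\<close> commutes with \<open>Jm\<close>: compression turns multiplication by
  \<open>KO\<close> on either side into multiplication by orthogonal 2 x 2 matrices. The gain is
  that on \<open>N\<close> the determinant has no cancellation: every term of \<open>npd\<close> is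
  nonnegative, so a single term bounds it from below. The size does cancel, since
  \<open>corner\<close>, its entry of highest degree, has terms of both signs. Where this matters,
  one parameter of the curve is solved for so that \<open>corner\<close> stays under control, while
  the other raises a single contribution to \<open>npd\<close>: the norm, the Gram determinant or
  the shifted square of \<eta>. The sizes \<open>r ^ 2\<close>, \<open>r ^ 6\<close> and
  \<open>r ^ 12\<close> only let the ends of the curves be integer powers of \<open>r\<close>. Among
  elements with \<open>y = 0\<close>, condition (ii) is the vanishing of \<open>corner\<close>. In
  condition (1), an element with \<phi> and \<open>y\<close> nonzero has size of order t^4 along its
  line, and a multiple of the \<eta>-axis cancels the leading term.\<close>

declare transpose_matrix_vector [simp del]

lemma sum_idx:
  "sum f (UNIV :: 'k::finite idx set) =
    f First + f Second + (\<Sum>k\<in>UNIV. f (Mid k)) + f Penult + (f Last :: 'b::comm_monoid_add)"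
proof -
  have "sum f (UNIV :: 'k idx set) = sum f {First, Second, Penult, Last} + sum f (range Mid)"
    unfolding UNIV_idx by (intro sum.union_disjoint) auto
  also have "sum f (range (Mid :: 'k \<Rightarrow> _)) = (\<Sum>k\<in>UNIV. f (Mid k))"
    by (subst sum.reindex) (auto simp: inj_on_def)
  finally show ?thesis by (simp add: ac_simps)
qed

fun opp :: "'k idx \<Rightarrow> 'k idx" where
  "opp First = Last"
| "opp Second = Penult"
| "opp (Mid i) = Mid i"
| "opp Penult = Second"
| "opp Last = First"

lemma opp_opp [simp]: "opp (opp i) = i"
  by (cases i) auto

text \<open>The Gram matrix of the form. It is a symmetric orthogonal involution, so its eigenspaces
  for 1 and -1 are orthogonal, and on them the form is plus or minus the Euclidean square.\<close>

definition Jm :: "'k::finite mat2n" where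
  "Jm = (\<chi> i j. if j = opp i then 1 else 0)"

lemma Jm_vec [simp]: "(Jm *v v) $ i = v $ opp i"
  by (simp add: Jm_def matrix_vector_mult_def if_distrib[of "\<lambda>x. x * _"] cong: if_cong)

lemma Jm_Jm_vec [simp]: "Jm *v (Jm *v v) = v"
  by (simp add: vec_eq_iff)

lemma Jm_Jm: "Jm ** Jm = mat 1"
  by (simp add: matrix_eq matrix_vector_mul_assoc[symmetric])

lemma transpose_Jm [simp]: "transpose Jm = Jm"
proof -
  have "i = opp j \<longleftrightarrow> j = opp i" for i j :: "'a idx" by auto
  then show ?thesis by (simp add: transpose_def Jm_def vec_eq_iff)
qed

lemma Jm_inner: "(Jm *v u) \<bullet> v = u \<bullet> (Jm *v v)"
  by (metis dot_lmul_matrix transpose_Jm vector_transpose_matrix)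

lemma norm_Jm [simp]: "norm (Jm *v v) = norm v"
  by (simp add: norm_eq_sqrt_inner Jm_inner)

lemma qform_eq: "qform v = v \<bullet> (Jm *v v)"
  by (simp add: qform_def inner_vec_def sum_idx power2_eq_square)

lemma adjoint: "(A *v u) \<bullet> v = u \<bullet> (transpose A *v v)" for A :: "real^'n^'n"
  by (metis dot_lmul_matrix vector_transpose_matrix transpose_transpose)

text \<open>The full isometry group O(2,n). The determinant is left free because reflections are
  used below; \<open>KAK\<close> restores it.\<close>

definition OJ :: "'k::finite mat2n set" where
  "OJ = {A. transpose A ** Jm ** A = Jm}"

lemma OJ_vec: "A \<in> OJ \<longleftrightarrow> (\<forall>v. transpose A *v (Jm *v (A *v v)) = Jm *v v)"
  by (simp add: OJ_def matrix_eq matrix_vector_mul_assoc matrix_mul_assoc)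

lemma OJ_inner: "A \<in> OJ \<longleftrightarrow> (\<forall>u v. (A *v u) \<bullet> (Jm *v (A *v v)) = u \<bullet> (Jm *v v))"
  unfolding OJ_vec adjoint by (auto simp: vector_eq_rdot) (metis vector_eq_ldot)

lemma OJ_qform: "A \<in> OJ \<longleftrightarrow> (\<forall>v. qform (A *v v) = qform v)"
proof
  assume h: "\<forall>v. qform (A *v v) = qform v"
  have pol: "qform (u + v) = qform u + qform v + 2 * (u \<bullet> (Jm *v v))" for u v :: "real^'a idx"
    by (simp add: qform_eq matrix_vector_right_distrib inner_add_left inner_add_right)
      (metis Jm_inner inner_commute)
  show "A \<in> OJ"
    unfolding OJ_inner
  proof (intro allI)
    fix u v
    have "qform (A *v u + A *v v) = qform (u + v)"
      using h by (metis matrix_vector_right_distrib)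
    then show "(A *v u) \<bullet> (Jm *v (A *v v)) = u \<bullet> (Jm *v v)"
      using h by (simp add: pol)
  qed
qed (simp add: OJ_inner qform_eq)

lemma carrier_SO2n: "carrier SO2n = {A. det A = 1 \<and> A \<in> OJ}"
  by (auto simp: SO2n_def OJ_qform)

lemma OJ_inv_left: "A \<in> OJ \<Longrightarrow> (Jm ** transpose A ** Jm) ** A = mat 1"
  by (simp add: OJ_def matrix_mul_assoc[symmetric] Jm_Jm)

lemma OJ_inv_right: "A \<in> OJ \<Longrightarrow> A ** (Jm ** transpose A ** Jm) = mat 1"
  using OJ_inv_left matrix_left_right_inverse by blast

lemma OJ_transpose:
  assumes "A \<in> OJ" shows "transpose A \<in> OJ"
proof -
  have "A ** (Jm ** transpose A ** Jm) ** Jm = Jm"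
    by (simp add: OJ_inv_right[OF assms])
  then have "A ** Jm ** transpose A ** (Jm ** Jm) = Jm"
    by (simp add: matrix_mul_assoc)
  then show ?thesis by (simp add: OJ_def Jm_Jm)
qed

lemma OJ_mult: "A \<in> OJ \<Longrightarrow> B \<in> OJ \<Longrightarrow> A ** B \<in> OJ"
  by (simp add: OJ_inner matrix_vector_mul_assoc[symmetric])

lemma OJ_one: "mat 1 \<in> OJ"
  by (simp add: OJ_inner)

text \<open>The maximal compact subgroup of O(2,n). Its elements commute with \<open>Jm\<close> and
  so preserve both eigenspaces.\<close>

definition KO :: "'k::finite mat2n set" where
  "KO = {k. k \<in> OJ \<and> orthogonal_matrix k}"

lemma KO_OJ: "k \<in> KO \<Longrightarrow> k \<in> OJ"
  by (simp add: KO_def)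

lemma KO_one: "mat 1 \<in> KO"
  by (simp add: KO_def OJ_one orthogonal_matrix_id)

lemma KO_mult: "k \<in> KO \<Longrightarrow> l \<in> KO \<Longrightarrow> k ** l \<in> KO"
  by (simp add: KO_def OJ_mult orthogonal_matrix_mul)

lemma KO_transpose: "k \<in> KO \<Longrightarrow> transpose k \<in> KO"
  by (simp add: KO_def OJ_transpose orthogonal_matrix_transpose)

lemma KO_left: "k \<in> KO \<Longrightarrow> transpose k ** k = mat 1"
  and KO_right: "k \<in> KO \<Longrightarrow> k ** transpose k = mat 1"
  by (auto simp: KO_def orthogonal_matrix_def)

lemma KO_left_vec [simp]: "k \<in> KO \<Longrightarrow> transpose k *v (k *v v) = v"
  and KO_right_vec [simp]: "k \<in> KO \<Longrightarrow> k *v (transpose k *v v) = v"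
  by (auto simp: matrix_vector_mul_assoc KO_left KO_right)

lemma KO_norm: "k \<in> KO \<Longrightarrow> norm (k *v v) = norm v"
  by (simp add: norm_eq_sqrt_inner adjoint)

lemma KO_Jm: 
  assumes "k \<in> KO" shows "Jm *v (k *v v) = k *v (Jm *v v)"
proof -
  have "transpose k *v (Jm *v (k *v v)) = Jm *v v"
    using assms KO_OJ OJ_vec by blast
  then show ?thesis using assms by (metis KO_right_vec)
qed

text \<open>Reflections in vectors of the two eigenspaces of \<open>Jm\<close> supply all rotations that are needed.\<close>

lemma KO_swap:
  fixes a b :: "real ^ 'k::finite idx"
  assumes "norm a = norm b" "Jm *v a = c *\<^sub>R a" "Jm *v b = c *\<^sub>R b"
  obtains k where "k \<in> KO" "k *v a = b" "\<And>w. w \<bullet> (a - b) = 0 \<Longrightarrow> k *v w = w"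
proof (cases "a = b")
  case True
  then show ?thesis using that[of "mat 1"] KO_one by simp
next
  case False
  define z where "z = a - b"
  define r where "r v = v - (2 * (v \<bullet> z) / (z \<bullet> z)) *\<^sub>R z" for v
  have z: "z \<bullet> z \<noteq> 0" "Jm *v z = c *\<^sub>R z"
    using False assms by (auto simp: z_def matrix_vector_mult_diff_distrib scaleR_diff_right)
  have lin: "linear r"
    unfolding r_def by (intro linearI) (simp_all add: inner_add_left algebra_simps add_divide_distrib scaleR_add_left)
  have rr: "r u \<bullet> r v = u \<bullet> v" for u v
    using z(1) by (simp add: r_def inner_diff_left inner_diff_right inner_commute field_simps)
  have Jr: "Jm *v r v = r (Jm *v v)" for v
  proof -
    have "(Jm *v v) \<bullet> z = c * (v \<bullet> z)" by (simp add: Jm_inner z)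
    then show ?thesis
      by (simp add: r_def matrix_vector_mult_diff_distrib z matrix_vector_mult_scaleR mult_ac)
  qed
  have m: "matrix r *v v = r v" for v
    by (simp add: matrix_works lin linear_matrix_vector_mul_eq)
  have "orthogonal_transformation r"
    by (simp add: orthogonal_transformation_def lin rr)
  then have "orthogonal_matrix (matrix r)"
    using orthogonal_transformation_matrix by blast
  moreover have "matrix r \<in> OJ"
    by (simp add: OJ_inner m Jr rr)
  ultimately have "matrix r \<in> KO" by (simp add: KO_def)
  moreover have "r a = b"
  proof -
    have "a \<bullet> a = b \<bullet> b" using assms(1) by (simp add: norm_eq)
    then have "2 * (a \<bullet> z) = z \<bullet> z"
      by (simp add: z_def inner_diff_left inner_diff_right inner_commute)
    then show ?thesis using z(1) by (simp add: r_def) (simp add: z_def)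
  qed
  ultimately show ?thesis
    using that[of "matrix r"] by (simp add: m r_def z_def)
qed

lemma eigen_orth:
  assumes "Jm *v a = a" "Jm *v b = - b" shows "a \<bullet> b = 0"
  by (metis Jm_inner assms inner_minus_right neg_equal_zero)

text \<open>An isotropic unit vector has components of equal length \<open>sqrt (1/2)\<close> in the
  two eigenspaces. One reflection in each eigenspace matches the components, and neither disturbs
  the other one. The last conclusion lets a later use on a smaller subspace keep earlier
  normalizations intact.\<close>

lemma KO_transitive:
  fixes u v :: "real ^ 'k::finite idx"
  assumes uv: "norm u = 1" "norm v = 1" "u \<bullet> (Jm *v u) = 0" "v \<bullet> (Jm *v v) = 0"
  obtains k where "k \<in> KO" "k *v u = v"
    "\<And>w. \<lbrakk>w \<bullet> u = 0; w \<bullet> (Jm *v u) = 0; w \<bullet> v = 0; w \<bullet> (Jm *v v) = 0\<rbrakk> \<Longrightarrow> k *v w = w"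
proof -
  define p q where "p u = (1/2) *\<^sub>R (u + Jm *v u)" and "q u = (1/2) *\<^sub>R (u - Jm *v u)"
    for u :: "real ^ 'k idx"
  have J: "Jm *v p x = p x" "Jm *v q x = - q x" "x = p x + q x" for x
    by (simp_all add: p_def q_def matrix_vector_mult_scaleR matrix_vector_right_distrib
        matrix_vector_mult_diff_distrib algebra_simps flip: scaleR_add_left)
  have n: "norm (p x) = sqrt (1/2)" "norm (q x) = sqrt (1/2)" if "norm x = 1" "x \<bullet> (Jm *v x) = 0" for x
  proof -
    have "x \<bullet> x = 1" using that(1) by (simp add: norm_eq_1)
    then have "p x \<bullet> p x = 1/2" "q x \<bullet> q x = 1/2"
      using that(2) by (simp_all add: p_def q_def inner_add_left inner_add_right inner_diff_left
          inner_diff_right Jm_inner inner_commute[of "Jm *v x" x])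
    then show "norm (p x) = sqrt (1/2)" "norm (q x) = sqrt (1/2)"
      by (simp_all add: norm_eq_sqrt_inner)
  qed
  have pq: "p x \<bullet> q y = 0" for x y
    using eigen_orth J(1,2) .
  obtain k where k: "k \<in> KO" "k *v p u = p v" "\<And>w. w \<bullet> (p u - p v) = 0 \<Longrightarrow> k *v w = w"
    using KO_swap[of "p u" "p v" 1] J n uv by auto
  obtain l where l: "l \<in> KO" "l *v q u = q v" "\<And>w. w \<bullet> (q u - q v) = 0 \<Longrightarrow> l *v w = w"
    using KO_swap[of "q u" "q v" "-1"] J n uv by auto
  have "k *v q u = q u"
    by (rule k(3)) (simp add: inner_diff_right inner_commute[of "q u"] pq)
  then have ku: "k *v u = p v + q u"
    using k(2) J(3)[of u] by (metis matrix_vector_right_distrib)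
  have "l *v p v = p v"
    by (rule l(3)) (simp add: inner_diff_right pq)
  then have "l *v (k *v u) = v"
    unfolding ku using l(2) J(3)[of v] by (metis matrix_vector_right_distrib)
  moreover have "l *v (k *v w) = w"
    if "w \<bullet> u = 0" "w \<bullet> (Jm *v u) = 0" "w \<bullet> v = 0" "w \<bullet> (Jm *v v) = 0" for w
  proof -
    have "k *v w = w" "l *v w = w"
      using that by (auto intro!: k(3) l(3) simp: p_def q_def inner_diff_right inner_add_right)
    then show ?thesis by simp
  qed
  ultimately show ?thesis
    using that[of "l ** k"] k(1) l(1) by (simp add: KO_mult matrix_vector_mul_assoc[symmetric])
qed

lemma quadratic_nonneg_imp_zero:
  fixes b c :: real
  assumes "\<And>t. 2 * t * b + t\<^sup>2 * c \<ge> 0"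
  shows "b = 0"
proof (rule ccontr)
  assume b: "b \<noteq> 0"
  define d where "d = \<bar>c\<bar> + 1"
  have d: "d > 0" "c < d" by (auto simp: d_def)
  \<comment> \<open>The test value \<open>t = - b / d\<close> makes the quadratic negative because
    \<open>d > 0\<close> and \<open>d > c\<close>, whatever the sign of \<open>c\<close>.\<close>
  have "0 \<le> (2 * (- b / d) * b + (- b / d)\<^sup>2 * c) * d\<^sup>2"
    by (rule mult_nonneg_nonneg[OF assms]) simp
  also have "\<dots> = b\<^sup>2 * (c - 2 * d)"
    using d(1) by (simp add: power2_eq_square divide_simps) (simp add: algebra_simps)
  also have "\<dots> < 0"
    using b d by (intro mult_pos_neg) auto
  finally show False by simp
qed

text \<open>First-order condition at a maximum of the norm on the unit sphere of \<open>S\<close>.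
  The variation is along the defect \<open>x\<close> itself, so the resulting nonnegative quadratic
  in \<open>t\<close> has linear coefficient \<open>2 * (x \<bullet> x)\<close>, which must
  vanish.\<close>

lemma maximal_vector:
  fixes g :: "real^'n^'n"
  assumes S: "subspace S" "v \<in> S" "\<And>w. w \<in> S \<Longrightarrow> g *v w \<in> S" "\<And>w. w \<in> S \<Longrightarrow> transpose g *v w \<in> S"
    and v: "norm v = 1" "norm (g *v v) = a" "\<And>w. w \<in> S \<Longrightarrow> norm (g *v w) \<le> a * norm w"
  shows "transpose g *v (g *v v) = a\<^sup>2 *\<^sub>R v"
proof -
  define x where "x = a\<^sup>2 *\<^sub>R v - transpose g *v (g *v v)"
  have x: "x \<in> S" unfolding x_def using S by (intro subspace_diff subspace_scale) auto
  have "2 * t * (x \<bullet> x) + t\<^sup>2 * (a\<^sup>2 * (x \<bullet> x) - (g *v x) \<bullet> (g *v x)) \<ge> 0" for t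
  proof -
    have "v + t *\<^sub>R x \<in> S" using S x by (intro subspace_add subspace_scale) auto
    then have "(norm (g *v (v + t *\<^sub>R x)))\<^sup>2 \<le> (a * norm (v + t *\<^sub>R x))\<^sup>2"
      using v(3) by (intro power_mono) auto
    moreover have "(norm (g *v (v + t *\<^sub>R x)))\<^sup>2 =
        a\<^sup>2 + 2 * t * (x \<bullet> (transpose g *v (g *v v))) + t\<^sup>2 * ((g *v x) \<bullet> (g *v x))"
    proof -
      have e: "(g *v v) \<bullet> (g *v x) = x \<bullet> (transpose g *v (g *v v))"
        by (metis adjoint inner_commute)
      have f: "(g *v v) \<bullet> (g *v v) = a\<^sup>2" using v(2) by (simp add: dot_square_norm)
      show ?thesis
        unfolding power2_norm_eq_inner matrix_vector_right_distrib matrix_vector_mult_scaleR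
        using f by (simp add: inner_add_left inner_add_right inner_commute[of "g *v x" "g *v v"] e power2_eq_square algebra_simps)
    qed
    moreover have "(a * norm (v + t *\<^sub>R x))\<^sup>2 = a\<^sup>2 + 2 * t * (x \<bullet> (a\<^sup>2 *\<^sub>R v)) + t\<^sup>2 * (a\<^sup>2 * (x \<bullet> x))"
    proof -
      have "v \<bullet> v = 1" using v(1) by (simp add: norm_eq_1)
      then show ?thesis
        unfolding power_mult_distrib power2_norm_eq_inner
        by (simp add: inner_add_left inner_add_right inner_commute[of v x] power2_eq_square algebra_simps)
    qed
    moreover have "x \<bullet> x = x \<bullet> (a\<^sup>2 *\<^sub>R v) - x \<bullet> (transpose g *v (g *v v))"
      by (subst (2) x_def) (simp only: inner_diff_right)
    moreover have "2 * t * (x \<bullet> x) = 2 * t * (x \<bullet> (a\<^sup>2 *\<^sub>R v)) - 2 * t * (x \<bullet> (transpose g *v (g *v v)))"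
      using calculation by (simp only: right_diff_distrib)
    ultimately show ?thesis by (simp only: right_diff_distrib)
  qed
  then have "x \<bullet> x = 0" by (rule quadratic_nonneg_imp_zero)
  then show ?thesis by (simp add: x_def)
qed

text \<open>The distinction on \<open>a\<close> makes the singular vector isotropic. If
  \<open>a\<close> is not 1, then \<open>v0\<close> is an eigenvector of the form isometry
  \<open>transpose g ** g\<close> for \<open>a\<^sup>2\<close>, so its form value equals
  \<open>a ^ 4\<close> times itself and vanishes. If \<open>a = 1\<close>, both \<open>g\<close> and
  its inverse are contractions on \<open>S\<close>, so the given isotropic \<open>e\<close> already
  attains the maximum.\<close>

lemma singular_step:
  fixes g :: "'k::finite mat2n"
  assumes g: "g \<in> OJ" and S: "subspace S" "\<And>w. w \<in> S \<Longrightarrow> g *v w \<in> S"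
      "\<And>w. w \<in> S \<Longrightarrow> transpose g *v w \<in> S" "\<And>w. w \<in> S \<Longrightarrow> Jm *v w \<in> S"
    and e: "e \<in> S" "norm e = 1" "e \<bullet> (Jm *v e) = 0"
  obtains a u v where "a \<ge> 1" "u \<in> S" "v \<in> S" "norm u = 1" "norm v = 1"
    "u \<bullet> (Jm *v u) = 0" "v \<bullet> (Jm *v v) = 0" "g *v v = a *\<^sub>R u" "transpose g *v u = a *\<^sub>R v"
    "\<And>w. w \<in> S \<Longrightarrow> norm (g *v w) \<le> a * norm w"
proof -
  note concl = that
  have comp: "compact (S \<inter> sphere 0 1)"
    using S(1) by (intro closed_Int_compact closed_subspace) auto
  have "continuous_on (S \<inter> sphere 0 1) (\<lambda>v. norm (g *v v))"
    by (intro continuous_intros)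
  moreover have "S \<inter> sphere 0 1 \<noteq> {}" using e by auto
  ultimately obtain v0 where v0: "v0 \<in> S" "norm v0 = 1"
    "\<And>w. w \<in> S \<Longrightarrow> norm w = 1 \<Longrightarrow> norm (g *v w) \<le> norm (g *v v0)"
    using continuous_attains_sup[OF comp] by fastforce
  define a where "a = norm (g *v v0)"
  have le: "norm (g *v w) \<le> a * norm w" if "w \<in> S" for w
  proof (cases "w = 0")
    case False
    have "norm (g *v ((1 / norm w) *\<^sub>R w)) \<le> a"
      unfolding a_def using False that S(1) by (intro v0(3)) (auto intro: subspace_scale)
    then show ?thesis using False by (simp add: matrix_vector_mult_scaleR field_simps)
  qed auto
  have q: "(g *v w) \<bullet> (Jm *v (g *v w)) = w \<bullet> (Jm *v w)" for w
    using g by (simp add: OJ_inner)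
  \<comment> \<open>On \<open>p\<close>, which \<open>Jm\<close> fixes, the form is the squared
    norm; \<open>g\<close> preserves the form, and the form never exceeds the squared norm.\<close>
  have a1: "a \<ge> 1"
  proof -
    define p where "p = e + Jm *v e"
    have p: "p \<in> S" "Jm *v p = p" 
      using e S by (auto simp: p_def matrix_vector_right_distrib intro: subspace_add)
    have "p \<bullet> p = 2"
      using e by (simp add: p_def inner_add_left inner_add_right Jm_inner inner_commute[of "Jm *v e" e] norm_eq_1)
    then have n: "(norm p)\<^sup>2 = 2" by (simp add: power2_norm_eq_inner)
    have "2 = (g *v p) \<bullet> (Jm *v (g *v p))" using q[of p] \<open>p \<bullet> p = 2\<close> p(2) by simp
    also have "\<dots> \<le> norm (g *v p) * norm (g *v p)"
      using norm_cauchy_schwarz[of "g *v p" "Jm *v (g *v p)"] by simp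
    also have "\<dots> = (norm (g *v p))\<^sup>2" by (simp add: power2_eq_square)
    also have "\<dots> \<le> (a * norm p)\<^sup>2"
      using le[OF p(1)] by (intro power_mono) auto
    finally have "1 \<le> a\<^sup>2" using n by (simp add: power_mult_distrib)
    then show ?thesis using power2_le_imp_le[of 1 a] by (simp add: a_def)
  qed
  have main: ?thesis if v: "v \<in> S" "norm v = 1" "norm (g *v v) = a" "v \<bullet> (Jm *v v) = 0" for v
  proof -
    define u where "u = (1 / a) *\<^sub>R (g *v v)"
    have gg: "transpose g *v (g *v v) = a\<^sup>2 *\<^sub>R v"
      using maximal_vector[OF S(1) v(1) S(2,3) v(2,3) le] .
    have "u \<bullet> (Jm *v u) = 0"
      using v(4) q[of v] by (simp add: u_def matrix_vector_mult_scaleR)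
    moreover have "transpose g *v u = a *\<^sub>R v" 
      using a1 by (simp add: u_def gg matrix_vector_mult_scaleR power2_eq_square)
    moreover have "u \<in> S" using S v(1) by (auto simp: u_def intro: subspace_scale)
    moreover have "norm u = 1" "g *v v = a *\<^sub>R u" using v(3) a1 by (auto simp: u_def)
    ultimately show ?thesis
      using concl[of a u v] v a1 le by blast
  qed
  show ?thesis
  proof (cases "a = 1")
    case True
    have tle: "norm (transpose g *v w) \<le> norm w" if "w \<in> S" for w
    proof (cases "transpose g *v w = 0")
      case False
      have "norm (transpose g *v w) * norm (transpose g *v w) = (transpose g *v w) \<bullet> (transpose g *v w)"
        by (metis power2_eq_square power2_norm_eq_inner)
      also have "\<dots> = w \<bullet> (g *v (transpose g *v w))"
        by (simp add: adjoint)
      also have "\<dots> \<le> norm w * norm (g *v (transpose g *v w))"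
        by (rule norm_cauchy_schwarz)
      also have "\<dots> \<le> norm w * norm (transpose g *v w)"
        using le[OF S(3)[OF that]] True by (intro mult_left_mono) auto
      finally show ?thesis using False by simp
    qed auto
    have "norm e \<le> norm (g *v e)"
    proof -
      have "Jm *v (transpose g *v (Jm *v (g *v e))) = e"
        using g by (simp add: OJ_vec)
      then have "norm e = norm (transpose g *v (Jm *v (g *v e)))"
        by (metis norm_Jm)
      also have "\<dots> \<le> norm (g *v e)"
        using tle[OF S(4)[OF S(2)[OF e(1)]]] by simp
      finally show ?thesis .
    qed
    then have "norm (g *v e) = a" using le[OF e(1)] True e(2) by simp
    then show ?thesis using main e by blast
  next
    case False
    have gg: "transpose g *v (g *v v0) = a\<^sup>2 *\<^sub>R v0"
      using maximal_vector[OF S(1) v0(1) S(2,3) v0(2) _ le] by (simp add: a_def)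
    have "(transpose g *v (g *v v0)) \<bullet> (Jm *v (transpose g *v (g *v v0))) = v0 \<bullet> (Jm *v v0)"
      using OJ_transpose[OF g] g by (simp add: OJ_inner)
    then have "(a\<^sup>2 * a\<^sup>2 - 1) * (v0 \<bullet> (Jm *v v0)) = 0"
      by (simp add: gg matrix_vector_mult_scaleR algebra_simps)
    moreover have "a\<^sup>2 * a\<^sup>2 > 1" using a1 False by (intro less_1_mult one_less_power) auto
    ultimately have "v0 \<bullet> (Jm *v v0) = 0" by simp
    then show ?thesis using main v0 by (auto simp: a_def)
  qed
qed

section \<open>The Cartan decomposition\<close>

abbreviation ax :: "'k::finite idx \<Rightarrow> real ^ 'k idx" where
  "ax i \<equiv> axis i 1"

lemma Jm_ax [simp]: "Jm *v ax i = ax (opp i)"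
proof -
  have "opp j = i \<longleftrightarrow> j = opp i" for j by auto
  then show ?thesis by (simp add: vec_eq_iff axis_def)
qed

lemma ax_inner [simp]: "ax i \<bullet> ax j = (if i = j then 1 else 0)"
  by (simp add: inner_axis_axis)

lemma mat_entry: "ax i \<bullet> (A *v ax j) = A $ i $ j"
  by (simp add: inner_axis' matrix_vector_mult_basis column_def)

text \<open>Diagonal of an element of the split torus \<open>A\<close>: opposite positions carry
  inverse entries.\<close>

fun dge :: "real \<Rightarrow> real \<Rightarrow> 'k idx \<Rightarrow> real" where
  "dge a b First = a"
| "dge a b Second = b"
| "dge a b (Mid i) = 1"
| "dge a b Penult = 1 / b"
| "dge a b Last = 1 / a"

definition dg :: "real \<Rightarrow> real \<Rightarrow> 'k::finite mat2n" where
  "dg a b = (\<chi> i j. if i = j then dge a b i else 0)"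

lemma dg_vec [simp]: "(dg a b *v v) $ i = dge a b i * v $ i"
  by (simp add: dg_def matrix_vector_mult_def if_distrib[of "\<lambda>x. x * _"] cong: if_cong)

lemma dg_mult: "dg a b ** dg c d = dg (a * c) (b * d)"
proof -
  have "dge a b i * dge c d i = dge (a * c) (b * d) i" for i :: "'a idx"
    by (cases i) auto
  then show ?thesis
    by (simp add: matrix_eq vec_eq_iff matrix_vector_mul_assoc[symmetric] mult.assoc[symmetric])
qed

lemma dg_one: "dg 1 1 = mat 1"
proof -
  have "dge 1 1 i = 1" for i :: "'a idx" by (cases i) auto
  then show ?thesis by (simp add: matrix_eq vec_eq_iff)
qed

lemma transpose_dg [simp]: "transpose (dg a b) = dg a b"
  by (auto simp: transpose_def dg_def vec_eq_iff)

lemma dg_OJ: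
  assumes "a \<noteq> 0" "b \<noteq> 0" shows "dg a b \<in> OJ"
proof -
  have "dge a b i * dge a b (opp i) = 1" for i :: "'a idx"
    using assms by (cases i) auto
  then show ?thesis
    by (simp add: OJ_vec vec_eq_iff mult.assoc[symmetric])
qed

lemma det_dg:
  assumes "a \<noteq> 0" "b \<noteq> 0" shows "det (dg a b :: 'k::finite mat2n) = 1"
proof -
  have "prod (dge a b) (UNIV :: 'k idx set) =
      prod (dge a b) {First, Second, Penult, Last :: 'k idx} * prod (dge a b) (range (Mid :: 'k \<Rightarrow> _))"
    unfolding UNIV_idx by (intro prod.union_disjoint) auto
  also have "prod (dge a b) (range (Mid :: 'k \<Rightarrow> _)) = 1"
    by (intro prod.neutral) auto
  finally show ?thesis
    using assms by (subst det_diagonal) (auto simp: dg_def)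
qed

lemma OJ_fixed_dual:
  fixes g :: "'k::finite mat2n"
  assumes "g \<in> OJ" "a \<noteq> 0" "g *v ax i = a *\<^sub>R ax i" 
  shows "transpose g *v ax (opp i) = (1 / a) *\<^sub>R ax (opp i)"
proof -
  have "transpose g *v (Jm *v (g *v ax i)) = Jm *v ax i"
    using assms(1) by (simp only: OJ_vec)
  then have "a *\<^sub>R (transpose g *v ax (opp i)) = ax (opp i)"
    by (simp add: assms(3) matrix_vector_mult_scaleR)
  then have "(1 / a) *\<^sub>R (a *\<^sub>R (transpose g *v ax (opp i))) = (1 / a) *\<^sub>R ax (opp i)"
    by simp
  then show ?thesis using assms(2) by simp
qed

lemma scale_eq:
  assumes "k *v u = (v :: real^'n)" "l *v v' = u'" "g *v u' = a *\<^sub>R u"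
  shows "(k ** g ** l) *v v' = a *\<^sub>R v"
  using assms by (simp add: matrix_vector_mul_assoc[symmetric] matrix_vector_mult_scaleR)

text \<open>Rotates the singular pair onto a coordinate axis. Since \<open>k\<close> and
  \<open>l\<close> fix everything orthogonal to \<open>S\<close>, an application inside
  \<open>S\<close> preserves the axes split off before.\<close>

lemma singular_step':
  fixes g :: "'k::finite mat2n" and i :: "'k idx"
  assumes g: "g \<in> OJ" and S: "subspace S" "\<And>w. w \<in> S \<Longrightarrow> g *v w \<in> S"
      "\<And>w. w \<in> S \<Longrightarrow> transpose g *v w \<in> S" "\<And>w. w \<in> S \<Longrightarrow> Jm *v w \<in> S"
    and i: "ax i \<in> S" "opp i \<noteq> i"
  obtains a k l where "a \<ge> 1" "k \<in> KO" "l \<in> KO"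
    "(k ** g ** l) *v ax i = a *\<^sub>R ax i" "transpose (k ** g ** l) *v ax i = a *\<^sub>R ax i"
    "\<And>w. w \<in> S \<Longrightarrow> norm (g *v w) \<le> a * norm w"
    "\<And>w. (\<And>s. s \<in> S \<Longrightarrow> w \<bullet> s = 0) \<Longrightarrow> k *v w = w \<and> l *v w = w"
proof -
  have ii: "norm (ax i :: real ^ 'k idx) = 1" "ax i \<bullet> (Jm *v ax i) = 0" using i by auto
  obtain a u v where auv: "a \<ge> 1" "u \<in> S" "v \<in> S" "norm u = 1" "norm v = 1"
    "u \<bullet> (Jm *v u) = 0" "v \<bullet> (Jm *v v) = 0" "g *v v = a *\<^sub>R u" "transpose g *v u = a *\<^sub>R v"
    "\<And>w. w \<in> S \<Longrightarrow> norm (g *v w) \<le> a * norm w"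
    using singular_step[OF g S i(1) ii] by blast
  obtain k where k: "k \<in> KO" "k *v u = ax i"
    "\<And>w. \<lbrakk>w \<bullet> u = 0; w \<bullet> (Jm *v u) = 0; w \<bullet> ax i = 0; w \<bullet> (Jm *v ax i) = 0\<rbrakk> \<Longrightarrow> k *v w = w"
    using KO_transitive[OF auv(4) ii(1) auv(6) ii(2)] by blast
  obtain l where l: "l \<in> KO" "l *v ax i = v"
    "\<And>w. \<lbrakk>w \<bullet> ax i = 0; w \<bullet> (Jm *v ax i) = 0; w \<bullet> v = 0; w \<bullet> (Jm *v v) = 0\<rbrakk> \<Longrightarrow> l *v w = w"
    using KO_transitive[OF ii(1) auv(5) ii(2) auv(7)] by blast
  have k': "transpose k *v ax i = u" using KO_left_vec[OF k(1), of u] by (simp add: k(2))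
  have l': "transpose l *v v = ax i" using KO_left_vec[OF l(1), of "ax i"] by (simp add: l(2))
  have "(k ** g ** l) *v ax i = a *\<^sub>R ax i"
    using scale_eq[OF k(2) l(2)] auv by simp
  moreover have "transpose (k ** g ** l) *v ax i = a *\<^sub>R ax i"
    using scale_eq[OF l' k'] auv by (simp add: matrix_transpose_mul matrix_mul_assoc)
  moreover have "k *v w = w \<and> l *v w = w" if "\<And>s. s \<in> S \<Longrightarrow> w \<bullet> s = 0" for w
    by (intro conjI k(3) l(3) that S(4) auv(2,3) i(1))
  ultimately show ?thesis using that[OF auv(1) k(1) l(1) _ _ auv(10)] by blast
qed

lemma KO_cancel:
  assumes "k \<in> KO" shows "transpose k ** (k ** A) = A" "k ** (transpose k ** A) = A"
  using assms by (simp_all add: matrix_mul_assoc KO_left KO_right)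

text \<open>Two singular steps, the second on the complement of the first hyperbolic pair,
  diagonalize the four outer axes. The remaining factor \<open>d\<close> fixes these axes; it is
  shown to be orthogonal and absorbed into the right factor.\<close>

lemma KAK_KO:
  fixes g :: "'k::finite mat2n"
  assumes g: "g \<in> OJ"
  obtains a b k l where "1 \<le> b" "b \<le> a" "k \<in> KO" "l \<in> KO" "g = k ** dg a b ** l"
proof -
  obtain a k l where 1: "a \<ge> 1" "k \<in> KO" "l \<in> KO"
    "(k ** g ** l) *v ax First = a *\<^sub>R ax First" "transpose (k ** g ** l) *v ax First = a *\<^sub>R ax First"
    "\<And>w. norm (g *v w) \<le> a * norm w"
    by (rule singular_step'[of g UNIV First]) (use g in auto)
  define h where "h = k ** g ** l"
  have h: "h \<in> OJ" using g 1 by (simp add: h_def OJ_mult KO_OJ)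
  have h1: "h *v ax First = a *\<^sub>R ax First" "transpose h *v ax First = a *\<^sub>R ax First"
    using 1 by (simp_all add: h_def)
  have h1': "h *v ax Last = (1/a) *\<^sub>R ax Last" "transpose h *v ax Last = (1/a) *\<^sub>R ax Last"
    using OJ_fixed_dual[OF OJ_transpose[OF h] _ h1(2)] OJ_fixed_dual[OF h _ h1(1)] 1(1) by auto
  define S where "S = {w :: real ^ 'k idx. w \<bullet> ax First = 0 \<and> w \<bullet> ax Last = 0}"
  have S: "subspace S" "\<And>w. w \<in> S \<Longrightarrow> h *v w \<in> S"
      "\<And>w. w \<in> S \<Longrightarrow> transpose h *v w \<in> S" "\<And>w. w \<in> S \<Longrightarrow> Jm *v w \<in> S" "ax Second \<in> S"
    by (auto simp: S_def subspace_def inner_add_left adjoint h1 h1' Jm_inner)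
  have "opp Second \<noteq> Second" by simp
  then obtain b k' l' where 2: "b \<ge> 1" "k' \<in> KO" "l' \<in> KO"
    "(k' ** h ** l') *v ax Second = b *\<^sub>R ax Second" 
    "transpose (k' ** h ** l') *v ax Second = b *\<^sub>R ax Second"
    "\<And>w. w \<in> S \<Longrightarrow> norm (h *v w) \<le> b * norm w"
    "\<And>w. (\<And>s. s \<in> S \<Longrightarrow> w \<bullet> s = 0) \<Longrightarrow> k' *v w = w \<and> l' *v w = w"
    using singular_step'[OF h S] by metis
  define f where "f = k' ** h ** l'"
  have f: "f \<in> OJ" using h 2 by (simp add: f_def OJ_mult KO_OJ)
  have kl: "k' *v ax First = ax First" "l' *v ax First = ax First"
    using 2(7)[of "ax First"] by (auto simp: S_def inner_commute)
  have kl': "transpose k' *v ax First = ax First" "transpose l' *v ax First = ax First"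
    using KO_left_vec[OF 2(2), of "ax First"] KO_left_vec[OF 2(3), of "ax First"] kl by auto
  have f1: "f *v ax First = a *\<^sub>R ax First" 
    using scale_eq[OF kl(1) kl(2) h1(1)] by (simp add: f_def)
  have f1t: "transpose f *v ax First = a *\<^sub>R ax First"
    using scale_eq[OF kl'(2) kl'(1) h1(2)] by (simp add: f_def matrix_transpose_mul matrix_mul_assoc)
  have f2: "f *v ax Second = b *\<^sub>R ax Second" "transpose f *v ax Second = b *\<^sub>R ax Second"
    using 2 by (simp_all add: f_def)
  have f3: "f *v ax Last = (1/a) *\<^sub>R ax Last" "f *v ax Penult = (1/b) *\<^sub>R ax Penult"
      "transpose f *v ax Last = (1/a) *\<^sub>R ax Last" "transpose f *v ax Penult = (1/b) *\<^sub>R ax Penult"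
    using OJ_fixed_dual[OF OJ_transpose[OF f] _ f1t] OJ_fixed_dual[OF f _ f1]
      OJ_fixed_dual[OF OJ_transpose[OF f] _ f2(2)] OJ_fixed_dual[OF f _ f2(1)] 1(1) 2(1) by auto
  define d where "d = dg (1/a) (1/b) ** f"
  have ab: "a \<noteq> 0" "b \<noteq> 0" using 1(1) 2(1) by auto
  have d: "d \<in> OJ" using f ab by (simp add: d_def OJ_mult dg_OJ)
  have dax: "dg x y *v ax i = dge x y i *\<^sub>R ax i" for x y and i :: "'k idx"
    by (auto simp: vec_eq_iff axis_def)
  have fd: "f = dg a b ** d"
    using ab by (simp add: d_def matrix_mul_assoc dg_mult dg_one)
  have d4: "d *v ax i = ax i" "transpose d *v ax i = ax i" if "i \<in> {First, Second, Penult, Last}" for i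
    using that ab by (auto simp: d_def matrix_vector_mul_assoc[symmetric] matrix_transpose_mul
        f1 f1t f2 f3 dax matrix_vector_mult_scaleR)
  \<comment> \<open>\<open>Jm\<close> is the identity on the middle coordinates, so the image of
    \<open>Jm - 1\<close> lies in the span of the fixed axes. Once \<open>d\<close> and its
    transpose fix this image, preserving the form amounts to preserving the Euclidean
    product.\<close>
  have dJ: "d *v (Jm *v w - w) = Jm *v w - w" "transpose d *v (Jm *v w - w) = Jm *v w - w" for w
  proof -
    have e: "Jm *v w - w = (w $ Last - w $ First) *\<^sub>R (ax First - ax Last)
        + (w $ Penult - w $ Second) *\<^sub>R (ax Second - ax Penult)" 
      unfolding vec_eq_iff by (intro allI, case_tac i) (auto simp: axis_def)
    show "d *v (Jm *v w - w) = Jm *v w - w" "transpose d *v (Jm *v w - w) = Jm *v w - w"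
      unfolding e by (simp_all add: matrix_vector_right_distrib matrix_vector_mult_scaleR
          matrix_vector_mult_diff_distrib d4)
  qed
  have "transpose d *v (d *v w) = w" for w
  proof -
    have "(Jm *v (d *v w) - d *v w) \<bullet> v = (Jm *v w - w) \<bullet> v" for v
    proof -
      have "(Jm *v (d *v w) - d *v w) \<bullet> v = w \<bullet> (transpose d *v (Jm *v v - v))"
        by (simp add: inner_diff_left Jm_inner inner_diff_right[symmetric] adjoint matrix_vector_mult_diff_distrib)
      also have "\<dots> = (Jm *v w - w) \<bullet> v"
        by (simp add: dJ inner_diff_left inner_diff_right Jm_inner)
      finally show ?thesis .
    qed
    then have "Jm *v (d *v w) - d *v w = Jm *v w - w"
      using vector_eq_rdot by blast
    moreover have "transpose d *v (Jm *v (d *v w)) = Jm *v w"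
      using d by (simp add: OJ_vec)
    moreover have "transpose d *v (Jm *v w - w) = Jm *v w - w" by (rule dJ)
    ultimately show ?thesis
      by (metis add_diff_cancel_left' diff_add_cancel matrix_vector_mult_diff_distrib)
  qed
  then have "transpose d ** d = mat 1"
    by (simp add: matrix_eq matrix_vector_mul_assoc)
  then have dK: "d \<in> KO"
    using d by (simp add: KO_def orthogonal_matrix)
  have "b \<le> a"
  proof -
    have "b = norm (f *v ax Second)" using 2(1) by (simp add: f2)
    also have "\<dots> = norm (g *v (l *v (l' *v ax Second)))"
      using 1(2) 2(2) by (simp add: f_def h_def matrix_vector_mul_assoc[symmetric] KO_norm)
    also have "\<dots> \<le> a"
      using 1(6)[of "l *v (l' *v ax Second)"] 1(3) 2(3) by (simp add: KO_norm)
    finally show ?thesis .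
  qed
  moreover have "g = (transpose k ** transpose k') ** dg a b ** (d ** transpose l' ** transpose l)"
  proof -
    have "(transpose k ** transpose k') ** dg a b ** (d ** transpose l' ** transpose l) =
        transpose k ** (transpose k' ** k') ** k ** g ** l ** (l' ** transpose l') ** transpose l"
    proof -
      have "(transpose k ** transpose k') ** dg a b ** (d ** transpose l' ** transpose l) =
          transpose k ** transpose k' ** (dg a b ** d) ** transpose l' ** transpose l"
        by (simp only: matrix_mul_assoc)
      also have "dg a b ** d = k' ** (k ** g ** l) ** l'"
        unfolding fd[symmetric] f_def h_def ..
      finally show ?thesis by (simp only: matrix_mul_assoc)
    qed
    also have "\<dots> = g"
      using 1 2 by (simp add: matrix_mul_assoc[symmetric] KO_cancel KO_right)
    finally show ?thesis by simp
  qed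
  ultimately show ?thesis
    using that[of b a "transpose k ** transpose k'" "d ** transpose l' ** transpose l"]
      1 2 dK by (simp add: KO_mult KO_transpose)
qed

text \<open>A reflection of determinant -1 that commutes with the torus: inserted on both sides of
  \<open>dg a b\<close>, it corrects the determinants of the compact factors.\<close>

definition mrefl :: "'k \<Rightarrow> 'k::finite mat2n" where
  "mrefl m = (\<chi> i j. if i = j then (if i = Mid m then -1 else 1) else 0)"

lemma mrefl_vec: "(mrefl m *v v) $ i = (if i = Mid m then - v $ i else v $ i)"
  by (simp add: mrefl_def matrix_vector_mult_def if_distrib[of "\<lambda>x. x * _"] cong: if_cong)

lemma mrefl:
  shows "mrefl m \<in> KO" "det (mrefl m) = -1" "mrefl m ** dg a b ** mrefl m = dg a b"
proof -
  have t: "transpose (mrefl m) = mrefl m"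
    by (auto simp: mrefl_def transpose_def vec_eq_iff)
  have o: "opp i = Mid m \<longleftrightarrow> i = Mid m" for i by (cases i) auto
  have "mrefl m \<in> OJ"
    by (simp add: OJ_vec t vec_eq_iff mrefl_vec o)
  moreover have "mrefl m ** mrefl m = mat 1"
    by (simp add: matrix_eq matrix_vector_mul_assoc[symmetric] vec_eq_iff mrefl_vec)
  ultimately show "mrefl m \<in> KO"
    by (simp add: KO_def orthogonal_matrix t)
  show "mrefl m ** dg a b ** mrefl m = dg a b"
    by (simp add: matrix_eq matrix_vector_mul_assoc[symmetric] vec_eq_iff mrefl_vec)
  have "det (mrefl m) = (\<Prod>i\<in>UNIV. if i = Mid m then -1 else 1)"
    by (subst det_diagonal) (auto simp: mrefl_def)
  then show "det (mrefl m) = -1" by simp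
qed

theorem KAK:
  fixes g :: "'k::finite mat2n"
  assumes g: "g \<in> carrier SO2n"
  obtains a b k l where "1 \<le> b" "b \<le> a" "k \<in> KO" "l \<in> KO" "det k = 1" "det l = 1"
    "g = k ** dg a b ** l"
proof -
  have gg: "g \<in> OJ" "det g = 1" using g by (auto simp: carrier_SO2n)
  obtain a b k l where 1: "1 \<le> b" "b \<le> a" "k \<in> KO" "l \<in> KO" "g = k ** dg a b ** l"
    by (rule KAK_KO[OF gg(1)])
  have "det k * det l = 1"
    using gg 1 by (simp add: det_mul det_dg)
  moreover have "det k = 1 \<or> det k = -1"
    using 1 det_orthogonal_matrix by (auto simp: KO_def)
  ultimately consider "det k = 1" "det l = 1" | "det k = -1" "det l = -1" by auto
  then show ?thesis
  proof cases
    assume "det k = 1" "det l = 1"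
    with 1 show ?thesis by (intro that[of b a k l])
  next
    assume 2: "det k = -1" "det l = -1"
    \<comment> \<open>Any middle coordinate serves; \<open>undefined\<close> merely names
      one.\<close>
    let ?r = "mrefl undefined"
    have "g = (k ** ?r) ** dg a b ** (?r ** l)"
    proof -
      have "(k ** ?r) ** dg a b ** (?r ** l) = k ** (?r ** dg a b ** ?r) ** l"
        by (simp add: matrix_mul_assoc)
      then show ?thesis using 1 by (simp add: mrefl)
    qed
    then show ?thesis
      using that[of b a "k ** ?r" "?r ** l"] 1 2 by (simp add: KO_mult mrefl det_mul)
  qed
qed

section \<open>Size functions on double cosets\<close>

definition fv :: "2 \<Rightarrow> real ^ 'k::finite idx" where
  "fv i = (if i = 1 then ax First - ax Last else ax Second - ax Penult)"

text \<open>\<open>blk g\<close> is the compression of \<open>g\<close> to the negative definite plane \<open>{v. Jm *v v = - v}\<close>, in the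
  orthonormal basis \<open>fv i / sqrt 2\<close>. For \<open>g = dg a b\<close> it is diagonal with entries \<open>cosh (ln a)\<close> and \<open>cosh (ln b)\<close>.\<close>

definition blk :: "'k::finite mat2n \<Rightarrow> real^2^2" where
  "blk g = (\<chi> i j. (1/2) * (fv i \<bullet> (g *v fv j)))"

lemma matrix_vector_mult_uminus: "A *v (- x) = - (A *v x)" for A :: "real^'n^'m"
  by (metis matrix_vector_mult_scaleR scaleR_minus1_left)

lemma dg_ax [simp]: "dg a b *v ax i = dge a b i *\<^sub>R ax i"
  by (auto simp: vec_eq_iff axis_def)

lemma Jm_fv: "Jm *v fv i = - fv i"
  by (simp add: fv_def matrix_vector_mult_diff_distrib)

lemma fv_expand:
  assumes "Jm *v w = - w"
  shows "w = (\<Sum>j\<in>UNIV. ((1/2) * (fv j \<bullet> w)) *\<^sub>R fv j)"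
proof -
  have "w $ opp i = - w $ i" for i using assms by (metis Jm_vec vector_uminus_component)
  from this[of First] this[of Second] this[of "Mid _"]
  have "w $ Last = - w $ First" "w $ Penult = - w $ Second" "\<And>m. w $ Mid m = 0" by auto
  moreover have "fv 1 \<bullet> w = w $ First - w $ Last" "fv 2 \<bullet> w = w $ Second - w $ Penult"
    by (auto simp: fv_def inner_diff_left inner_axis')
  ultimately show ?thesis
    unfolding vec_eq_iff sum_2
    by (intro allI, case_tac i) (auto simp: fv_def axis_def)
qed

lemma blk_transpose: "blk (transpose g) = transpose (blk g)"
  by (auto simp: blk_def transpose_def vec_eq_iff adjoint[symmetric] inner_commute[of "g *v _"]
      simp del: transpose_matrix_vector) (metis adjoint inner_commute transpose_def)

text \<open>Compression is not multiplicative in general. It is here because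
  \<open>transpose k\<close> maps the negative definite plane to itself and acts on the
  \<open>fv i\<close> by the rows of \<open>blk k\<close>.\<close>

lemma blk_mult_left:
  assumes k: "k \<in> KO"
  shows "blk (k ** g) = blk k ** blk g"
proof -
  have *: "transpose k *v fv i = (\<Sum>l\<in>UNIV. (blk k $ i $ l) *\<^sub>R fv l)" for i
  proof -
    have "Jm *v (transpose k *v fv i) = - (transpose k *v fv i)"
      using KO_Jm[OF KO_transpose[OF k]] by (simp add: Jm_fv matrix_vector_mult_uminus)
    then have "transpose k *v fv i = (\<Sum>j\<in>UNIV. ((1/2) * (fv j \<bullet> (transpose k *v fv i))) *\<^sub>R fv j)"
      by (rule fv_expand)
    moreover have "fv j \<bullet> (transpose k *v fv i) = fv i \<bullet> (k *v fv j)" for j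
      by (metis adjoint inner_commute)
    ultimately show ?thesis by (simp add: blk_def)
  qed
  have "fv i \<bullet> ((k ** g) *v fv j) = (\<Sum>l\<in>UNIV. blk k $ i $ l * (fv l \<bullet> (g *v fv j)))" for i j
  proof -
    have "fv i \<bullet> ((k ** g) *v fv j) = (transpose k *v fv i) \<bullet> (g *v fv j)"
      by (simp add: adjoint matrix_vector_mul_assoc[symmetric])
    then show ?thesis by (simp add: * inner_sum_left)
  qed
  then show ?thesis
    by (simp add: vec_eq_iff matrix_matrix_mult_def) (simp add: blk_def sum_distrib_left mult_ac)
qed

lemma blk_mult_right:
  assumes k: "k \<in> KO"
  shows "blk (g ** k) = blk g ** blk k"
proof -
  have "transpose (blk (g ** k)) = transpose (blk g ** blk k)"
    using blk_mult_left[OF KO_transpose[OF k], of "transpose g"]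
    by (simp add: blk_transpose[symmetric] matrix_transpose_mul)
  then show ?thesis by (metis transpose_transpose)
qed

lemma blk_one: "blk (mat 1) = mat 1"
  by (simp add: blk_def vec_eq_iff forall_2 fv_def inner_diff_left inner_diff_right) (simp add: mat_def)

lemma blk_dg: "blk (dg a b) = (\<chi> i j. if i = j then (if i = 1 then (a + 1/a)/2 else (b + 1/b)/2) else 0)"
  by (simp add: blk_def vec_eq_iff forall_2 fv_def inner_diff_left inner_diff_right
      matrix_vector_mult_diff_distrib)

lemma blk_KO:
  assumes "k \<in> KO" shows "orthogonal_matrix (blk k)"
  unfolding orthogonal_matrix
  by (simp add: blk_transpose[symmetric] blk_mult_left[symmetric] KO_transpose assms KO_left blk_one)

lemma orthogonal_entry_le:
  fixes k :: "real^'n^'n"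
  assumes "orthogonal_matrix k" shows "\<bar>k $ i $ j\<bar> \<le> 1"
proof -
  have "\<bar>k $ i $ j\<bar> \<le> norm (k $ i)" by (rule component_le_norm_cart)
  also have "norm (k $ i) = 1"
    using assms orthogonal_matrix_orthonormal_rows[of k] by (simp add: row_def)
  finally show ?thesis .
qed

definition pn :: "'k::finite mat2n \<Rightarrow> real" where
  "pn g = (\<Sum>i\<in>UNIV. \<Sum>j\<in>UNIV. \<bar>blk g $ i $ j\<bar>)"

definition pd :: "'k::finite mat2n \<Rightarrow> real" where
  "pd g = det (blk g)"

text \<open>The local \<open>c x\<close> is cosh (ln x), which lies between \<open>x / 2\<close> and
  \<open>x\<close>. Orthogonal factors keep the absolute determinant and change the entry sum by a
  bounded factor; each of the four entries is at most \<open>2 * a\<close>.\<close>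

lemma KAK_pn_pd:
  fixes k l :: "'k::finite mat2n"
  assumes kl: "k \<in> KO" "l \<in> KO" and ab: "1 \<le> b" "b \<le> a"
  shows "a / 2 \<le> pn (k ** dg a b ** l)" "pn (k ** dg a b ** l) \<le> 8 * a"
    "a * b / 4 \<le> \<bar>pd (k ** dg a b ** l)\<bar>" "\<bar>pd (k ** dg a b ** l)\<bar> \<le> a * b"
proof -
  define g where "g = k ** dg a b ** l"
  define c where "c x = (x + 1/x)/2" for x :: real
  have c: "x / 2 \<le> c x" "c x \<le> x" if "1 \<le> x" for x
  proof -
    have "1/x \<le> 1" "1/x \<ge> 0" using that by auto
    then have "x \<le> x + 1/x" "x + 1/x \<le> 2 * x" using that by linarith+
    then show "x / 2 \<le> c x" "c x \<le> x" by (simp_all only: c_def, simp_all)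
  qed
  have c0: "c a \<ge> 0" "c b \<ge> 0" "c a \<le> a" "c b \<le> a"
    using c(1)[of a] c(2)[of a] c(1)[of b] c(2)[of b] ab by linarith+
  have g: "blk g = blk k ** blk (dg a b :: 'k mat2n) ** blk l"
    by (simp add: g_def blk_mult_left blk_mult_right kl)
  have D: "blk (dg a b :: 'k mat2n) = (\<chi> i j. if i = j then (if i = 1 then c a else c b) else 0)"
    unfolding c_def by (rule blk_dg)
  have dD: "det (blk (dg a b :: 'k mat2n)) = c a * c b" by (simp add: D det_2)
  have "\<bar>det (blk k)\<bar> = 1" "\<bar>det (blk l)\<bar> = 1"
    using det_orthogonal_matrix[OF blk_KO] kl by fastforce+
  then have pd: "\<bar>pd g\<bar> = c a * c b"
    using c0 by (simp add: pd_def g det_mul dD abs_mult)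
  have "(a/2) * (b/2) \<le> c a * c b"
    using c ab c0 by (intro mult_mono) auto
  then show "a * b / 4 \<le> \<bar>pd (k ** dg a b ** l)\<bar>" using pd by (simp add: g_def)
  have "c a * c b \<le> a * b" using c ab c0 by (intro mult_mono) auto
  then show "\<bar>pd (k ** dg a b ** l)\<bar> \<le> a * b" using pd by (simp add: g_def)
  have ke: "\<bar>blk k $ i $ j\<bar> \<le> 1" "\<bar>blk l $ i $ j\<bar> \<le> 1" for i j
    using orthogonal_entry_le[OF blk_KO[OF kl(1)]] orthogonal_entry_le[OF blk_KO[OF kl(2)]] by auto
  have "\<bar>blk g $ i $ j\<bar> \<le> 2 * a" for i j
  proof -
    have "blk g $ i $ j = blk k $ i $ 1 * c a * blk l $ 1 $ j + blk k $ i $ 2 * c b * blk l $ 2 $ j"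
      by (simp add: g D matrix_matrix_mult_def sum_2)
    moreover have "\<bar>blk k $ i $ 1 * c a * blk l $ 1 $ j\<bar> \<le> 1 * a * 1"
      unfolding abs_mult using ke c0 by (intro mult_mono) auto
    moreover have "\<bar>blk k $ i $ 2 * c b * blk l $ 2 $ j\<bar> \<le> 1 * a * 1"
      unfolding abs_mult using ke c0 by (intro mult_mono) auto
    ultimately show ?thesis by linarith
  qed
  from this[of 1 1] this[of 1 2] this[of 2 1] this[of 2 2]
  show "pn (k ** dg a b ** l) \<le> 8 * a"
    by (simp add: pn_def sum_2 g_def)
  \<comment> \<open>For the lower bound the rotations are undone: \<open>c a\<close> is a
    combination of the four entries of \<open>blk g\<close> with coefficients of absolute value at
    most 1.\<close>
  have Dt: "blk (dg a b :: 'k mat2n) = transpose (blk k) ** blk g ** transpose (blk l)"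
  proof -
    have "transpose (blk k) ** blk g ** transpose (blk l) =
        (transpose (blk k) ** blk k) ** blk (dg a b :: 'k mat2n) ** (blk l ** transpose (blk l))"
      by (simp add: g matrix_mul_assoc)
    then show ?thesis
      using blk_KO[OF kl(1)] blk_KO[OF kl(2)] by (simp add: orthogonal_matrix_def)
  qed
  have "c a = blk (dg a b :: 'k mat2n) $ 1 $ 1"
    by (simp add: D)
  also have "\<dots> = (transpose (blk k) ** blk g ** transpose (blk l)) $ 1 $ 1"
    by (simp only: Dt)
  also have "\<dots> = blk k $ 1 $ 1 * blk g $ 1 $ 1 * blk l $ 1 $ 1 + blk k $ 2 $ 1 * blk g $ 2 $ 1 * blk l $ 1 $ 1
      + (blk k $ 1 $ 1 * blk g $ 1 $ 2 * blk l $ 1 $ 2 + blk k $ 2 $ 1 * blk g $ 2 $ 2 * blk l $ 1 $ 2)"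
    by (simp add: matrix_matrix_mult_def sum_2 transpose_def algebra_simps)
  also have "\<dots> \<le> \<bar>blk g $ 1 $ 1\<bar> + \<bar>blk g $ 2 $ 1\<bar> + (\<bar>blk g $ 1 $ 2\<bar> + \<bar>blk g $ 2 $ 2\<bar>)"
  proof -
    have "x * y * z \<le> \<bar>y\<bar>" if "\<bar>x\<bar> \<le> 1" "\<bar>z\<bar> \<le> 1" for x y z :: real
    proof -
      have "x * y * z \<le> \<bar>x\<bar> * \<bar>y\<bar> * \<bar>z\<bar>" by (metis abs_ge_self abs_mult)
      also have "\<dots> \<le> 1 * \<bar>y\<bar> * 1" using that by (intro mult_mono) auto
      finally show ?thesis by simp
    qed
    then show ?thesis using ke by (intro add_mono) auto
  qed
  finally show "a / 2 \<le> pn (k ** dg a b ** l)"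
    using c(1)[of a] ab by (simp add: pn_def sum_2 g_def)
qed

section \<open>Double cosets under bounded factors, and the coarse criterion\<close>

lemma matrix_dg_entry:
  fixes X Y :: "'k::finite mat2n"
  shows
  "(X ** dg a b ** Y) $ i $ j = (\<Sum>p\<in>UNIV. X $ i $ p * dge a b p * Y $ p $ j)"
proof -
  have "(X ** dg a b) $ i $ p = X $ i $ p * dge a b p" for p
    by (simp add: matrix_matrix_mult_def dg_def if_distrib[of "\<lambda>x. _ * x"] cong: if_cong)
  then show ?thesis by (simp add: matrix_matrix_mult_def[of "X ** dg a b"])
qed

lemma dge_bounds:
  assumes "1 \<le> b" "b \<le> a"
  shows "0 \<le> dge a b p" "dge a b p \<le> a" "p \<noteq> q \<Longrightarrow> dge a b p * dge a b q \<le> a * b"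
proof -
  have i: "0 \<le> 1/a" "1/a \<le> 1" "0 \<le> 1/b" "1/b \<le> 1" using assms by auto
  have ab: "0 \<le> a" "1 \<le> a" "0 \<le> b" using assms by auto
  show "0 \<le> dge a b p" for p using i ab by (cases p) auto
  have le': "dge a b p \<le> b" if "p \<noteq> First" for p
  proof -
    have "dge a b p = b \<or> dge a b p = 1 \<or> dge a b p = 1/b \<or> dge a b p = 1/a"
      using that by (cases p) auto
    then show ?thesis using assms i by (elim disjE) linarith+
  qed
  then show le: "dge a b p \<le> a" for p
    using assms by (cases "p = First") (auto intro: order_trans)
  show "dge a b p * dge a b q \<le> a * b" if "p \<noteq> q"
  proof (cases "q = First")
    case True
    then have "dge a b p * dge a b q \<le> b * a"
      using le le' that ab \<open>\<And>p. 0 \<le> dge a b p\<close> by (intro mult_mono) auto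
    then show ?thesis by (simp add: mult.commute)
  next
    case False
    then show ?thesis
      using le le' that ab \<open>\<And>p. 0 \<le> dge a b p\<close> by (intro mult_mono) auto
  qed
qed

text \<open>Bounded factors change \<open>a\<close> and \<open>a * b\<close> by bounded factors
  only: \<open>a\<close> is the largest entry of the torus element, and \<open>a * b\<close> its
  largest 2 x 2 minor, a substitute for the norm on the exterior square.\<close>

lemma dg_compare:
  fixes X Y :: "'k::finite mat2n"
  assumes eq: "dg a b = X ** dg a' b' ** Y" and ab: "1 \<le> b'" "b' \<le> a'"
    and XY: "\<And>i j. \<bar>X $ i $ j\<bar> \<le> M" "\<And>i j. \<bar>Y $ i $ j\<bar> \<le> M"
  defines "n \<equiv> real CARD('k idx)"
  shows "a \<le> n * (M * a' * M)" "a * b \<le> n * (n * (M * M * (a' * b') * (2 * M * M)))"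
proof -
  let ?d = "dge a' b'"
  have M: "0 \<le> M" using XY(1)[of First First] by linarith
  have d: "0 \<le> ?d p" "?d p \<le> a'" "p \<noteq> q \<Longrightarrow> ?d p * ?d q \<le> a' * b'" for p q :: "'k idx"
    using dge_bounds[OF ab] by blast+
  have e: "(dg a b :: 'k mat2n) $ i $ j = (\<Sum>p\<in>UNIV. X $ i $ p * ?d p * Y $ p $ j)" for i j
    unfolding eq by (rule matrix_dg_entry)
  have "a = (\<Sum>p\<in>UNIV. X $ First $ p * ?d p * Y $ p $ First)"
    using e[of First First] by (simp add: dg_def)
  also have "\<dots> \<le> (\<Sum>p\<in>(UNIV :: 'k idx set). M * a' * M)"
  proof (rule sum_mono)
    fix p
    have "X $ First $ p * ?d p * Y $ p $ First \<le> \<bar>X $ First $ p\<bar> * \<bar>?d p\<bar> * \<bar>Y $ p $ First\<bar>"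
      by (rule order_trans[OF abs_ge_self]) (simp add: abs_mult)
    also have "\<dots> \<le> M * a' * M"
      using XY d M ab by (intro mult_mono) auto
    finally show "X $ First $ p * ?d p * Y $ p $ First \<le> M * a' * M" .
  qed
  finally show "a \<le> n * (M * a' * M)" by (simp add: n_def)
  have "a * b = (\<Sum>p\<in>UNIV. X $ First $ p * ?d p * Y $ p $ First) * (\<Sum>q\<in>UNIV. X $ Second $ q * ?d q * Y $ q $ Second)
     - (\<Sum>p\<in>UNIV. X $ First $ p * ?d p * Y $ p $ Second) * (\<Sum>q\<in>UNIV. X $ Second $ q * ?d q * Y $ q $ First)"
    unfolding e[symmetric] by (simp add: dg_def)
  \<comment> \<open>A Cauchy-Binet expansion over ordered pairs. The terms with \<open>p = q\<close>
    vanish, so only products of distinct diagonal entries, at most \<open>a' * b'\<close>,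
    remain.\<close>
  also have "\<dots> = (\<Sum>p\<in>UNIV. \<Sum>q\<in>UNIV. X $ First $ p * X $ Second $ q * (?d p * ?d q) *
      (Y $ p $ First * Y $ q $ Second - Y $ p $ Second * Y $ q $ First))"
    unfolding sum_product sum_subtractf[symmetric]
    by (intro sum.cong refl) (simp add: algebra_simps)
  also have "\<dots> \<le> (\<Sum>p\<in>(UNIV :: 'k idx set). \<Sum>q\<in>(UNIV :: 'k idx set). M * M * (a' * b') * (2 * M * M))"
  proof (intro sum_mono)
    fix p q :: "'k idx"
    show "X $ First $ p * X $ Second $ q * (?d p * ?d q) *
      (Y $ p $ First * Y $ q $ Second - Y $ p $ Second * Y $ q $ First) \<le> M * M * (a' * b') * (2 * M * M)"
    proof (cases "p = q")
      case True
      then show ?thesis using M ab by (simp add: mult.commute)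
    next
      case False
      have y: "\<bar>Y $ p $ First * Y $ q $ Second - Y $ p $ Second * Y $ q $ First\<bar> \<le> 2 * M * M"
      proof -
        have "\<bar>Y $ p $ First * Y $ q $ Second\<bar> \<le> M * M" "\<bar>Y $ p $ Second * Y $ q $ First\<bar> \<le> M * M"
          unfolding abs_mult using XY M by (auto intro!: mult_mono)
        then show ?thesis by linarith
      qed
      have "X $ First $ p * X $ Second $ q * (?d p * ?d q) *
      (Y $ p $ First * Y $ q $ Second - Y $ p $ Second * Y $ q $ First) \<le>
       \<bar>X $ First $ p\<bar> * \<bar>X $ Second $ q\<bar> * \<bar>?d p * ?d q\<bar> *
      \<bar>Y $ p $ First * Y $ q $ Second - Y $ p $ Second * Y $ q $ First\<bar>"
        by (rule order_trans[OF abs_ge_self]) (simp add: abs_mult)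
      also have "\<dots> \<le> M * M * (a' * b') * (2 * M * M)"
        using XY M d(1) d(3)[OF False] ab y by (intro mult_mono mult_nonneg_nonneg) auto
      finally show ?thesis .
    qed
  qed
  finally show "a * b \<le> n * (n * (M * M * (a' * b') * (2 * M * M)))" by (simp add: n_def)
qed

text \<open>Every point of the Weyl chamber is within bounded distance of the Cartan projection of
  \<open>H\<close>. Distances of logarithms appear as multiplicative bounds, and \<open>pn\<close>
  and \<open>pd\<close> replace the projection.\<close>

definition Cartan_criterion :: "'k::finite mat2n set \<Rightarrow> bool" where
  "Cartan_criterion H \<longleftrightarrow> (\<exists>B\<ge>1. \<forall>a b. 1 \<le> b \<longrightarrow> b \<le> a \<longrightarrow>
    (\<exists>h\<in>H. a \<le> B * pn h \<and> pn h \<le> B * a \<and> a * b \<le> B * \<bar>pd h\<bar> \<and> \<bar>pd h\<bar> \<le> B * (a * b)))"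

lemma matrix_mult_entry_le:
  fixes X Y :: "real^'n^'n"
  assumes "\<And>i j. \<bar>X $ i $ j\<bar> \<le> M" "\<And>i j. \<bar>Y $ i $ j\<bar> \<le> L"
  shows "\<bar>(X ** Y) $ i $ j\<bar> \<le> real CARD('n) * (M * L)"
proof -
  have "0 \<le> M" using assms(1)[of i j] by linarith
  have "\<bar>(X ** Y) $ i $ j\<bar> \<le> (\<Sum>k\<in>UNIV. \<bar>X $ i $ k * Y $ k $ j\<bar>)"
    by (simp add: matrix_matrix_mult_def sum_abs)
  also have "\<dots> \<le> (\<Sum>k\<in>(UNIV :: 'n set). M * L)"
    unfolding abs_mult using assms \<open>0 \<le> M\<close> by (intro sum_mono mult_mono) auto
  finally show ?thesis by simp
qed

lemma continuous_matrix_mult: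
  fixes f :: "'a::topological_space \<Rightarrow> real^'n^'m" and g :: "'a \<Rightarrow> real^'p^'n"
  assumes "continuous_on S f" "continuous_on S g"
  shows "continuous_on S (\<lambda>x. f x ** g x)"
  unfolding matrix_matrix_mult_def
  by (intro continuous_on_vec_lambda continuous_intros assms)

lemma closed_SO2n: "closed (carrier SO2n :: 'k::finite mat2n set)"
proof -
  have "continuous_on UNIV (\<lambda>A :: 'k mat2n. transpose A ** Jm ** A)"
    unfolding transpose_def
    by (intro continuous_matrix_mult continuous_on_vec_lambda continuous_intros)
  then have 1: "closed {A :: 'k mat2n. transpose A ** Jm ** A = Jm}"
    by (intro closed_Collect_eq continuous_intros)
  have "continuous_on UNIV (\<lambda>A :: 'k mat2n. det A)"
    unfolding det_def by (intro continuous_intros)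
  then have 2: "closed {A :: 'k mat2n. det A = 1}"
    by (intro closed_Collect_eq continuous_intros)
  have "carrier SO2n = {A :: 'k mat2n. det A = 1} \<inter> {A. transpose A ** Jm ** A = Jm}"
    by (auto simp: carrier_SO2n OJ_def)
  then show ?thesis using closed_Int[OF 2 1] by simp
qed

lemma compact_SO2n_bounded:
  "compact {c \<in> carrier SO2n :: 'k::finite mat2n set. \<forall>i j. \<bar>c $ i $ j\<bar> \<le> M}"
proof -
  let ?S = "{c :: 'k mat2n. \<forall>i j. \<bar>c $ i $ j\<bar> \<le> M}"
  have "closed ?S"
    by (intro closed_Collect_all closed_Collect_le continuous_intros)
  moreover have "bounded ?S"
  proof (rule boundedI)
    fix c assume c: "c \<in> ?S"
    have "norm c \<le> (\<Sum>i\<in>UNIV. norm (c $ i))" unfolding norm_vec_def by (rule L2_set_le_sum) auto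
    also have "\<dots> \<le> (\<Sum>i\<in>(UNIV :: 'k idx set). \<Sum>j\<in>(UNIV :: 'k idx set). M)"
      using c by (intro sum_mono order_trans[OF norm_le_l1_cart] sum_mono) auto
    finally show "norm c \<le> (\<Sum>i\<in>(UNIV :: 'k idx set). \<Sum>j\<in>(UNIV :: 'k idx set). M)" .
  qed
  moreover have "{c \<in> carrier SO2n. \<forall>i j. \<bar>c $ i $ j\<bar> \<le> M} = ?S \<inter> carrier SO2n" by auto
  ultimately show ?thesis
    by (simp add: compact_eq_bounded_closed bounded_Int closed_Int closed_SO2n)
qed

lemma KO_entry_le: "k \<in> KO \<Longrightarrow> \<bar>k $ i $ j\<bar> \<le> 1"
  by (simp add: KO_def orthogonal_entry_le)

text \<open>This conjugate of the transpose is the inverse of an isometry. Its entries are those of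
  \<open>c\<close> in other positions, so a bound on \<open>C\<close> also bounds the
  inverses.\<close>

lemma Jm_conj_entry: "(Jm ** transpose c ** Jm) $ i $ j = c $ opp j $ opp i"
proof -
  have "opp p = i \<longleftrightarrow> p = opp i" for p i :: "'a idx" by auto
  then have "((Jm ** transpose c) ** Jm) $ i $ j = (Jm ** transpose c) $ i $ opp j"
    unfolding matrix_matrix_mult_def[of "Jm ** transpose c"]
    by (simp add: Jm_def if_distrib[of "\<lambda>x. _ * x"] eq_commute[of j] cong: if_cong)
  also have "\<dots> = c $ opp j $ opp i"
    by (simp add: matrix_matrix_mult_def Jm_def transpose_def if_distrib[of "\<lambda>x. x * _"] cong: if_cong)
  finally show ?thesis .
qed

lemma set_mult_SO2n: "C <#>\<^bsub>SO2n\<^esub> H = {c ** h |c h. c \<in> C \<and> h \<in> H}"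
  by (auto simp: set_mult_def SO2n_def)

text \<open>Apply \<open>C H C = G\<close> to \<open>dg a b\<close>. Moving the two factors from
  \<open>C\<close> to the other side gives a second factorization of the same shape, and
  \<open>dg_compare\<close> for both yields bounds in both directions.\<close>

lemma Cartan_imp_criterion:
  fixes H C :: "'k::finite mat2n set"
  assumes H: "H \<subseteq> carrier SO2n" and C: "C \<subseteq> carrier SO2n" "compact C"
    and eq: "C <#>\<^bsub>SO2n\<^esub> H <#>\<^bsub>SO2n\<^esub> C = carrier SO2n"
  shows "Cartan_criterion H"
proof -
  obtain M0 where M0: "\<And>c. c \<in> C \<Longrightarrow> norm c \<le> M0"
    using C(2) compact_imp_bounded bounded_iff by metis
  have M0e: "\<bar>c $ i $ j\<bar> \<le> M0" if "c \<in> C" for c i j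
    using M0[OF that] component_le_norm_cart[of "c $ i" j] Finite_Cartesian_Product.norm_nth_le[of c i]
    by linarith
  define n where "n = real CARD('k idx)"
  define M where "M = n * (\<bar>M0\<bar> * 1)"
  define B where "B = 1 + 8 * (n * (M * M)) + 4 * (n * (n * (M * M * (2 * M * M))))"
  have n: "n \<ge> 0" "M \<ge> 0" by (auto simp: n_def M_def)
  have nn: "n * (M * M) \<ge> 0" "n * (n * (M * M * (2 * M * M))) \<ge> 0"
    using n by auto
  have "\<exists>h\<in>H. a \<le> B * pn h \<and> pn h \<le> B * a \<and> a * b \<le> B * \<bar>pd h\<bar> \<and> \<bar>pd h\<bar> \<le> B * (a * b)"
    if ab: "1 \<le> b" "b \<le> a" for a b
  proof -
    have "(dg a b :: 'k mat2n) \<in> carrier SO2n"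
      using ab by (simp add: carrier_SO2n det_dg dg_OJ)
    then obtain c h c' where chc: "c \<in> C" "h \<in> H" "c' \<in> C" "dg a b = c ** h ** c'"
      unfolding eq[symmetric] set_mult_SO2n by blast
    obtain a' b' k l where kl: "1 \<le> b'" "b' \<le> a'" "k \<in> KO" "l \<in> KO" "h = k ** dg a' b' ** l"
      by (rule KAK[OF subsetD[OF H chc(2)]])
    have e1: "dg a b = (c ** k) ** dg a' b' ** (l ** c')"
      by (simp add: chc kl matrix_mul_assoc)
    have OC: "c \<in> OJ" "c' \<in> OJ" using chc C by (auto simp: carrier_SO2n)
    define d where "d x = Jm ** transpose x ** Jm" for x :: "'k mat2n"
    have d: "d c ** c = mat 1" "c' ** d c' = mat 1"
      using OJ_inv_left OJ_inv_right OC by (auto simp: d_def)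
    have e2: "dg a' b' = (transpose k ** d c) ** dg a b ** (d c' ** transpose l)"
    proof -
      have "(transpose k ** d c) ** dg a b ** (d c' ** transpose l) =
        transpose k ** (d c ** c) ** k ** dg a' b' ** l ** (c' ** d c') ** transpose l"
        by (simp add: e1 matrix_mul_assoc)
      also have "\<dots> = transpose k ** (k ** (dg a' b' ** (l ** transpose l)))"
        by (simp add: d matrix_mul_assoc)
      also have "\<dots> = dg a' b'" using kl by (simp add: KO_cancel KO_right)
      finally show ?thesis by simp
    qed
    have le: "\<bar>x $ i $ j\<bar> \<le> \<bar>M0\<bar>" if "x \<in> {c, c', d c, d c'}" for x i j
      using that M0e chc unfolding d_def
      by (auto simp: Jm_conj_entry intro: order_trans[OF _ abs_ge_self])
    have le1: "\<bar>x $ i $ j\<bar> \<le> 1" if "x \<in> {k, l, transpose k, transpose l}" for x i j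
      using that kl KO_entry_le KO_transpose by blast
    have leM: "\<bar>(x ** y) $ i $ j\<bar> \<le> M" 
      if "x \<in> {c, c', d c, d c'}" "y \<in> {k, l, transpose k, transpose l}" for x y i j
      unfolding M_def n_def by (rule matrix_mult_entry_le) (use le[OF that(1)] le1[OF that(2)] in auto)
    have leM': "\<bar>(y ** x) $ i $ j\<bar> \<le> M" 
      if "x \<in> {c, c', d c, d c'}" "y \<in> {k, l, transpose k, transpose l}" for x y i j
      unfolding M_def n_def mult.commute[of "\<bar>M0\<bar>"]
      by (rule matrix_mult_entry_le) (use le[OF that(1)] le1[OF that(2)] in auto)
    have c1: "a \<le> n * (M * a' * M)" "a * b \<le> n * (n * (M * M * (a' * b') * (2 * M * M)))"
      using dg_compare[OF e1 kl(1,2), of M] leM leM' by (auto simp: n_def)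
    have c2: "a' \<le> n * (M * a * M)" "a' * b' \<le> n * (n * (M * M * (a * b) * (2 * M * M)))"
      using dg_compare[OF e2 ab, of M] leM leM' by (auto simp: n_def)
    note p = KAK_pn_pd[OF kl(3,4,1,2), folded kl(5)]
    have pos: "0 \<le> a" "0 \<le> a * b" "0 \<le> pn h" "0 \<le> a' * b'" "0 \<le> a'" using ab kl p by auto
    have "a \<le> B * pn h"
    proof -
      have "a \<le> (n * (M * M)) * a'" using c1(1) by (simp add: mult_ac)
      also have "\<dots> \<le> (n * (M * M)) * (2 * pn h)" using p(1) nn by (intro mult_left_mono) auto
      also have "\<dots> = (2 * (n * (M * M))) * pn h" by simp
      also have "\<dots> \<le> B * pn h" using nn pos unfolding B_def by (intro mult_right_mono) linarith+
      finally show ?thesis .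
    qed
    moreover have "pn h \<le> B * a"
    proof -
      have "pn h \<le> 8 * ((n * (M * M)) * a)" using p(2) c2(1) by (simp add: mult_ac)
      also have "\<dots> = (8 * (n * (M * M))) * a" by simp
      also have "\<dots> \<le> B * a" using nn pos unfolding B_def by (intro mult_right_mono) linarith+
      finally show ?thesis .
    qed
    moreover have "a * b \<le> B * \<bar>pd h\<bar>"
    proof -
      have "a * b \<le> n * (n * (M * M * (2 * M * M))) * (a' * b')" using c1(2) by (simp add: mult_ac)
      also have "\<dots> \<le> n * (n * (M * M * (2 * M * M))) * (4 * \<bar>pd h\<bar>)"
        using p(3) nn by (intro mult_left_mono) auto
      also have "\<dots> = 4 * (n * (n * (M * M * (2 * M * M)))) * \<bar>pd h\<bar>" by simp
      also have "\<dots> \<le> B * \<bar>pd h\<bar>" using nn pos unfolding B_def by (intro mult_right_mono) linarith+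
      finally show ?thesis .
    qed
    moreover have "\<bar>pd h\<bar> \<le> B * (a * b)"
    proof -
      have "\<bar>pd h\<bar> \<le> n * (n * (M * M * (2 * M * M))) * (a * b)" using p(4) c2(2) by (simp add: mult_ac)
      also have "\<dots> \<le> B * (a * b)" using nn pos unfolding B_def by (intro mult_right_mono) linarith+
      finally show ?thesis .
    qed
    ultimately show ?thesis using chc(2) by blast
  qed
  moreover have "B \<ge> 1" using nn by (simp add: B_def)
  ultimately show ?thesis unfolding Cartan_criterion_def by blast
qed

text \<open>If \<open>g\<close> and \<open>h\<close> have comparable torus parts, the quotient
  \<open>r\<close> of these parts is bounded, and
  \<open>g = (k ** r ** transpose k') ** h ** (transpose l' ** l)\<close>. Thus one bounded set of
  outer factors serves for all \<open>g\<close>.\<close>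

lemma criterion_imp_Cartan:
  fixes H :: "'k::finite mat2n set"
  assumes H: "H \<subseteq> carrier SO2n" and crit: "Cartan_criterion H"
  shows "\<exists>C. C \<subseteq> carrier SO2n \<and> compact C \<and> C <#>\<^bsub>SO2n\<^esub> H <#>\<^bsub>SO2n\<^esub> C = carrier SO2n"
proof -
  obtain B where B: "B \<ge> 1" "\<And>a b. 1 \<le> b \<Longrightarrow> b \<le> a \<Longrightarrow>
    \<exists>h\<in>H. a \<le> B * pn h \<and> pn h \<le> B * a \<and> a * b \<le> B * \<bar>pd h\<bar> \<and> \<bar>pd h\<bar> \<le> B * (a * b)"
    using crit unfolding Cartan_criterion_def by blast
  define n where "n = real CARD('k idx)"
  \<comment> \<open>The bound \<open>q2\<close> on \<open>b'\<close> needs the most: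
    \<open>4 * B\<close> from the product estimate times \<open>8 * B\<close> from the size
    estimate.\<close>
  define M0 where "M0 = 32 * B\<^sup>2"
  define M where "M = n * (M0 * 1)"
  define C where "C = {c \<in> carrier SO2n :: 'k mat2n set. \<forall>i j. \<bar>c $ i $ j\<bar> \<le> M}"
  have n1: "n \<ge> 1" by (simp add: n_def Suc_leI)
  have BB: "B \<le> B\<^sup>2" using B(1) by (simp add: power2_eq_square)
  have M0: "1 \<le> M0" "8 * B \<le> M0" using B(1) BB by (auto simp: M0_def)
  have M: "n \<le> M" using n1 M0 by (simp add: M_def)
  have C: "C \<subseteq> carrier SO2n" "compact C" unfolding C_def by (auto simp: compact_SO2n_bounded)
  have car: "k ** l \<in> carrier SO2n" if "k \<in> carrier SO2n" "l \<in> carrier SO2n" for k l :: "'k mat2n"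
    using that by (simp add: carrier_SO2n OJ_mult det_mul)
  have "g \<in> C <#>\<^bsub>SO2n\<^esub> H <#>\<^bsub>SO2n\<^esub> C" if g: "g \<in> carrier SO2n" for g
  proof -
    obtain a b k l where ab: "1 \<le> b" "b \<le> a" "k \<in> KO" "l \<in> KO" "det k = 1" "det l = 1" "g = k ** dg a b ** l"
      by (rule KAK[OF g])
    obtain h where h: "h \<in> H" "a \<le> B * pn h" "pn h \<le> B * a" "a * b \<le> B * \<bar>pd h\<bar>" "\<bar>pd h\<bar> \<le> B * (a * b)"
      using B(2)[OF ab(1,2)] by blast
    obtain a' b' k' l' where ab': "1 \<le> b'" "b' \<le> a'" "k' \<in> KO" "l' \<in> KO" "det k' = 1" "det l' = 1" "h = k' ** dg a' b' ** l'"
      by (rule KAK[OF subsetD[OF H h(1)]])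
    note p = KAK_pn_pd[OF ab'(3,4,1,2), folded ab'(7)]
    have pos: "0 < a" "0 < b" "0 < a'" "0 < b'" using ab ab' by auto
    have a1: "a \<le> 8 * B * a'" 
    proof -
      have "B * pn h \<le> B * (8 * a')" using p(2) B(1) by (intro mult_left_mono) auto
      then show ?thesis using h(2) by simp
    qed
    have a2: "a' \<le> 2 * B * a" using p(1) h(3) by (simp add: mult_ac)
    have b1: "a * b \<le> B * (a' * b')"
    proof -
      have "B * \<bar>pd h\<bar> \<le> B * (a' * b')" using p(4) B(1) by (intro mult_left_mono) auto
      then show ?thesis using h(4) by simp
    qed
    have b2: "a' * b' \<le> 4 * B * (a * b)" using p(3) h(5) by simp
    have q1: "b \<le> M0 * b'"
    proof -
      have "a * b \<le> B * b' * a'" using b1 by (simp add: mult_ac)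
      also have "\<dots> \<le> B * b' * (2 * B * a)" using a2 B(1) pos by (intro mult_left_mono) auto
      finally have "a * b \<le> a * (2 * B\<^sup>2 * b')" by (simp add: power2_eq_square mult_ac)
      then have "b \<le> 2 * B\<^sup>2 * b'" using pos by simp
      also have "\<dots> \<le> M0 * b'" using pos B(1) unfolding M0_def by (intro mult_right_mono) auto
      finally show ?thesis .
    qed
    have q2: "b' \<le> M0 * b"
    proof -
      have "a' * b' \<le> 4 * B * b * a" using b2 by (simp add: mult_ac)
      also have "\<dots> \<le> 4 * B * b * (8 * B * a')" using a1 B(1) pos by (intro mult_left_mono) auto
      finally have "a' * b' \<le> a' * (32 * B\<^sup>2 * b)" by (simp add: power2_eq_square mult_ac)
      then show ?thesis using pos by (simp add: M0_def)
    qed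
    have q3: "a \<le> M0 * a'" using a1 mult_right_mono[OF M0(2), of a'] pos by linarith
    have q4: "a' \<le> M0 * a"
    proof -
      have "2 * B * a \<le> M0 * a" using M0(2) B(1) pos by (intro mult_right_mono) auto
      then show ?thesis using a2 by linarith
    qed
    define r :: "'k mat2n" where "r = dg (a / a') (b / b')"
    have dr: "\<bar>dge (a / a') (b / b') i\<bar> \<le> M0" for i :: "'k idx"
      using q1 q2 q3 q4 pos M0 by (cases i) (auto simp: divide_le_eq abs_div_pos[symmetric])
    have re: "\<bar>r $ i $ j\<bar> \<le> M0" for i j
      using dr[of i] M0(1) by (auto simp: r_def dg_def)
    have "r ** dg a' b' = dg a b"
      using pos by (simp add: r_def dg_mult)
    then have geq: "g = (k ** r ** transpose k') ** h ** (transpose l' ** l)"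
    proof -
      have "(k ** r ** transpose k') ** h ** (transpose l' ** l) =
          k ** (r ** (transpose k' ** (k' ** (dg a' b' ** (l' ** (transpose l' ** l))))))"
        by (simp add: ab' matrix_mul_assoc)
      also have "\<dots> = k ** (r ** (dg a' b' ** l))"
        using ab' by (simp only: KO_cancel)
      also have "\<dots> = k ** (r ** dg a' b') ** l"
        by (simp only: matrix_mul_assoc)
      finally show ?thesis using \<open>r ** dg a' b' = dg a b\<close> ab by simp
    qed
    have KC: "x \<in> carrier SO2n" if "x \<in> KO" "det x = 1" for x :: "'k mat2n"
      using that by (simp add: carrier_SO2n KO_OJ)
    have kc: "k \<in> carrier SO2n" "transpose k' \<in> carrier SO2n" "transpose l' \<in> carrier SO2n" "l \<in> carrier SO2n"
      using ab ab' by (auto intro!: KC KO_transpose)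
    have rc: "r \<in> carrier SO2n"
      using pos by (simp add: r_def carrier_SO2n det_dg dg_OJ)
    have "k ** r ** transpose k' \<in> C"
    proof -
      have "\<bar>(k ** r) $ i $ j\<bar> \<le> M0" for i j
      proof -
        have "(k ** r) $ i $ j = k $ i $ j * dge (a / a') (b / b') j"
          by (simp add: matrix_matrix_mult_def r_def dg_def if_distrib[of "\<lambda>x. _ * x"] cong: if_cong)
        also have "\<bar>\<dots>\<bar> \<le> 1 * M0"
          unfolding abs_mult using KO_entry_le[OF ab(3)] dr by (intro mult_mono) auto
        finally show ?thesis by simp
      qed
      then have "\<bar>(k ** r ** transpose k') $ i $ j\<bar> \<le> M" for i j
        unfolding M_def n_def using KO_entry_le[OF KO_transpose[OF ab'(3)]]
        by (intro matrix_mult_entry_le) auto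
      then show ?thesis using kc rc by (simp add: C_def car)
    qed
    moreover have "transpose l' ** l \<in> C"
    proof -
      have "\<bar>(transpose l' ** l) $ i $ j\<bar> \<le> 1" for i j
        using KO_entry_le[OF KO_mult[OF KO_transpose[OF ab'(4)] ab(4)]] .
      moreover have "1 \<le> M" using M n1 by linarith
      ultimately have "\<bar>(transpose l' ** l) $ i $ j\<bar> \<le> M" for i j
        by (meson order_trans)
      then show ?thesis using kc by (simp add: C_def car)
    qed
    ultimately show ?thesis
      unfolding set_mult_SO2n using h(1) geq by blast
  qed
  moreover have "C <#>\<^bsub>SO2n\<^esub> H <#>\<^bsub>SO2n\<^esub> C \<subseteq> carrier SO2n"
    unfolding set_mult_SO2n using C(1) H by (auto intro!: car)
  ultimately show ?thesis using C by blast
qed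

section \<open>The unipotent group in exponential coordinates\<close>

type_synonym 'k ncoord = "real \<times> (real ^ 'k) \<times> (real ^ 'k) \<times> real"

definition nm :: "'k::finite ncoord \<Rightarrow> 'k mat2n" where
  "nm = (\<lambda>(\<phi>, x, y, \<eta>). n_elt \<phi> x y \<eta>)"

text \<open>Entries of the matrix exponential of \<open>n_elt\<close>, as \<open>mat_exp_nm\<close>
  confirms. The closed form turns the group law and the size functions into polynomial
  identities.\<close>

fun expe :: "real \<Rightarrow> real ^ 'k \<Rightarrow> real ^ 'k \<Rightarrow> real \<Rightarrow> 'k::finite idx \<Rightarrow> 'k idx \<Rightarrow> real" where
  "expe \<phi> x y \<eta> First First = 1"
| "expe \<phi> x y \<eta> First Second = \<phi>"
| "expe \<phi> x y \<eta> First (Mid k) = (x + (\<phi> / 2) *\<^sub>R y) $ k"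
| "expe \<phi> x y \<eta> First Penult = \<eta> - (x \<bullet> y) / 2 - \<phi> * (y \<bullet> y) / 6"
| "expe \<phi> x y \<eta> First Last = - \<phi> * \<eta> - (x \<bullet> x) / 2 + \<phi>\<^sup>2 * (y \<bullet> y) / 24"
| "expe \<phi> x y \<eta> Second Second = 1"
| "expe \<phi> x y \<eta> Second (Mid k) = y $ k"
| "expe \<phi> x y \<eta> Second Penult = - (y \<bullet> y) / 2"
| "expe \<phi> x y \<eta> Second Last = - \<eta> - (x \<bullet> y) / 2 + \<phi> * (y \<bullet> y) / 6"
| "expe \<phi> x y \<eta> (Mid k) (Mid l) = (if k = l then 1 else 0)"
| "expe \<phi> x y \<eta> (Mid k) Penult = (- y) $ k"
| "expe \<phi> x y \<eta> (Mid k) Last = ((\<phi> / 2) *\<^sub>R y - x) $ k"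
| "expe \<phi> x y \<eta> Penult Penult = 1"
| "expe \<phi> x y \<eta> Penult Last = - \<phi>"
| "expe \<phi> x y \<eta> Last Last = 1"
| "expe \<phi> x y \<eta> _ _ = 0"

definition expn :: "'k::finite ncoord \<Rightarrow> 'k mat2n" where
  "expn = (\<lambda>(\<phi>, x, y, \<eta>). \<chi> i j. expe \<phi> x y \<eta> i j)"

lemma expn_entry: "expn (\<phi>, x, y, \<eta>) $ i $ j = expe \<phi> x y \<eta> i j"
  by (simp add: expn_def)

text \<open>The matrix commutator in the coordinates of \<open>nm\<close>.\<close>

definition nbr :: "'k::finite ncoord \<Rightarrow> 'k ncoord \<Rightarrow> 'k ncoord" where
  "nbr = (\<lambda>(\<phi>, x, y, \<eta>) (\<phi>', x', y', \<eta>'). (0, \<phi> *\<^sub>R y' - \<phi>' *\<^sub>R y, 0, x' \<bullet> y - x \<bullet> y'))"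

text \<open>The Baker--Campbell--Hausdorff product, which breaks off since \<open>\<nn>\<close> is nilpotent of class 3.\<close>

definition nop :: "'k::finite ncoord \<Rightarrow> 'k ncoord \<Rightarrow> 'k ncoord" where
  "nop X Y = X + Y + (1/2) *\<^sub>R nbr X Y + (1/12) *\<^sub>R nbr (X - Y) (nbr X Y)"

lemma nop_eq:
  "nop (\<phi>, x, y, \<eta>) (\<phi>', x', y', \<eta>') =
    (\<phi> + \<phi>', x + x' + (1/2) *\<^sub>R (\<phi> *\<^sub>R y' - \<phi>' *\<^sub>R y), y + y',
     \<eta> + \<eta>' + (x' \<bullet> y - x \<bullet> y') / 2 + ((\<phi> *\<^sub>R y' - \<phi>' *\<^sub>R y) \<bullet> (y - y')) / 12)"
  by (simp add: nop_def nbr_def)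

lemma sum_inner: "(\<Sum>k\<in>UNIV. u $ k * v $ k) = u \<bullet> (v :: real^'k)"
  by (simp add: inner_vec_def)

lemma sum_delta_mult:
  "(\<Sum>k\<in>UNIV. f k * (if k = l then 1 else 0)) = (f (l::'k::finite) :: real)"
  "(\<Sum>k\<in>UNIV. (if l = k then 1 else 0) * f k) = (f (l::'k::finite) :: real)"
  "(\<Sum>k\<in>UNIV. f k * (if l = k then 1 else 0)) = (f (l::'k::finite) :: real)"
  "(\<Sum>k\<in>UNIV. (if k = l then 1 else 0) * f k) = (f (l::'k::finite) :: real)"
  by (simp_all add: if_distrib[of "\<lambda>x. x * _"] if_distrib[of "\<lambda>x. _ * x"] cong: if_cong)

lemmas vec_comps = vector_add_component vector_minus_component vector_uminus_component vector_scaleR_component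

lemmas inner_expand = inner_add_left inner_add_right inner_diff_left inner_diff_right

lemma expn_nop: "expn X ** expn Y = expn (nop X Y)"
proof -
  obtain \<phi> x y \<eta> \<phi>' x' y' \<eta>' where XY: "X = (\<phi>, x, y, \<eta>)" "Y = (\<phi>', x', y', \<eta>')"
    by (metis prod_cases4)
  have "(expn X ** expn Y) $ i $ j = expn (nop X Y) $ i $ j" for i j
    unfolding XY nop_eq expn_entry matrix_matrix_mult_def vec_lambda_beta sum_idx
    by (cases i; cases j; simp add: sum_inner sum_delta_mult del: mult_if_delta vec_comps)
      (simp_all add: inner_expand inner_commute[of x y] inner_commute[of x' y] inner_commute[of y' y]
       inner_commute[of x' x] inner_commute[of x y'] inner_commute[of x' y']
        field_simps power2_eq_square)
  then show ?thesis by (simp add: vec_eq_iff)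
qed

lemma expn_0 [simp]: "expn 0 = mat 1"
proof -
  have "expn (0, 0, 0, 0) $ i $ j = (mat 1 :: 'a mat2n) $ i $ j" for i j
    unfolding expn_entry by (cases i; cases j) (simp_all add: mat_def)
  then show ?thesis by (simp add: vec_eq_iff zero_prod_def)
qed

text \<open>Polynomial inverse of \<open>expn\<close>: \<phi> and \<open>y\<close> are entries,
  after which \<open>x\<close> and \<eta> are solved for. Its continuity carries connectedness of
  \<open>H\<close> over to the set of logarithms.\<close>

definition logn :: "'k::finite mat2n \<Rightarrow> 'k ncoord" where
  "logn A = (let \<phi> = A $ First $ Second; y = (\<chi> k. A $ Second $ Mid k);
      x = (\<chi> k. A $ First $ Mid k) - (\<phi> / 2) *\<^sub>R y
    in (\<phi>, x, y, A $ First $ Penult + (x \<bullet> y) / 2 + \<phi> * (y \<bullet> y) / 6))"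

lemma logn_expn [simp]: "logn (expn X) = X"
proof -
  obtain \<phi> x y \<eta> where X: "X = (\<phi>, x, y, \<eta>)" by (metis prod_cases4)
  have "(\<chi> k. y $ k) = y" "(\<chi> k. (x + (\<phi> / 2) *\<^sub>R y) $ k) = x + (\<phi> / 2) *\<^sub>R y"
    by (simp_all add: vec_eq_iff)
  then show ?thesis
    by (simp only: X logn_def Let_def expn_entry expe.simps) simp
qed

lemma expn_inject: "expn X = expn Y \<longleftrightarrow> X = Y"
  by (metis logn_expn)

lemma continuous_logn: "continuous_on S (logn :: 'k::finite mat2n \<Rightarrow> _)"
  unfolding logn_def Let_def
  by (intro continuous_intros continuous_on_vec_lambda) auto

lemma nop_assoc: "nop (nop X Y) Z = nop X (nop Y Z)"
  by (simp add: expn_inject[symmetric] expn_nop[symmetric] matrix_mul_assoc)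

lemma nop_0 [simp]: "nop X 0 = X" "nop 0 X = X"
  by (simp_all add: expn_inject[symmetric] expn_nop[symmetric])

lemma nbr_scaleR: "nbr (a *\<^sub>R X) (b *\<^sub>R Y) = (a * b) *\<^sub>R nbr X Y"
  by (cases X rule: prod_cases4; cases Y rule: prod_cases4)
    (simp add: nbr_def scaleR_diff_right algebra_simps)

lemma nbr_self [simp]: "nbr X X = 0"
  by (cases X rule: prod_cases4) (simp add: nbr_def inner_commute zero_prod_def)

lemma nop_scaleR_self: "nop (a *\<^sub>R X) (b *\<^sub>R X) = (a + b) *\<^sub>R X"
proof -
  have "nbr (a *\<^sub>R X - b *\<^sub>R X) 0 = 0" by (cases X rule: prod_cases4) (simp add: nbr_def zero_prod_def)
  then show ?thesis by (simp add: nop_def nbr_scaleR scaleR_add_left)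
qed

lemma nop_minus [simp]: "nop X (- X) = 0" "nop (- X) X = 0"
  using nop_scaleR_self[of 1 X "-1"] nop_scaleR_self[of "-1" X 1] by simp_all

lemma nop_cancel [simp]: "nop X (nop (- X) Y) = Y" "nop (- X) (nop X Y) = Y"
  by (simp_all add: nop_assoc[symmetric])

lemma nop_minus_rev: "- nop X Y = nop (- Y) (- X)"
proof -
  have "nop (nop X Y) (nop (- Y) (- X)) = 0"
    by (simp add: nop_assoc)
  then have "nop (- nop X Y) (nop (nop X Y) (nop (- Y) (- X))) = - nop X Y"
    by simp
  then show ?thesis by simp
qed

lemma nm_linear: "linear nm"
proof
  fix X Y :: "'a ncoord" and r :: real
  have "nm (X + Y) $ i $ j = (nm X + nm Y) $ i $ j" for i j
    by (cases X rule: prod_cases4; cases Y rule: prod_cases4; cases i; cases j)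
      (simp_all add: nm_def n_elt_def)
  then show "nm (X + Y) = nm X + nm Y" by (simp add: vec_eq_iff)
  have "nm (r *\<^sub>R X) $ i $ j = (r *\<^sub>R nm X) $ i $ j" for i j
    by (cases X rule: prod_cases4; cases i; cases j) (simp_all add: nm_def n_elt_def)
  then show "nm (r *\<^sub>R X) = r *\<^sub>R nm X" by (simp add: vec_eq_iff)
qed

lemma nm_inject: "nm X = nm Y \<longleftrightarrow> X = Y"
proof
  assume e: "nm X = nm Y"
  obtain \<phi> x y \<eta> \<phi>' x' y' \<eta>' where XY: "X = (\<phi>, x, y, \<eta>)" "Y = (\<phi>', x', y', \<eta>')"
    by (metis prod_cases4)
  have "n_elt \<phi> x y \<eta> $ i $ j = n_elt \<phi>' x' y' \<eta>' $ i $ j" for i j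
    using e by (simp add: XY nm_def)
  from this[of First Second] this[of First "Mid _"] this[of Second "Mid _"] this[of First Penult]
  show "X = Y" by (simp add: XY n_elt_def vec_eq_iff)
qed simp

section \<open>Powers and exponentials of elements of the Lie algebra\<close>

fun pow2 :: "real \<Rightarrow> real ^ 'k \<Rightarrow> real ^ 'k \<Rightarrow> real \<Rightarrow> 'k::finite idx \<Rightarrow> 'k idx \<Rightarrow> real" where
  "pow2 \<phi> x y \<eta> First (Mid k) = (\<phi> *\<^sub>R y) $ k"
| "pow2 \<phi> x y \<eta> First Penult = - (x \<bullet> y)"
| "pow2 \<phi> x y \<eta> First Last = - 2 * \<phi> * \<eta> - x \<bullet> x"
| "pow2 \<phi> x y \<eta> Second Penult = - (y \<bullet> y)"
| "pow2 \<phi> x y \<eta> Second Last = - (x \<bullet> y)"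
| "pow2 \<phi> x y \<eta> (Mid k) Last = (\<phi> *\<^sub>R y) $ k"
| "pow2 \<phi> x y \<eta> _ _ = 0"

fun pow3 :: "real \<Rightarrow> real ^ 'k \<Rightarrow> 'k::finite idx \<Rightarrow> 'k idx \<Rightarrow> real" where
  "pow3 \<phi> y First Penult = - \<phi> * (y \<bullet> y)"
| "pow3 \<phi> y Second Last = \<phi> * (y \<bullet> y)"
| "pow3 \<phi> y _ _ = 0"

fun pow4 :: "real \<Rightarrow> real ^ 'k \<Rightarrow> 'k::finite idx \<Rightarrow> 'k idx \<Rightarrow> real" where
  "pow4 \<phi> y First Last = \<phi>\<^sup>2 * (y \<bullet> y)"
| "pow4 \<phi> y _ _ = 0"

fun nent :: "real \<Rightarrow> real ^ 'k \<Rightarrow> real ^ 'k \<Rightarrow> real \<Rightarrow> 'k::finite idx \<Rightarrow> 'k idx \<Rightarrow> real" where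
  "nent \<phi> x y \<eta> First Second = \<phi>"
| "nent \<phi> x y \<eta> First (Mid k) = x $ k"
| "nent \<phi> x y \<eta> First Penult = \<eta>"
| "nent \<phi> x y \<eta> Second (Mid k) = y $ k"
| "nent \<phi> x y \<eta> Second Last = - \<eta>"
| "nent \<phi> x y \<eta> (Mid k) Penult = (- y) $ k"
| "nent \<phi> x y \<eta> (Mid k) Last = (- x) $ k"
| "nent \<phi> x y \<eta> Penult Last = - \<phi>"
| "nent \<phi> x y \<eta> _ _ = 0"

lemma nm_nent: "nm (\<phi>, x, y, \<eta>) $ i $ j = nent \<phi> x y \<eta> i j"
  by (cases i; cases j) (simp_all add: nm_def n_elt_def)

lemma nm_powers:
  fixes \<phi> \<eta> :: real and x y :: "real ^ 'k::finite"
  defines "P \<equiv> \<lambda>n. (((**) (nm (\<phi>, x, y, \<eta>)) ^^ n) (mat 1))"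
  shows "P 2 $ i $ j = pow2 \<phi> x y \<eta> i j" "P 3 $ i $ j = pow3 \<phi> y i j"
    "P 4 $ i $ j = pow4 \<phi> y i j" "n \<ge> 5 \<Longrightarrow> P n = 0"
proof -
  let ?X = "nm (\<phi>, x, y, \<eta>)"
  have Suc: "P (Suc n) = ?X ** P n" for n by (simp add: P_def)
  have P1: "P 1 = ?X" by (simp add: P_def)
  have P2: "P 2 $ i $ j = pow2 \<phi> x y \<eta> i j" for i j
  proof -
    have "P 2 = ?X ** ?X" using Suc[of 1] P1 by (simp add: numeral_2_eq_2)
    then show ?thesis
      by (simp only: nm_nent matrix_matrix_mult_def vec_lambda_beta sum_idx)
        (cases i; cases j; simp add: sum_inner inner_commute[of y x] del: vec_comps; simp)
  qed
  have P3: "P 3 $ i $ j = pow3 \<phi> y i j" for i j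
  proof -
    have "P 3 = ?X ** P 2" using Suc[of 2] by simp
    then show ?thesis
      by (simp only: nm_nent matrix_matrix_mult_def vec_lambda_beta sum_idx P2)
        (cases i; cases j; simp add: sum_inner inner_commute[of y x] del: vec_comps)
  qed
  have P4: "P 4 $ i $ j = pow4 \<phi> y i j" for i j
  proof -
    have "P 4 = ?X ** P 3" using Suc[of 3] by simp
    then show ?thesis
      by (simp only: nm_nent matrix_matrix_mult_def vec_lambda_beta sum_idx P3)
        (cases i; cases j; simp add: power2_eq_square)
  qed
  have "P 5 $ i $ j = 0" for i j
  proof -
    have "P 5 = ?X ** P 4" using Suc[of 4] by simp
    then show ?thesis
      by (simp only: nm_nent matrix_matrix_mult_def vec_lambda_beta sum_idx P4)
        (cases i; cases j; simp)
  qed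
  then have P5: "P 5 = 0" by (simp add: vec_eq_iff)
  have "P n = 0" if "n \<ge> 5" for n
    using that by (induction n rule: dec_induct)
      (simp_all add: P5 Suc vec_eq_iff matrix_matrix_mult_def)
  then show "P 2 $ i $ j = pow2 \<phi> x y \<eta> i j" "P 3 $ i $ j = pow3 \<phi> y i j"
    "P 4 $ i $ j = pow4 \<phi> y i j" "n \<ge> 5 \<Longrightarrow> P n = 0"
    using P2 P3 P4 by auto
qed

lemma mat_exp_nm: "mat_exp (nm X) = expn X"
proof -
  obtain \<phi> x y \<eta> where X: "X = (\<phi>, x, y, \<eta>)" by (metis prod_cases4)
  let ?P = "\<lambda>n. (((**) (nm X) ^^ n) (mat 1))"
  have "mat_exp (nm X) = (\<Sum>n\<in>{..<5}. (1 / fact n) *\<^sub>R ?P n)"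
    unfolding mat_exp_def X by (intro suminf_finite) (auto simp: nm_powers)
  also have "\<dots> = mat 1 + nm X + (1/2) *\<^sub>R ?P 2 + (1/6) *\<^sub>R ?P 3 + (1/24) *\<^sub>R ?P 4" (is "_ = ?R")
    by (simp add: lessThan_nat_numeral lessThan_Suc fact_numeral)
  finally have e: "mat_exp (nm X) = ?R" .
  have "mat_exp (nm X) $ i $ j = expn X $ i $ j" for i j
    unfolding e
    unfolding vector_add_component vector_scaleR_component X nm_powers nm_nent expn_entry
    by (cases i; cases j; simp add: mat_def field_simps)
  then show ?thesis by (simp add: vec_eq_iff)
qed

section \<open>Closed subgroups\<close>

lemma bounded_bilinear_nbr: "bounded_bilinear (nbr :: 'k::finite ncoord \<Rightarrow> _)"
proof -
  have "bilinear (nbr :: 'k ncoord \<Rightarrow> _)"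
    unfolding bilinear_def
    by (intro conjI allI linearI; (case_tac x rule: prod_cases4)?; (case_tac b1 rule: prod_cases4)?;
        (case_tac b2 rule: prod_cases4)?)
      (auto simp: nbr_def inner_expand algebra_simps scaleR_add_left scaleR_add_right)
  then show ?thesis by (simp add: bilinear_conv_bounded_bilinear)
qed

interpretation nbr: bounded_bilinear nbr
  by (rule bounded_bilinear_nbr)

lemma continuous_nop:
  fixes f g :: "'a::topological_space \<Rightarrow> 'k::finite ncoord"
  assumes "continuous_on S f" "continuous_on S g"
  shows "continuous_on S (\<lambda>x. nop (f x) (g x))"
  unfolding nop_def by (intro continuous_intros nbr.continuous_on assms)

text \<open>Conjugation is \<open>exp (ad X)\<close>; the series ends after the quadratic term
  because the Lie algebra has class 3.\<close>

lemma nop_conj: "nop (nop X Y) (- X) = Y + nbr X Y + (1/2) *\<^sub>R nbr X (nbr X Y)"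
proof -
  obtain \<phi> x y \<eta> \<phi>' x' y' \<eta>' where XY: "X = (\<phi>, x, y, \<eta>)" "Y = (\<phi>', x', y', \<eta>')"
    by (metis prod_cases4)
  have two: "v * 2 = 2 *\<^sub>R v" for v :: "real ^ 'a" by (simp add: vec_eq_iff)
  show ?thesis
    unfolding XY nop_eq
    by (simp add: nbr_def nop_eq; intro conjI; simp add: vec_eq_iff inner_expand inner_commute[of y' y]
        inner_commute[of y' x] inner_commute[of y x]; simp add: two inner_commute[of y' y] algebra_simps add_divide_distrib diff_divide_distrib)
qed

locale closed_nsub =
  fixes S :: "'k::finite ncoord set"
  assumes closed_S: "closed S" and zero_S: "0 \<in> S"
    and nop_S: "X \<in> S \<Longrightarrow> Y \<in> S \<Longrightarrow> nop X Y \<in> S" and uminus_S: "X \<in> S \<Longrightarrow> - X \<in> S"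
begin

definition L :: "'k ncoord set" where
  "L = {X. \<forall>t. t *\<^sub>R X \<in> S}"

lemma L_S: "X \<in> L \<Longrightarrow> X \<in> S"
  unfolding L_def using scaleR_one by (metis (mono_tags) mem_Collect_eq)

lemma nat_S: "X \<in> S \<Longrightarrow> real n *\<^sub>R X \<in> S"
proof (induction n)
  case (Suc n)
  have "real (Suc n) *\<^sub>R X = nop (real n *\<^sub>R X) X"
    using nop_scaleR_self[of "real n" X 1] by (simp add: algebra_simps)
  then show ?case using Suc nop_S by simp
qed (simp add: zero_S)

lemma int_S: "X \<in> S \<Longrightarrow> real_of_int n *\<^sub>R X \<in> S"
  using nat_S[of X "nat n"] uminus_S[OF nat_S[of X "nat (- n)"]]
  by (cases "n \<ge> 0") auto

lemma L_scale: "X \<in> L \<Longrightarrow> c *\<^sub>R X \<in> L"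
  by (simp add: L_def)

text \<open>Lie product formula: \<open>n\<close> times the product of \<open>U / n\<close> and
  \<open>V / n\<close> lies in \<open>S\<close> and tends to \<open>U + V\<close>, as the bracket
  terms carry additional factors \<open>1 / n\<close>.\<close>

lemma L_add:
  assumes "X \<in> L" "Y \<in> L" shows "X + Y \<in> L"
  unfolding L_def
proof (intro CollectI allI)
  fix t
  define U V where "U = t *\<^sub>R X" and "V = t *\<^sub>R Y"
  have UV: "U \<in> L" "V \<in> L" using assms by (auto simp: U_def V_def L_scale)
  define a where "a k = inverse (real (Suc k))" for k
  have a: "a \<longlonglongrightarrow> 0" unfolding a_def by (rule LIMSEQ_inverse_real_of_nat)
  define Z where "Z k = real (Suc k) *\<^sub>R nop (a k *\<^sub>R U) (a k *\<^sub>R V)" for k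
  have Zeq: "Z k = U + V + (1/2 * a k) *\<^sub>R nbr U V + (1/12 * (a k * a k)) *\<^sub>R nbr (U - V) (nbr U V)" for k
  proof -
    have "nbr (a k *\<^sub>R U - a k *\<^sub>R V) (nbr (a k *\<^sub>R U) (a k *\<^sub>R V)) =
        (a k * (a k * a k)) *\<^sub>R nbr (U - V) (nbr U V)"
      by (simp add: scaleR_diff_right[symmetric] nbr_scaleR)
    moreover have "real (Suc k) * a k = 1" by (simp add: a_def)
    ultimately show ?thesis
      unfolding Z_def nop_def scaleR_add_right nbr_scaleR scaleR_scaleR
      by (simp add: mult.assoc[symmetric] mult.commute[of "real (Suc k)"] del: of_nat_Suc)
  qed
  have "Z k \<in> S" for k
    unfolding Z_def using UV by (intro nat_S nop_S L_S L_scale)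
  moreover have "Z \<longlonglongrightarrow> U + V + (1/2 * 0) *\<^sub>R nbr U V + (1/12 * (0 * 0)) *\<^sub>R nbr (U - V) (nbr U V)"
    unfolding Zeq by (intro tendsto_intros a)
  ultimately have "U + V \<in> S"
    using closed_sequentially[OF closed_S, of Z "U + V"] by simp
  then show "t *\<^sub>R (X + Y) \<in> S" by (simp add: U_def V_def scaleR_add_right)
qed

lemma subspace_L: "subspace L"
  using L_add L_scale by (auto simp: subspace_def L_def zero_S)

lemma L_conj:
  assumes "X \<in> S" "Y \<in> L" shows "Y + nbr X Y + (1/2) *\<^sub>R nbr X (nbr X Y) \<in> L"
  unfolding L_def
proof (intro CollectI allI)
  fix t
  have "t *\<^sub>R (Y + nbr X Y + (1/2) *\<^sub>R nbr X (nbr X Y)) = nop (nop X (t *\<^sub>R Y)) (- X)"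
    unfolding nop_conj by (simp add: nbr.scaleR_right scaleR_add_right)
  also have "\<dots> \<in> S" using assms L_S[OF L_scale[OF assms(2)]] by (intro nop_S uminus_S)
  finally show "t *\<^sub>R (Y + nbr X Y + (1/2) *\<^sub>R nbr X (nbr X Y)) \<in> S" .
qed

text \<open>Conjugations by \<open>X\<close> and by \<open>- X\<close> both map \<open>Y\<close>
  into \<open>L\<close>. Half the difference of the results is the bracket; the quadratic terms
  cancel.\<close>

lemma L_nbr:
  assumes "X \<in> L" "Y \<in> L" shows "nbr X Y \<in> L"
proof -
  have "Y + nbr X Y + (1/2) *\<^sub>R nbr X (nbr X Y) \<in> L"
    using L_conj assms L_S by blast
  moreover have "Y - nbr X Y + (1/2) *\<^sub>R nbr X (nbr X Y) \<in> L"
    using L_conj[of "- X" Y] assms L_S uminus_S by (simp add: nbr.minus_left nbr.minus_right)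
  ultimately have "(1/2) *\<^sub>R ((Y + nbr X Y + (1/2) *\<^sub>R nbr X (nbr X Y)) -
      (Y - nbr X Y + (1/2) *\<^sub>R nbr X (nbr X Y))) \<in> L"
    using subspace_L subspace_diff L_scale by blast
  then show ?thesis by (simp flip: scaleR_add_left add: scaleR_2[symmetric])
qed

lemma L_nop: "X \<in> L \<Longrightarrow> Y \<in> L \<Longrightarrow> nop X Y \<in> L"
  unfolding nop_def using subspace_L
  by (intro L_add L_scale L_nbr subspace_diff) auto

text \<open>Von Neumann's argument: if elements of \<open>S\<close> outside \<open>L\<close> accumulate at \<open>0\<close>, divide each of them by its
  best approximation in \<open>L\<close>; the limit direction of the quotients lies in \<open>L\<close>, so that the approximation
  can be improved.\<close>

lemma L_local: "\<exists>e>0. \<forall>X\<in>S. norm X < e \<longrightarrow> X \<in> L"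
proof (rule ccontr)
  assume "\<not> ?thesis"
  then have "\<forall>e>0. \<exists>X. X \<in> S \<and> norm X < e \<and> X \<notin> L" by blast
  then have "\<exists>X. X \<in> S \<and> norm X < inverse (real (Suc n)) \<and> X \<notin> L" for n by simp
  then obtain X where X: "\<And>n. X n \<in> S" "\<And>n. norm (X n) < inverse (real (Suc n))" "\<And>n. X n \<notin> L"
    by metis
  \<comment> \<open>All quotients of \<open>X n\<close> by elements of \<open>L\<close> that are no
    longer than \<open>X n\<close>. The norm bound makes this set compact, and it contains
    \<open>X n\<close>, so a shortest quotient exists.\<close>
  define A where "A n = {Z. norm Z \<le> norm (X n) \<and> nop (X n) (- Z) \<in> L}" for n
  have "\<exists>Z\<in>A n. \<forall>Z'\<in>A n. norm Z \<le> norm Z'" for n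
  proof -
    have "closed ((\<lambda>Z. nop (X n) (- Z)) -` L)"
      using subspace_L by (intro closed_vimage closed_subspace continuous_nop continuous_intros) auto
    moreover have "A n = cball 0 (norm (X n)) \<inter> (\<lambda>Z. nop (X n) (- Z)) -` L"
      by (auto simp: A_def)
    ultimately have "compact (A n)" by auto
    moreover have "X n \<in> A n" using subspace_L by (simp add: A_def subspace_0)
    ultimately show ?thesis
      using continuous_attains_inf[of "A n" norm] by (fastforce intro: continuous_intros)
  qed
  then obtain Z where Z: "\<And>n. Z n \<in> A n" "\<And>n Z'. Z' \<in> A n \<Longrightarrow> norm (Z n) \<le> norm Z'" by metis
  have ZX: "norm (Z n) \<le> norm (X n)" "nop (X n) (- Z n) \<in> L" for n
    using Z(1) by (auto simp: A_def)
  have ZS: "Z n \<in> S" for n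
  proof -
    have "nop (- nop (X n) (- Z n)) (X n) \<in> S"
      by (rule nop_S[OF uminus_S[OF L_S[OF ZX(2)]] X(1)])
    then show ?thesis by (simp add: nop_minus_rev nop_assoc)
  qed
  have Z0: "Z n \<noteq> 0" for n using ZX(2)[of n] X(3)[of n] by auto
  have Zlim: "(\<lambda>n. norm (Z n)) \<longlonglongrightarrow> 0"
  proof (rule tendsto_sandwich[OF _ _ tendsto_const LIMSEQ_inverse_real_of_nat])
    show "\<forall>\<^sub>F n in sequentially. norm (Z n) \<le> inverse (real (Suc n))"
      using X(2) by (intro always_eventually allI order_trans[OF ZX(1)] less_imp_le)
  qed auto
  define D where "D n = (1 / norm (Z n)) *\<^sub>R Z n" for n
  have "\<forall>n. D n \<in> sphere 0 1" using Z0 by (simp add: D_def)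
  then obtain W r where W: "W \<in> sphere 0 1" "strict_mono r" "(D \<circ> r) \<longlonglongrightarrow> W"
    by (rule seq_compactE[OF compact_imp_seq_compact[OF compact_sphere]])
  have Zr: "(\<lambda>n. norm (Z (r n))) \<longlonglongrightarrow> 0"
    using LIMSEQ_subseq_LIMSEQ[OF Zlim W(2)] by (simp add: o_def)
  have "W \<in> L"
    unfolding L_def
  proof (intro CollectI allI)
    fix t
    \<comment> \<open>Integer multiples of elements of \<open>S\<close> stay in \<open>S\<close>,
      and rounding costs at most one step of length \<open>norm (Z (r n))\<close>, which tends to
      0.\<close>
    define k where "k n = \<lfloor>t / norm (Z (r n))\<rfloor>" for n
    have "(\<lambda>n. k n * norm (Z (r n)) - t) \<longlonglongrightarrow> 0"
    proof (rule Lim_null_comparison[OF _ Zr], intro always_eventually allI)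
      fix n
      have "k n \<le> t / norm (Z (r n))" "t / norm (Z (r n)) < k n + 1"
        unfolding k_def by linarith+
      then have "k n * norm (Z (r n)) \<le> t" "t < (k n + 1) * norm (Z (r n))"
        using Z0[of "r n"] by (simp_all add: pos_le_divide_eq pos_divide_less_eq)
      then show "norm (k n * norm (Z (r n)) - t) \<le> norm (Z (r n))"
        by (simp add: algebra_simps)
    qed
    then have "(\<lambda>n. k n * norm (Z (r n))) \<longlonglongrightarrow> t" by (simp add: LIM_zero_iff)
    then have "(\<lambda>n. (k n * norm (Z (r n))) *\<^sub>R (D \<circ> r) n) \<longlonglongrightarrow> t *\<^sub>R W"
      by (intro tendsto_intros W(3))
    moreover have "(k n * norm (Z (r n))) *\<^sub>R (D \<circ> r) n = k n *\<^sub>R Z (r n)" for n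
      using Z0 by (simp add: D_def)
    ultimately have "(\<lambda>n. k n *\<^sub>R Z (r n)) \<longlonglongrightarrow> t *\<^sub>R W" by simp
    then show "t *\<^sub>R W \<in> S"
      by (rule closed_sequentially[OF closed_S int_S[OF ZS]])
  qed
  have "\<exists>K>0. \<forall>a b. norm (nbr a b :: 'k ncoord) \<le> norm a * norm b * K" by (rule nbr.pos_bounded)
  then obtain K where K: "K > 0" "\<And>a b. norm (nbr a b :: 'k ncoord) \<le> norm a * norm b * K" by blast
  define f where "f n = norm ((D \<circ> r) n - W) + (1/2 * K * norm (Z (r n)) + K\<^sup>2 / 6 * (norm (Z (r n)))\<^sup>2)" for n
  have "f \<longlonglongrightarrow> norm (W - W) + (1/2 * K * 0 + K\<^sup>2 / 6 * 0\<^sup>2)"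
    unfolding f_def by (intro tendsto_intros W(3) Zr)
  then have "f \<longlonglongrightarrow> 0" by simp
  then have "\<forall>\<^sub>F n in sequentially. f n < 1" by (rule order_tendstoD) simp
  then obtain n where fn: "f n < 1" using eventually_happens'[OF sequentially_bot] by blast
  \<comment> \<open>Removing \<open>s *\<^sub>R W\<close> from \<open>Z m\<close> leaves norm at
    most \<open>s * f n\<close>, since the bracket terms are of higher order in \<open>s\<close>.
    This is below \<open>s\<close>, against minimality.\<close>
  define m s Z' where "m = r n" and "s = norm (Z m)" and "Z' = nop (- (s *\<^sub>R W)) (Z m)"
  have s0: "s > 0" using Z0 by (simp add: s_def)
  have W1: "norm W = 1" using W(1) by simp
  have b1: "norm (nbr (- (s *\<^sub>R W)) (Z m)) \<le> s * s * K"
    using K(2)[of "- (s *\<^sub>R W)" "Z m"] s0 W1 by (simp add: s_def)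
  have "norm (nbr (- (s *\<^sub>R W) - Z m) (nbr (- (s *\<^sub>R W)) (Z m))) \<le> (2 * s) * (s * s * K) * K"
  proof -
    have "norm (- (s *\<^sub>R W) - Z m) \<le> 2 * s"
      using norm_triangle_ineq4[of "- (s *\<^sub>R W)" "Z m"] s0 W1 by (simp add: s_def)
    then have "norm (- (s *\<^sub>R W) - Z m) * norm (nbr (- (s *\<^sub>R W)) (Z m)) \<le> (2 * s) * (s * s * K)"
      using b1 s0 by (intro mult_mono) auto
    then have "norm (- (s *\<^sub>R W) - Z m) * norm (nbr (- (s *\<^sub>R W)) (Z m)) * K \<le> (2 * s) * (s * s * K) * K"
      using K(1) by (intro mult_right_mono) auto
    then show ?thesis by (rule order_trans[OF K(2)])
  qed
  moreover have "norm Z' \<le> norm (Z m - s *\<^sub>R W) + norm ((1/2) *\<^sub>R nbr (- (s *\<^sub>R W)) (Z m))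
      + norm ((1/12) *\<^sub>R nbr (- (s *\<^sub>R W) - Z m) (nbr (- (s *\<^sub>R W)) (Z m)))"
  proof -
    have Zeq: "Z' = Z m - s *\<^sub>R W + (1/2) *\<^sub>R nbr (- (s *\<^sub>R W)) (Z m)
      + (1/12) *\<^sub>R nbr (- (s *\<^sub>R W) - Z m) (nbr (- (s *\<^sub>R W)) (Z m))"
      by (simp add: Z'_def nop_def)
    show ?thesis
      unfolding Zeq by (intro order_trans[OF norm_triangle_ineq] add_right_mono norm_triangle_ineq)
  qed
  ultimately have "norm Z' \<le> norm (Z m - s *\<^sub>R W) + (1/2) * (s * s * K) + (1/12) * ((2 * s) * (s * s * K) * K)"
    using b1 unfolding norm_scaleR abs_divide abs_one abs_numeral by linarith
  also have "Z m - s *\<^sub>R W = s *\<^sub>R ((D \<circ> r) n - W)"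
    using s0 by (simp add: D_def m_def s_def scaleR_diff_right)
  also have "norm (s *\<^sub>R ((D \<circ> r) n - W)) + (1/2) * (s * s * K) + (1/12) * ((2 * s) * (s * s * K) * K) = s * f n"
    using s0 unfolding norm_scaleR by (simp add: f_def s_def[symmetric] m_def[symmetric] power2_eq_square algebra_simps)
  also have "\<dots> < s" using fn s0 by simp
  finally have lt: "norm Z' < norm (Z m)" by (simp add: s_def)
  have "nop (X m) (- Z') = nop (nop (X m) (- Z m)) (s *\<^sub>R W)"
    by (simp add: Z'_def nop_minus_rev nop_assoc)
  also have "\<dots> \<in> L" by (rule L_nop[OF ZX(2) L_scale[OF \<open>W \<in> L\<close>]])
  finally have "Z' \<in> A m" using lt ZX(1)[of m] by (simp add: A_def)
  then show False using Z(2)[of Z' m] lt by simp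
qed

text \<open>\<open>L_local\<close>, translated by elements of \<open>L\<close>, makes
  \<open>L\<close> open in \<open>S\<close>; as a subspace it is also closed.\<close>

lemma connected_L:
  assumes "connected S" shows "S = L"
proof -
  have LS: "L \<subseteq> S" using L_S by blast
  obtain e where e: "e > 0" "\<And>X. X \<in> S \<Longrightarrow> norm X < e \<Longrightarrow> X \<in> L" using L_local by blast
  have "openin (top_of_set S) L"
    unfolding openin_contains_ball
  proof (intro conjI ballI LS)
    fix X assume X: "X \<in> L"
    have "continuous_on UNIV (\<lambda>Y. nop (- X) Y)" by (intro continuous_nop continuous_intros)
    from this[unfolded continuous_on_iff, rule_format, OF UNIV_I e(1), of X]
    obtain d where d: "d > 0" "\<And>Y. dist Y X < d \<Longrightarrow> dist (nop (- X) Y) (nop (- X) X) < e"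
      by auto
    have "Y \<in> L" if "Y \<in> ball X d \<inter> S" for Y
    proof -
      have Y: "Y \<in> S" "dist Y X < d" using that by (auto simp: dist_commute)
      have "nop (- X) Y \<in> L"
      proof (rule e(2)[OF nop_S[OF uminus_S[OF L_S[OF X]] Y(1)]])
        show "norm (nop (- X) Y) < e" using d(2)[OF Y(2)] by simp
      qed
      then have "nop X (nop (- X) Y) \<in> L" using X L_nop by blast
      then show ?thesis by simp
    qed
    then show "\<exists>d>0. ball X d \<inter> S \<subseteq> L" using d(1) by blast
  qed
  moreover have "closedin (top_of_set S) L"
    using LS closed_subspace[OF subspace_L] by (simp add: closed_subset)
  moreover have "L \<noteq> {}" using subspace_L subspace_0 by blast
  ultimately show ?thesis using assms connected_clopen[of S] by blast
qed

end

section \<open>The unipotent group as the image of \<open>expn\<close>, and the Lie algebras of its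
  subgroups\<close>

lemma OJ_entries:
  "A \<in> OJ \<longleftrightarrow> (\<forall>i j. A $ Last $ i * A $ First $ j + A $ Penult $ i * A $ Second $ j
     + (\<Sum>k\<in>UNIV. A $ Mid k $ i * A $ Mid k $ j) + A $ Second $ i * A $ Penult $ j
     + A $ First $ i * A $ Last $ j = (if j = opp i then 1 else 0))"
proof -
  have "(transpose A ** Jm ** A) $ i $ j = (A *v ax i) \<bullet> (Jm *v (A *v ax j))" for i j
    by (simp add: mat_entry[symmetric] matrix_vector_mul_assoc[symmetric] adjoint inner_commute
        matrix_mul_assoc[symmetric])
  moreover have "A *v ax i = column i A" for i by (simp add: matrix_vector_mult_basis)
  ultimately have "(transpose A ** Jm ** A) $ i $ j = A $ Last $ i * A $ First $ j + A $ Penult $ i * A $ Second $ j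
     + (\<Sum>k\<in>UNIV. A $ Mid k $ i * A $ Mid k $ j) + A $ Second $ i * A $ Penult $ j
     + A $ First $ i * A $ Last $ j" for i j
    by (simp add: inner_vec_def sum_idx column_def)
  then show ?thesis
    by (simp add: OJ_def vec_eq_iff Jm_def)
qed

lemma expn_OJ: "expn X \<in> OJ"
proof -
  obtain \<phi> x y \<eta> where X: "X = (\<phi>, x, y, \<eta>)" by (metis prod_cases4)
  show ?thesis
    unfolding OJ_entries X expn_entry
    by (intro allI; case_tac i; case_tac j; simp add: sum_inner sum_delta_mult del: mult_if_delta vec_comps;
        simp add: inner_expand inner_commute[of y x] power2_eq_square field_simps)
qed

lemma det_OJ: 
  assumes "A \<in> OJ" shows "(det A)\<^sup>2 = 1"
proof -
  have "det (Jm :: 'a mat2n) * det (Jm :: 'a mat2n) = 1"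
    by (simp add: det_mul[symmetric] Jm_Jm)
  moreover have "det A * det (Jm :: 'a mat2n) * det A = det (Jm :: 'a mat2n)"
  proof -
    have "det (transpose A ** Jm ** A) = det (Jm :: 'a mat2n)" using assms by (simp add: OJ_def)
    then show ?thesis by (simp add: det_mul)
  qed
  then have "(det A)\<^sup>2 * (det (Jm :: 'a mat2n) * det (Jm :: 'a mat2n)) =
      det (Jm :: 'a mat2n) * det (Jm :: 'a mat2n)"
    by (simp add: power2_eq_square mult_ac)
  ultimately show ?thesis by simp
qed

text \<open>\<open>expn X\<close> is the square of \<open>expn ((1/2) *\<^sub>R X)\<close>, whose
  determinant is 1 or -1.\<close>

lemma det_expn: "det (expn X) = 1"
proof -
  have "expn X = expn ((1/2) *\<^sub>R X) ** expn ((1/2) *\<^sub>R X)"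
    unfolding expn_nop nop_scaleR_self by simp
  then have "det (expn X) = (det (expn ((1/2) *\<^sub>R X)))\<^sup>2"
    by (simp add: det_mul power2_eq_square)
  then show ?thesis using det_OJ[OF expn_OJ] by simp
qed

lemma expn_unipotent: "expn X \<in> upper_unipotent"
proof -
  obtain \<phi> x y \<eta> where X: "X = (\<phi>, x, y, \<eta>)" by (metis prod_cases4)
  have "expe \<phi> x y \<eta> i j = 0" if "j < i" for i j
    using that by (cases i; cases j) (auto simp: less_idx_def)
  moreover have "expe \<phi> x y \<eta> i i = 1" for i by (cases i) auto
  ultimately show ?thesis by (simp add: upper_unipotent_def X expn_entry)
qed

text \<open>The entries read by \<open>logn\<close> are free; the isometry equations determine all
  others.\<close>

lemma unipotent_OJ_expn:
  fixes A :: "'k::{finite,linorder} mat2n"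
  assumes A: "A \<in> OJ" "A \<in> upper_unipotent"
  shows "A = expn (logn A)"
proof -
  have z: "A $ i $ j = 0" if "j < i" for i j using A(2) that by (auto simp: upper_unipotent_def)
  have d: "A $ i $ i = 1" for i using A(2) by (auto simp: upper_unipotent_def)
  note z' = z[of First Second] z[of First "Mid _"] z[of First Penult] z[of First Last]
    z[of Second "Mid _"] z[of Second Penult] z[of Second Last] z[of "Mid _" Penult] z[of "Mid _" Last]
    z[of Penult Last]
  note zz = z'[unfolded less_idx_def block.simps, simplified]
  have e: "A $ Last $ i * A $ First $ j + A $ Penult $ i * A $ Second $ j
     + (\<Sum>k\<in>UNIV. A $ Mid k $ i * A $ Mid k $ j) + A $ Second $ i * A $ Penult $ j
     + A $ First $ i * A $ Last $ j = (if j = opp i then 1 else 0)" for i j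
    using A(1) unfolding OJ_entries by blast
  \<comment> \<open>A column of the middle block has squared length 1 and already a 1 on the
    diagonal, so its other entries vanish.\<close>
  have mm: "A $ Mid k $ Mid l = (if k = l then 1 else 0)" for k l
  proof (cases "k = l")
    case False
    have "(\<Sum>m\<in>UNIV. A $ Mid m $ Mid l * A $ Mid m $ Mid l) = 1"
      using e[of "Mid l" "Mid l"] by (simp add: zz)
    moreover have "(\<Sum>m\<in>UNIV. A $ Mid m $ Mid l * A $ Mid m $ Mid l) =
        1 + (\<Sum>m\<in>UNIV - {l}. A $ Mid m $ Mid l * A $ Mid m $ Mid l)"
      by (subst sum.remove[of _ l]) (auto simp: d)
    ultimately have "(\<Sum>m\<in>UNIV - {l}. A $ Mid m $ Mid l * A $ Mid m $ Mid l) = 0" by simp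
    then have "A $ Mid k $ Mid l * A $ Mid k $ Mid l = 0"
      using False by (subst (asm) sum_nonneg_eq_0_iff) auto
    then show ?thesis using False by simp
  qed (simp add: d)
  define y where "y = (\<chi> k. A $ Second $ Mid k)"
  define p where "p = (\<chi> k. A $ First $ Mid k)"
  define \<phi> where "\<phi> = A $ First $ Second"
  define x where "x = p - (\<phi> / 2) *\<^sub>R y"
  define c where "c = A $ First $ Penult"
  define \<eta> where "\<eta> = c + (x \<bullet> y) / 2 + \<phi> * (y \<bullet> y) / 6"
  have l: "logn A = (\<phi>, x, y, \<eta>)"
    by (simp add: logn_def Let_def y_def p_def \<phi>_def x_def \<eta>_def c_def)
  have 1: "A $ Mid k $ Penult = (- y) $ k" for k
    using e[of "Mid k" Penult] by (simp add: zz mm d sum_delta_mult y_def del: mult_if_delta)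
  have 2: "2 * A $ Second $ Penult = - (y \<bullet> y)"
    using e[of Penult Penult] by (simp add: zz mm d 1 sum_inner del: mult_if_delta vector_uminus_component)
  have 3: "A $ Penult $ Last = - \<phi>"
    using e[of Second Last] by (simp add: zz mm d \<phi>_def)
  have r: "A $ Mid k $ Last = (\<phi> *\<^sub>R y - p) $ k" for k
    using e[of "Mid k" Last] by (simp add: zz mm d 3 sum_delta_mult y_def p_def algebra_simps del: mult_if_delta)
  have 4: "A $ Second $ Last = - (A $ Second $ Penult * (- \<phi>)) - (- y) \<bullet> (\<phi> *\<^sub>R y - p) - c"
    using e[of Penult Last] 
    by (simp add: zz mm d 3 1 r sum_inner c_def del: mult_if_delta vec_comps)
  have 5: "2 * A $ First $ Last = 2 * \<phi> * A $ Second $ Last - (\<phi> *\<^sub>R y - p) \<bullet> (\<phi> *\<^sub>R y - p)"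
    using e[of Last Last] 
    by (simp add: zz mm d 3 1 r sum_inner del: mult_if_delta vec_comps)
  have 6: "A $ Second $ Penult = - (y \<bullet> y) / 2" using 2 by simp
  have p: "p = x + (\<phi> / 2) *\<^sub>R y" by (simp add: x_def)
  have c: "c = \<eta> - (x \<bullet> y) / 2 - \<phi> * (y \<bullet> y) / 6" by (simp add: \<eta>_def)
  have 7: "A $ Second $ Last = - \<eta> - (x \<bullet> y) / 2 + \<phi> * (y \<bullet> y) / 6"
    unfolding 4 6 p c by (simp add: inner_expand inner_commute[of y x] algebra_simps add_divide_distrib)
  have 8: "A $ First $ Mid k = (x + (\<phi> / 2) *\<^sub>R y) $ k" "A $ Second $ Mid k = y $ k" for k
    unfolding p[symmetric] by (simp_all add: p_def y_def)
  have 9: "A $ Mid k $ Last = ((\<phi> / 2) *\<^sub>R y - x) $ k" for k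
    unfolding r p by simp
  have 10: "A $ First $ Last = - \<phi> * \<eta> - (x \<bullet> x) / 2 + \<phi>\<^sup>2 * (y \<bullet> y) / 24"
    using 5 unfolding 7 p
    by (simp add: inner_expand inner_commute[of y x] power2_eq_square field_simps)
  have "A $ i $ j = expn (\<phi>, x, y, \<eta>) $ i $ j" for i j
    unfolding expn_entry
    by (cases i; cases j; simp add: zz mm d 1 3 6 7 8 9 10 c_def[symmetric] \<phi>_def[symmetric] c del: vec_comps)
  then show ?thesis unfolding l by (simp add: vec_eq_iff)
qed

lemma carrier_N2n: "carrier (N2n :: 'k::{finite,linorder} mat2n monoid) = range expn"
proof -
  have "carrier (N2n :: 'k mat2n monoid) = carrier SO2n \<inter> upper_unipotent"
    by (simp add: N2n_def)
  also have "\<dots> = range expn"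
    using unipotent_OJ_expn by (auto simp: carrier_SO2n det_expn expn_OJ expn_unipotent)
  finally show ?thesis .
qed

lemma closed_upper_unipotent: "closed (upper_unipotent :: 'k::{finite,linorder} mat2n set)"
proof -
  have "upper_unipotent = {A :: 'k mat2n. \<forall>i j. j < i \<longrightarrow> A $ i $ j = 0} \<inter> {A. \<forall>i. A $ i $ i = 1}"
    by (auto simp: upper_unipotent_def)
  also have "closed \<dots>"
    by (intro closed_Int closed_Collect_all closed_Collect_imp closed_Collect_eq continuous_intros) simp
  finally show ?thesis .
qed

lemma continuous_expn: "continuous_on S (expn :: 'k::finite ncoord \<Rightarrow> _)"
proof -
  have 1: "continuous_on S (\<lambda>X :: 'k ncoord. expe (fst X) (fst (snd X)) (fst (snd (snd X))) (snd (snd (snd X))) i j)"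
    for i j
    by (cases i; cases j; simp del: vec_comps; intro continuous_intros; simp)
  have 2: "expn = (\<lambda>X :: 'k ncoord. \<chi> i j. expe (fst X) (fst (snd X)) (fst (snd (snd X))) (snd (snd (snd X))) i j)"
    by (auto simp: expn_def fun_eq_iff)
  show ?thesis unfolding 2 by (intro continuous_on_vec_lambda 1)
qed

text \<open>\<open>Lie_algebra\<close> ranges over arbitrary matrices, for which the exponential
  series need not stop. A power series for each entry makes it differentiable in the
  parameter.\<close>

lemma mat_exp_entry:
  fixes X :: "real^'n^'n"
  defines "P \<equiv> \<lambda>k. (((**) X ^^ k) (mat 1))"
  shows "mat_exp (t *\<^sub>R X) $ i $ j = (\<Sum>k. (P k $ i $ j / fact k) * t ^ k)"
    "summable (\<lambda>k. (P k $ i $ j / fact k) * t ^ k)"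
proof -
  define n where "n = real CARD('n)"
  have n: "n \<ge> 1" by (simp add: n_def Suc_leI)
  have Xe: "\<bar>X $ i $ j\<bar> \<le> norm X" for i j
    using component_le_norm_cart[of "X $ i" j] Finite_Cartesian_Product.norm_nth_le[of X i] by linarith
  have Pe: "\<bar>P k $ i $ j\<bar> \<le> (n * norm X) ^ k" for k i j
  proof (induction k arbitrary: i j)
    case 0 then show ?case by (simp add: P_def mat_def)
  next
    case (Suc k)
    have "\<bar>(X ** P k) $ i $ j\<bar> \<le> n * (norm X * (n * norm X) ^ k)"
      unfolding n_def by (rule matrix_mult_entry_le) (use Xe Suc in \<open>auto simp: n_def\<close>)
    then show ?case by (simp add: P_def mult_ac)
  qed
  have sm: "summable (\<lambda>k. (P k $ i $ j / fact k) * t ^ k)" for i j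
  proof (rule summable_comparison_test')
    show "summable (\<lambda>k. inverse (fact k) * (n * norm X * \<bar>t\<bar>) ^ k)" by (rule summable_exp)
    fix k
    have "\<bar>P k $ i $ j\<bar> * (\<bar>t\<bar> ^ k / fact k) \<le> (n * norm X) ^ k * (\<bar>t\<bar> ^ k / fact k)"
      using Pe by (intro mult_right_mono) auto
    then show "norm ((P k $ i $ j / fact k) * t ^ k) \<le> inverse (fact k) * (n * norm X * \<bar>t\<bar>) ^ k"
      by (simp add: abs_mult power_abs power_mult_distrib field_simps)
  qed
  have Pt: "((**) (t *\<^sub>R X) ^^ k) (mat 1) = t ^ k *\<^sub>R P k" for k
  proof (induction k)
    case (Suc k)
    have "(t *\<^sub>R X) ** (t ^ k *\<^sub>R P k) = (t ^ Suc k) *\<^sub>R (X ** P k)"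
      by (simp add: vec_eq_iff matrix_matrix_mult_def sum_distrib_left mult_ac)
    then show ?case using Suc by (simp add: P_def)
  qed (simp add: P_def)
  define F where "F k = (1 / fact k) *\<^sub>R (((**) (t *\<^sub>R X) ^^ k) (mat 1))" for k
  define M where "M = (\<chi> i j. \<Sum>k. (P k $ i $ j / fact k) * t ^ k)"
  have "F sums M"
    unfolding sums_def
  proof (intro vec_tendstoI)
    fix i j
    have "(\<lambda>k. (P k $ i $ j / fact k) * t ^ k) sums (M $ i $ j)"
      unfolding M_def using sm by (simp add: summable_sums)
    then show "((\<lambda>N. (\<Sum>k<N. F k) $ i $ j) \<longlongrightarrow> M $ i $ j) sequentially"
      by (simp add: sums_def F_def Pt mult_ac)
  qed
  then have "mat_exp (t *\<^sub>R X) = M"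
    unfolding mat_exp_def F_def[symmetric] by (rule sums_unique[symmetric])
  then show "mat_exp (t *\<^sub>R X) $ i $ j = (\<Sum>k. (P k $ i $ j / fact k) * t ^ k)"
    by (simp add: M_def)
  show "summable (\<lambda>k. (P k $ i $ j / fact k) * t ^ k)" by (rule sm)
qed

lemma mat_exp_DERIV:
  fixes X :: "real^'n^'n"
  shows "((\<lambda>t. mat_exp (t *\<^sub>R X) $ i $ j) has_real_derivative X $ i $ j) (at 0)"
proof -
  define c where "c k = ((((**) X ^^ k) (mat 1)) $ i $ j / fact k :: real)" for k
  have "((\<lambda>t. \<Sum>k. c k * t ^ k) has_real_derivative (\<Sum>k. diffs c k * 0 ^ k)) (at 0)"
    by (rule termdiffs_strong[of c 1]) (use mat_exp_entry(2)[of X i j 1] in \<open>simp_all add: c_def\<close>)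
  moreover have "(\<Sum>k. diffs c k * 0 ^ k) = X $ i $ j"
    by (simp only: powser_zero) (simp add: diffs_def c_def)
  moreover have "mat_exp (t *\<^sub>R X) $ i $ j = (\<Sum>k. c k * t ^ k)" for t
    unfolding c_def by (rule mat_exp_entry(1))
  ultimately show ?thesis by simp
qed

text \<open>The entries of \<open>expn\<close> satisfy polynomial relations. They hold along
  \<open>mat_exp (t *\<^sub>R X)\<close> for all \<open>t\<close>, and their derivatives at 0 are
  the linear equations of the Lie algebra.\<close>

lemma one_parameter_nm:
  fixes X :: "'k::finite mat2n"
  assumes "\<And>t. mat_exp (t *\<^sub>R X) \<in> range expn"
  shows "X \<in> range nm"
proof -
  define f where "f i j t = mat_exp (t *\<^sub>R X) $ i $ j" for i j t
  have D: "(f i j has_real_derivative X $ i $ j) (at 0)" for i j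
    unfolding f_def by (rule mat_exp_DERIV)
  have f0: "f i j 0 = (if i = j then 1 else 0)" for i j
  proof -
    have "f i j 0 = mat_exp (nm 0) $ i $ j" by (simp add: f_def linear_0[OF nm_linear])
    then show ?thesis by (simp only: mat_exp_nm expn_0) (simp add: mat_def)
  qed
  define Y where "Y t = logn (mat_exp (t *\<^sub>R X))" for t
  have Y: "mat_exp (t *\<^sub>R X) = expn (Y t)" for t using assms[of t] by (auto simp: Y_def)
  define \<phi> x y \<eta> where "\<phi> t = fst (Y t)" and "x t = fst (snd (Y t))"
    and "y t = fst (snd (snd (Y t)))" and "\<eta> t = snd (snd (snd (Y t)))" for t
  then have Y4: "Y t = (\<phi> t, x t, y t, \<eta> t)" for t by simp
  have fe: "f i j t = expe (\<phi> t) (x t) (y t) (\<eta> t) i j" for i j t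
    by (simp add: f_def Y Y4 expn_entry)
  have eqD: "X $ i $ j = d" if "\<And>t. f i j t = g t" "(g has_real_derivative d) (at 0)" for i j g d
  proof -
    have "f i j = g" using that(1) by (simp add: fun_eq_iff)
    then show ?thesis using DERIV_unique[OF D[of i j]] that(2) by blast
  qed
  have const: "X $ i $ j = 0" if "\<And>t. f i j t = c" for i j c
    using eqD[OF that DERIV_const] .
  have eq: "X $ i $ j = nent (X $ First $ Second) (\<chi> k. X $ First $ Mid k) (\<chi> k. X $ Second $ Mid k)
      (X $ First $ Penult) i j" for i j
  proof -
    note D' = D[THEN DERIV_cong]
    have m1: "X $ Mid k $ Penult = - X $ Second $ Mid k" for k
      by (rule eqD[OF _ DERIV_minus[OF D]]) (simp add: fe)
    have m2: "X $ Penult $ Last = - X $ First $ Second"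
      by (rule eqD[OF _ DERIV_minus[OF D]]) (simp add: fe)
    have m3: "X $ Mid k $ Last = - X $ First $ Mid k" for k
      by (rule eqD[of _ _ "\<lambda>t. f First Second t * f Second (Mid k) t - f First (Mid k) t"])
        (simp add: fe, auto intro!: derivative_eq_intros D' simp: f0)
    have m4: "X $ Second $ Penult = 0"
      by (rule eqD[of _ _ "\<lambda>t. - (\<Sum>k\<in>UNIV. f Second (Mid k) t * f Second (Mid k) t) / 2"])
        (simp add: fe sum_inner, auto intro!: derivative_eq_intros D' simp: f0)
    have m5: "X $ Second $ Last = - X $ First $ Penult"
      by (rule eqD[of _ _ "\<lambda>t. - f First Penult t -
            (\<Sum>k\<in>UNIV. (f First (Mid k) t - f First Second t / 2 * f Second (Mid k) t) * f Second (Mid k) t)"])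
        (simp add: fe sum_inner, auto intro!: derivative_eq_intros D' simp: f0)
    have m6: "X $ First $ Last = 0"
      by (rule eqD[of _ _ "\<lambda>t. f First Second t * f Second Last t -
            (\<Sum>k\<in>UNIV. f (Mid k) Last t * f (Mid k) Last t) / 2"])
        (simp add: fe sum_inner inner_expand inner_commute[of "y _" "x _"] power2_eq_square algebra_simps add_divide_distrib diff_divide_distrib
           del: vec_comps,
         auto intro!: derivative_eq_intros D' simp: f0)
    show ?thesis
      by (cases i; cases j) (simp_all add: m1 m2 m3 m4 m5 m6 const fe)
  qed
  have "X = nm (X $ First $ Second, \<chi> k. X $ First $ Mid k, \<chi> k. X $ Second $ Mid k, X $ First $ Penult)"
    unfolding vec_eq_iff nm_nent using eq by blast
  then show ?thesis by blast
qed

lemma expn_inv: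
  fixes G :: "'k::finite mat2n monoid"
  assumes "range expn \<subseteq> carrier G" "(\<otimes>\<^bsub>G\<^esub>) = (**)" "\<one>\<^bsub>G\<^esub> = mat 1"
  shows "inv\<^bsub>G\<^esub> (expn X) = expn (- X)"
  unfolding m_inv_def
proof (rule the_equality)
  show "expn (- X) \<in> carrier G \<and> expn X \<otimes>\<^bsub>G\<^esub> expn (- X) = \<one>\<^bsub>G\<^esub> \<and> expn (- X) \<otimes>\<^bsub>G\<^esub> expn X = \<one>\<^bsub>G\<^esub>"
    using assms by (auto simp: expn_nop)
  fix A assume A: "A \<in> carrier G \<and> expn X \<otimes>\<^bsub>G\<^esub> A = \<one>\<^bsub>G\<^esub> \<and> A \<otimes>\<^bsub>G\<^esub> expn X = \<one>\<^bsub>G\<^esub>"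
  have "A = (expn (- X) ** expn X) ** A" by (simp add: expn_nop)
  also have "\<dots> = expn (- X)" using A by (simp add: assms matrix_mul_assoc[symmetric])
  finally show "A = expn (- X)" .
qed

theorem connected_subgroup_N2n:
  fixes H :: "'k::{finite,linorder} mat2n set"
  assumes H: "closed_subgroup H N2n" "connected H"
  obtains h where "subspace h" "\<And>X Y. X \<in> h \<Longrightarrow> Y \<in> h \<Longrightarrow> nbr X Y \<in> h"
    "H = expn ` h" "Lie_algebra H = nm ` h" "Lie_dim H = dim h"
proof -
  have sub: "subgroup H N2n" and cl: "closedin (top_of_set (carrier N2n)) H"
    using H(1) by (auto simp: closed_subgroup_def)
  have HN: "H \<subseteq> range expn" using subgroup.subset[OF sub] by (simp add: carrier_N2n)
  have "closed (carrier N2n :: 'k mat2n set)"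
    by (simp add: N2n_def closed_Int closed_SO2n closed_upper_unipotent)
  then have clH: "closed H" using cl closedin_closed_trans by blast
  have mult: "(\<otimes>\<^bsub>N2n\<^esub>) = ((**) :: 'k mat2n \<Rightarrow> _)" and one: "\<one>\<^bsub>N2n\<^esub> = (mat 1 :: 'k mat2n)"
    by (simp_all add: N2n_def SO2n_def)
  define S where "S = expn -` H"
  have HS: "H = expn ` S" using HN by (auto simp: S_def)
  interpret closed_nsub S
  proof
    show "closed S" unfolding S_def by (intro closed_vimage clH continuous_expn)
    show "0 \<in> S" using subgroup.one_closed[OF sub] by (simp add: S_def one)
    show S2: "nop X Y \<in> S" if "X \<in> S" "Y \<in> S" for X Y
      using subgroup.m_closed[OF sub] that by (simp add: S_def mult expn_nop[symmetric])
    show "- X \<in> S" if "X \<in> S" for X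
    proof -
      have "inv\<^bsub>N2n\<^esub> (expn X) = expn (- X)"
        by (rule expn_inv) (simp_all add: carrier_N2n mult one)
      then show ?thesis using subgroup.m_inv_closed[OF sub, of "expn X"] that by (simp add: S_def)
    qed
  qed
  have "S = logn ` H" by (auto simp: HS image_image)
  then have "connected S" using connected_continuous_image[OF continuous_logn H(2)] by simp
  then have SL: "S = L" by (rule connected_L)
  have Lie: "Lie_algebra H = nm ` L"
  proof (intro equalityI subsetI)
    fix X assume X: "X \<in> Lie_algebra H"
    then obtain Z where Z: "X = nm Z"
      using one_parameter_nm[of X] HN unfolding Lie_algebra_def by blast
    have "t *\<^sub>R Z \<in> S" for t
      using X unfolding Lie_algebra_def Z by (simp add: linear_scale[OF nm_linear, symmetric] mat_exp_nm S_def)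
    then show "X \<in> nm ` L" by (auto simp: Z L_def)
  next
    fix X assume "X \<in> nm ` L"
    then obtain Z where Z: "Z \<in> L" "X = nm Z" by blast
    have "t *\<^sub>R Z \<in> S" for t using Z(1) by (simp add: L_def)
    then show "X \<in> Lie_algebra H"
      by (simp add: Z(2) Lie_algebra_def linear_scale[OF nm_linear, symmetric] mat_exp_nm S_def)
  qed
  have "Lie_dim H = dim L"
    unfolding Lie_dim_def Lie
    by (rule dim_image_eq[OF nm_linear]) (auto simp: inj_on_def nm_inject)
  then show ?thesis
    using that[OF subspace_L L_nbr] HS SL Lie by metis
qed

section \<open>Sizes of unipotent elements\<close>

definition gram :: "real ^ 'k::finite \<Rightarrow> real ^ 'k \<Rightarrow> real" where
  "gram x y = (x \<bullet> x) * (y \<bullet> y) - (x \<bullet> y)\<^sup>2"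

lemma gram_nonneg: "0 \<le> gram x y"
  using Cauchy_Schwarz_ineq[of x y] by (simp add: gram_def)

lemma gram_scaleR: "gram (s *\<^sub>R x) (t *\<^sub>R y) = s\<^sup>2 * t\<^sup>2 * gram x y"
  by (simp add: gram_def power2_eq_square algebra_simps)

lemma gram_zero [simp]: "gram 0 y = 0" "gram x 0 = 0"
  by (simp_all add: gram_def)

lemma gram_eq_0_iff:
  assumes "y \<noteq> 0" shows "gram x y = 0 \<longleftrightarrow> (\<exists>c. x = c *\<^sub>R y)"
proof
  assume g: "gram x y = 0"
  define c where "c = (x \<bullet> y) / (y \<bullet> y)"
  have "(x - c *\<^sub>R y) \<bullet> (x - c *\<^sub>R y) * (y \<bullet> y) = gram x y"
    using assms by (simp add: c_def gram_def inner_expand inner_commute[of y x] power2_eq_square field_simps)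
  then have "x - c *\<^sub>R y = 0" using g assms by simp
  then show "\<exists>c. x = c *\<^sub>R y" by auto
qed (auto simp: gram_def power2_eq_square)

text \<open>\<open>corner X\<close> is the entry \<open>(First, Last)\<close> of \<open>expn X\<close>, the entry of highest degree.\<close>

definition corner :: "'k::finite ncoord \<Rightarrow> real" where
  "corner = (\<lambda>(\<phi>, x, y, \<eta>). - \<phi> * \<eta> - (x \<bullet> x) / 2 + \<phi>\<^sup>2 * (y \<bullet> y) / 24)"

definition npn :: "'k::finite ncoord \<Rightarrow> real" where
  "npn X = (case X of (\<phi>, x, y, \<eta>) \<Rightarrow> \<bar>1 - corner X / 2\<bar>
    + \<bar>\<phi> - (\<eta> - (x \<bullet> y) / 2 - \<phi> * (y \<bullet> y) / 6)\<bar> / 2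
    + \<bar>\<phi> + (- \<eta> - (x \<bullet> y) / 2 + \<phi> * (y \<bullet> y) / 6)\<bar> / 2 + (1 + (y \<bullet> y) / 4))"

text \<open>All summands are nonnegative, so each is a lower bound. The coordinate \<eta> enters
  only through a shifted square.\<close>

definition npd :: "'k::finite ncoord \<Rightarrow> real" where
  "npd = (\<lambda>(\<phi>, x, y, \<eta>). 1 + (\<phi>\<^sup>2 + x \<bullet> x + y \<bullet> y) / 4 + \<phi>\<^sup>2 * (y \<bullet> y) / 16
    + (\<eta> + \<phi> * (y \<bullet> y) / 12)\<^sup>2 / 4 + gram x y / 16)"

lemma blk_entries:
  "blk A $ 1 $ 1 = (A $ First $ First - A $ First $ Last - A $ Last $ First + A $ Last $ Last) / 2"
  "blk A $ 1 $ 2 = (A $ First $ Second - A $ First $ Penult - A $ Last $ Second + A $ Last $ Penult) / 2"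
  "blk A $ 2 $ 1 = (A $ Second $ First - A $ Second $ Last - A $ Penult $ First + A $ Penult $ Last) / 2"
  "blk A $ 2 $ 2 = (A $ Second $ Second - A $ Second $ Penult - A $ Penult $ Second + A $ Penult $ Penult) / 2"
  by (simp_all add: blk_def fv_def matrix_vector_mult_diff_distrib inner_diff_left inner_diff_right mat_entry)

lemma pn_expn: "pn (expn X) = npn X"
proof -
  obtain \<phi> x y \<eta> where X: "X = (\<phi>, x, y, \<eta>)" by (metis prod_cases4)
  have a: "1 + (y \<bullet> y) / 4 = \<bar>1 + (y \<bullet> y) / 4\<bar>" by simp
  have b: "\<bar>u / 2\<bar> = \<bar>- u\<bar> / 2" for u :: real by simp
  show ?thesis
    unfolding pn_def sum_2 blk_entries X expn_entry expe.simps npn_def corner_def prod.case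
    by (subst a, subst (3) b) (simp add: field_simps)
qed

lemma pd_expn: "pd (expn X) = npd X"
proof -
  obtain \<phi> x y \<eta> where X: "X = (\<phi>, x, y, \<eta>)" by (metis prod_cases4)
  show ?thesis
    unfolding pd_def det_2 blk_entries X expn_entry expe.simps npd_def prod.case gram_def
    by (simp add: field_simps power2_eq_square)
qed

lemma npd_ge_1: "1 \<le> npd X"
  by (cases X rule: prod_cases4) (simp add: npd_def gram_nonneg)

lemma npn_ge_1: "1 \<le> npn X"
  by (cases X rule: prod_cases4) (simp add: npn_def)

lemma npn_ge:
  "\<bar>corner (\<phi>, x, y, \<eta>)\<bar> / 2 \<le> npn (\<phi>, x, y, \<eta>)"
  "1 + (y \<bullet> y) / 4 \<le> npn (\<phi>, x, y, \<eta>)"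
proof -
  define c where "c = corner (\<phi>, x, y, \<eta>)"
  have n: "npn (\<phi>, x, y, \<eta>) \<ge> \<bar>1 - c / 2\<bar> + (1 + (y \<bullet> y) / 4)"
    by (simp add: npn_def c_def)
  have "y \<bullet> y \<ge> 0" "\<bar>c\<bar> / 2 \<le> \<bar>1 - c / 2\<bar> + 1" by (simp, linarith)
  then show "\<bar>corner (\<phi>, x, y, \<eta>)\<bar> / 2 \<le> npn (\<phi>, x, y, \<eta>)"
    using n unfolding c_def[symmetric] by linarith
  show "1 + (y \<bullet> y) / 4 \<le> npn (\<phi>, x, y, \<eta>)" using n by simp
qed

lemma npn_le:
  "npn (\<phi>, x, y, \<eta>) \<le> 2 + \<bar>corner (\<phi>, x, y, \<eta>)\<bar> + \<bar>\<phi>\<bar> + \<bar>\<eta>\<bar> + \<bar>x \<bullet> y\<bar> + \<bar>\<phi>\<bar> * (y \<bullet> y) + y \<bullet> y"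
proof -
  define u where "u = \<phi> * (y \<bullet> y)"
  have "\<bar>u\<bar> = \<bar>\<phi>\<bar> * (y \<bullet> y)" by (simp add: u_def abs_mult)
  moreover have "0 \<le> y \<bullet> y" by simp
  ultimately show ?thesis
    by (simp add: npn_def u_def[symmetric] del: inner_ge_zero) argo
qed

definition ncrit :: "'k::finite ncoord set \<Rightarrow> bool" where
  "ncrit h \<longleftrightarrow> (\<exists>B\<ge>1. \<forall>a b. 1 \<le> b \<longrightarrow> b \<le> a \<longrightarrow>
    (\<exists>X\<in>h. a \<le> B * npn X \<and> npn X \<le> B * a \<and> a * b \<le> B * npd X \<and> npd X \<le> B * (a * b)))"

lemma Cartan_criterion_expn: "Cartan_criterion (expn ` h) \<longleftrightarrow> ncrit h"
proof -
  have "\<bar>npd X\<bar> = npd X" for X :: "'a ncoord" using npd_ge_1[of X] by simp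
  then show ?thesis
    by (simp add: Cartan_criterion_def ncrit_def pn_expn pd_expn)
qed

lemma continuous_npd:
  assumes "continuous_on S f" shows "continuous_on S (\<lambda>t. npd (f t))"
proof -
  have "npd X = 1 + ((fst X)\<^sup>2 + (fst (snd X)) \<bullet> (fst (snd X)) + (fst (snd (snd X))) \<bullet> (fst (snd (snd X)))) / 4
    + (fst X)\<^sup>2 * ((fst (snd (snd X))) \<bullet> (fst (snd (snd X)))) / 16
    + (snd (snd (snd X)) + fst X * ((fst (snd (snd X))) \<bullet> (fst (snd (snd X)))) / 12)\<^sup>2 / 4
    + (((fst (snd X)) \<bullet> (fst (snd X))) * ((fst (snd (snd X))) \<bullet> (fst (snd (snd X))))
       - ((fst (snd X)) \<bullet> (fst (snd (snd X))))\<^sup>2) / 16" for X :: "'b ncoord"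
    by (simp add: npd_def gram_def split: prod.split)
  then show ?thesis by (simp only:) (intro continuous_intros assms; simp)
qed

text \<open>For size \<open>a = R\<close> the product \<open>a * b\<close> ranges from
  \<open>R\<close> at \<open>b = 1\<close> to \<open>R\<^sup>2\<close> at \<open>b = a\<close>; the
  end conditions reach both extremes up to constants.\<close>

definition sweeps :: "'k::finite ncoord set \<Rightarrow> real \<Rightarrow> real \<Rightarrow> real \<Rightarrow> bool" where
  "sweeps h c C R \<longleftrightarrow> (\<exists>\<gamma> u v. u \<le> v \<and> continuous_on {u..v} \<gamma> \<and>
      (\<forall>t\<in>{u..v}. \<gamma> t \<in> h \<and> c * R \<le> npn (\<gamma> t) \<and> npn (\<gamma> t) \<le> C * R) \<and>
      npd (\<gamma> u) \<le> C * R \<and> c * R\<^sup>2 \<le> npd (\<gamma> (v::real)))"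

text \<open>By the intermediate value theorem, \<open>npd\<close> has to be controlled only at the two ends of a curve.\<close>

lemma ncrit_sweeps:
  fixes h :: "'k::finite ncoord set"
  assumes h: "0 \<in> h" and k: "k > 0" and c: "c > 0"
    and sweeps: "\<And>r. r \<ge> r0 \<Longrightarrow> r \<ge> 1 \<Longrightarrow> sweeps h c C (r ^ k)"
  shows "ncrit h"
  unfolding ncrit_def
proof (intro exI conjI allI impI)
  define B where "B = 1 + \<bar>C\<bar> + 1/c"
  have B: "B \<ge> 1" "B \<ge> C" "B * c \<ge> 1"
  proof -
    have i: "1/c > 0" using c by simp
    show "B \<ge> 1" "B \<ge> C" using i unfolding B_def by linarith+
    have "B * c = (1 + \<bar>C\<bar>) * c + 1" using c by (simp add: B_def field_simps)
    then show "B * c \<ge> 1" using c by simp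
  qed
  define r1 where "r1 = max r0 1"
  define R0 where "R0 = r1 ^ k"
  have R0: "R0 \<ge> 1" by (simp add: R0_def r1_def one_le_power)
  \<comment> \<open>The term \<open>R0\<^sup>2\<close> covers the bounded range
    \<open>a < R0\<close>, where the element 0 is taken and \<open>a * b\<close> is at most
    \<open>R0\<^sup>2\<close>.\<close>
  define D where "D = B + 2 + R0\<^sup>2"
  have R02: "R0 \<le> R0\<^sup>2" using R0 by (simp add: power2_eq_square)
  show "1 \<le> D" using B(1) by (simp add: D_def add_nonneg_nonneg add_increasing2)
  have BD: "B \<le> D" by (simp add: D_def)
  fix a b :: real assume ab: "1 \<le> b" "b \<le> a"
  have a: "a > 0" using ab by simp
  have bb: "b * a \<le> a\<^sup>2" "a \<le> a * b" using ab by (simp_all add: power2_eq_square)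
  have ab1: "1 \<le> a * b" using bb ab by linarith
  show "\<exists>X\<in>h. a \<le> D * npn X \<and> npn X \<le> D * a \<and> a * b \<le> D * npd X \<and> npd X \<le> D * (a * b)"
  proof (cases "a < R0")
    case True
    have z: "npn (0 :: 'k ncoord) = 2" "npd (0 :: 'k ncoord) = 1"
      by (simp_all add: npn_def npd_def corner_def zero_prod_def)
    have "a\<^sup>2 \<le> R0\<^sup>2" using True a by (intro power_mono) auto
    moreover have "2 * 1 \<le> D * a" "1 * 1 \<le> D * (a * b)"
      using B(1) ab ab1 by (intro mult_mono; simp add: D_def)+
    ultimately show ?thesis
      using h z True R02 R0 B(1) bb by (intro bexI[of _ 0]) (auto simp: D_def mult.commute[of b])
  next
    case False
    define r where "r = root k a"
    have rk: "r ^ k = a" using a k by (simp add: r_def)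
    have "root k (r1 ^ k) \<le> root k a"
      using False k by (intro real_root_le_mono) (auto simp: R0_def)
    then have "r \<ge> r1" using k by (simp add: r_def r1_def real_root_power_cancel)
    then have "sweeps h c C a" using sweeps[of r] by (simp add: rk r1_def)
    then obtain \<gamma> and u v :: real where g: "u \<le> v" "continuous_on {u..v} \<gamma>"
      "\<forall>t\<in>{u..v}. \<gamma> t \<in> h \<and> c * a \<le> npn (\<gamma> t) \<and> npn (\<gamma> t) \<le> C * a"
      "npd (\<gamma> u) \<le> C * a" "c * a\<^sup>2 \<le> npd (\<gamma> v)"
      unfolding sweeps_def by blast
    have up: "x \<le> B * a" if "x \<le> C * a" for x
      using that mult_right_mono[OF B(2), of a] a by linarith
    have lo: "x \<le> B * y" if "c * x \<le> y" "0 \<le> x" for x y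
    proof -
      have "x \<le> (B * c) * x" using B(3) that by (simp add: mult_le_cancel_right1)
      also have "\<dots> \<le> B * y" using that(1) B(1) mult_left_mono[of "c * x" y B] by (simp add: mult.assoc)
      finally show ?thesis .
    qed
    have ends: "npd (\<gamma> u) \<le> B * a" "a\<^sup>2 \<le> B * npd (\<gamma> v)"
      using up lo g(4,5) by auto
    have BT: "1 * (a * b) \<le> B * (a * b)" using B(1) ab1 by (intro mult_right_mono) auto
    have "\<exists>t\<in>{u..v}. a * b \<le> B * npd (\<gamma> t) \<and> npd (\<gamma> t) \<le> B * (a * b)"
    proof -
      consider "npd (\<gamma> u) \<ge> a * b" | "npd (\<gamma> v) \<le> a * b" | "npd (\<gamma> u) \<le> a * b" "a * b \<le> npd (\<gamma> v)"
        by linarith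
      then show ?thesis
      proof cases
        case 1
        have "B * a \<le> B * (a * b)" using bb B(1) by (intro mult_left_mono) auto
        moreover have "1 * npd (\<gamma> u) \<le> B * npd (\<gamma> u)"
          using B(1) npd_ge_1[of "\<gamma> u"] by (intro mult_right_mono) auto
        ultimately show ?thesis using 1 g(1) ends by (intro bexI[of _ u]) auto
      next
        case 2
        then show ?thesis using BT g(1) ends bb by (intro bexI[of _ v]) (auto simp: mult.commute[of b])
      next
        case 3
        have "continuous_on {u..v} (\<lambda>t. npd (\<gamma> t))" using g(2) by (rule continuous_npd)
        then obtain t where "u \<le> t" "t \<le> v" "npd (\<gamma> t) = a * b"
          using IVT'[of "\<lambda>t. npd (\<gamma> t)" u "a * b" v] 3 g(1) by auto
        then show ?thesis using BT by (intro bexI[of _ t]) auto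
      qed
    qed
    then obtain t where t: "t \<in> {u..v}" "a * b \<le> B * npd (\<gamma> t)" "npd (\<gamma> t) \<le> B * (a * b)" by blast
    have gt: "\<gamma> t \<in> h" "a \<le> B * npn (\<gamma> t)" "npn (\<gamma> t) \<le> B * a"
      using bspec[OF g(3) t(1)] up lo a by auto
    have "B * npn (\<gamma> t) \<le> D * npn (\<gamma> t)" "B * a \<le> D * a" "B * npd (\<gamma> t) \<le> D * npd (\<gamma> t)"
       "B * (a * b) \<le> D * (a * b)"
      using BD ab npd_ge_1[of "\<gamma> t"] npn_ge_1[of "\<gamma> t"] by (intro mult_right_mono; simp)+
    then show ?thesis using t gt by (intro bexI[of _ "\<gamma> t"]) auto
  qed
qed

section \<open>Curves in subalgebras\<close>

lemma corner_y0: "corner (\<phi>, x, 0, \<eta>) = - (2 * \<phi> * \<eta> + x \<bullet> x) / 2"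
  by (simp add: corner_def)

lemma norm_ncoord:
  fixes x y :: "real ^ 'k::finite"
  shows "(norm (\<phi>, x, y, \<eta>))\<^sup>2 = \<phi>\<^sup>2 + x \<bullet> x + y \<bullet> y + \<eta>\<^sup>2"
  by (simp add: norm_Pair power2_norm_eq_inner real_sqrt_pow2 add_nonneg_nonneg)

lemma abs_le_norm_ncoord:
  fixes x y :: "real ^ 'k::finite"
  shows "\<bar>\<phi>\<bar> \<le> norm (\<phi>, x, y, \<eta>)" "\<bar>\<eta>\<bar> \<le> norm (\<phi>, x, y, \<eta>)"
  "norm x \<le> norm (\<phi>, x, y, \<eta>)" "norm y \<le> norm (\<phi>, x, y, \<eta>)"
proof -
  have "\<bar>\<phi>\<bar>\<^sup>2 \<le> (norm (\<phi>, x, y, \<eta>))\<^sup>2" "\<bar>\<eta>\<bar>\<^sup>2 \<le> (norm (\<phi>, x, y, \<eta>))\<^sup>2"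
    "(norm x)\<^sup>2 \<le> (norm (\<phi>, x, y, \<eta>))\<^sup>2" "(norm y)\<^sup>2 \<le> (norm (\<phi>, x, y, \<eta>))\<^sup>2"
    unfolding norm_ncoord by (simp_all add: power2_norm_eq_inner)
  then show "\<bar>\<phi>\<bar> \<le> norm (\<phi>, x, y, \<eta>)" "\<bar>\<eta>\<bar> \<le> norm (\<phi>, x, y, \<eta>)"
    "norm x \<le> norm (\<phi>, x, y, \<eta>)" "norm y \<le> norm (\<phi>, x, y, \<eta>)"
    using power2_le_imp_le norm_ge_zero by blast+
qed

lemma npd_y0:
  fixes x :: "real ^ 'k::finite"
  shows "npd (\<phi>, x, 0, \<eta>) = 1 + (norm (\<phi>, x, 0 :: real ^ 'k, \<eta>))\<^sup>2 / 4"
  unfolding norm_ncoord by (simp add: npd_def)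

lemma npd_ge:
  "gram x y / 16 \<le> npd (\<phi>, x, y, \<eta>)"
  "(\<eta> + \<phi> * (y \<bullet> y) / 12)\<^sup>2 / 4 \<le> npd (\<phi>, x, y, \<eta>)"
proof -
  have "0 \<le> \<phi>\<^sup>2" "0 \<le> x \<bullet> x" "0 \<le> y \<bullet> y" "0 \<le> \<phi>\<^sup>2 * (y \<bullet> y)"
    "0 \<le> (\<eta> + \<phi> * (y \<bullet> y) / 12)\<^sup>2" "0 \<le> gram x y"
    by (simp_all add: gram_nonneg)
  then show "gram x y / 16 \<le> npd (\<phi>, x, y, \<eta>)"
    "(\<eta> + \<phi> * (y \<bullet> y) / 12)\<^sup>2 / 4 \<le> npd (\<phi>, x, y, \<eta>)"
    unfolding npd_def prod.case by argo+
qed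

text \<open>For \<open>y = 0\<close>, the value \<open>lq X X\<close> is
  \<open>- 2 * corner X\<close>; its vanishing is condition (ii).\<close>

definition lq :: "'k::finite ncoord \<Rightarrow> 'k ncoord \<Rightarrow> real" where
  "lq = (\<lambda>(\<phi>, x, y, \<eta>) (\<phi>', x', y', \<eta>'). \<phi> * \<eta>' + \<eta> * \<phi>' + x \<bullet> x')"

text \<open>For \<open>y = 0\<close> the size is governed by \<open>lq\<close> and linear terms, but
  \<open>npd\<close> by the squared norm. Moving along \<open>B\<close> and adjusting the multiple
  of \<open>A\<close> keeps \<open>lq\<close> at \<open>r\<^sup>2 * lq A A\<close> while the norm
  grows from order \<open>r\<close> to order \<open>r\<^sup>2\<close>.\<close>

lemma ncrit_y0:
  fixes A B :: "'k::finite ncoord"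
  assumes h: "subspace h" "A \<in> h" "B \<in> h" and y: "fst (snd (snd A)) = 0" "fst (snd (snd B)) = 0"
    and q: "lq A A \<noteq> 0" "B \<noteq> 0" "lq B B = 0"
  shows "ncrit h"
proof -
  have main: "ncrit h" if B: "B \<in> h" "fst (snd (snd B)) = 0" "B \<noteq> 0" "lq B B = 0" and k0: "lq A B / lq A A \<ge> 0" for B
  proof -
    define k where "k = lq A B / lq A A"
    have k: "k \<ge> 0" "lq A B = k * lq A A" using k0 q(1) by (simp_all add: k_def)
    obtain a xa ea where A4: "A = (a, xa, 0, ea)" using y(1) by (metis prod_cases4 fst_conv snd_conv)
    obtain b xb eb where B4: "B = (b, xb, 0, eb)" using B(2) by (metis prod_cases4 fst_conv snd_conv)
    define s where "s r t = sqrt (t\<^sup>2 * k\<^sup>2 + r\<^sup>2) - t * k" for r t :: real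
    \<comment> \<open>\<open>s r t\<close> is the positive root of the equation \<open>lq (g r t) (g r t) = r\<^sup>2 * lq A A\<close>\<close>
    define g where "g r t = s r t *\<^sub>R A + t *\<^sub>R B" for r t
    have s: "0 \<le> s r t" "s r t \<le> r" "(s r t)\<^sup>2 + 2 * s r t * t * k = r\<^sup>2" if "0 \<le> t" "0 \<le> r" for r t
    proof -
      have tk: "0 \<le> t * k" using that k by simp
      have "sqrt ((t * k)\<^sup>2) \<le> sqrt (t\<^sup>2 * k\<^sup>2 + r\<^sup>2)" by (intro real_sqrt_le_mono) (simp add: power_mult_distrib)
      then show "0 \<le> s r t" using tk by (simp add: s_def)
      have "sqrt (t\<^sup>2 * k\<^sup>2 + r\<^sup>2) \<le> sqrt ((t * k + r)\<^sup>2)"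
        using mult_nonneg_nonneg[OF tk that(2)] by (intro real_sqrt_le_mono) (simp add: power2_eq_square algebra_simps)
      then show "s r t \<le> r" using tk that by (simp add: s_def)
      have "(sqrt (t\<^sup>2 * k\<^sup>2 + r\<^sup>2))\<^sup>2 = t\<^sup>2 * k\<^sup>2 + r\<^sup>2" by (simp add: add_nonneg_nonneg)
      then show "(s r t)\<^sup>2 + 2 * s r t * t * k = r\<^sup>2"
        by (simp add: s_def power2_eq_square algebra_simps)
    qed
    have corner: "corner (g r t) = - lq A A * r\<^sup>2 / 2" if "0 \<le> t" "0 \<le> r" for r t
    proof -
      have "corner (g r t) = - ((s r t)\<^sup>2 * lq A A + 2 * s r t * t * lq A B + t\<^sup>2 * lq B B) / 2"
        by (simp add: g_def A4 B4 corner_y0 lq_def inner_expand inner_commute[of xb xa] power2_eq_square algebra_simps)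
      also have "\<dots> = - lq A A * ((s r t)\<^sup>2 + 2 * s r t * t * k) / 2"
        using B(4) k(2) by (simp add: algebra_simps)
      finally show ?thesis using s[OF that] by simp
    qed
    have gform: "\<exists>\<phi> x \<eta>. g r t = (\<phi>, x, 0, \<eta>)" for r t by (simp add: g_def A4 B4)
    have gh: "g r t \<in> h" for r t
      unfolding g_def using h(1,2) B(1) by (intro subspace_add subspace_scale)
    have ng: "norm (g r t) \<le> r * norm A + t * norm B" if "0 \<le> t" "0 \<le> r" for r t
    proof -
      have "norm (g r t) \<le> norm (s r t *\<^sub>R A) + norm (t *\<^sub>R B)" unfolding g_def by (rule norm_triangle_ineq)
      also have "\<dots> \<le> r * norm A + t * norm B" using s[OF that] that by (simp add: mult_right_mono)
      finally show ?thesis .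
    qed
    have nB: "norm B > 0" using B(3) by simp
    define C where "C = 2 + \<bar>lq A A\<bar> + 2 * norm A + 2 * norm B + (norm A)\<^sup>2"
    define c where "c = min (\<bar>lq A A\<bar> / 4) ((norm B)\<^sup>2 / 16)"
    show ?thesis
    proof (rule ncrit_sweeps[of h 2 c "2 * norm A / norm B" C])
      show "0 \<in> h" using h(1) subspace_0 by blast
      show "c > 0" using q(1) nB by (simp add: c_def)
      fix r :: real assume r: "r \<ge> 2 * norm A / norm B" "r \<ge> 1"
      have r2: "r \<le> r\<^sup>2" "1 \<le> r\<^sup>2" using r self_le_power[of r 2] one_le_power[of r 2] by simp_all
      have ar: "\<bar>r\<bar> = r" using r by simp
      show "sweeps h c C (r\<^sup>2)" unfolding sweeps_def
      proof (rule exI[of _ "g r"], rule exI[of _ 0], rule exI[of _ "r\<^sup>2"], intro conjI ballI)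
        show "0 \<le> r\<^sup>2" by simp
        show "continuous_on {0..r\<^sup>2} (g r)" unfolding g_def s_def by (intro continuous_intros)
        fix t assume t: "t \<in> {0..r\<^sup>2}"
        then have t': "0 \<le> t" "0 \<le> r" "t \<le> r\<^sup>2" using r by auto
        show "g r t \<in> h" by (rule gh)
        obtain \<phi> x \<eta> where g4: "g r t = (\<phi>, x, 0, \<eta>)" using gform by blast
        have "\<bar>lq A A\<bar> * r\<^sup>2 / 4 \<le> npn (g r t)"
          using npn_ge(1)[of \<phi> x 0 \<eta>] corner[OF t'(1,2)] unfolding g4 by (simp add: abs_mult)
        moreover have "c * r\<^sup>2 \<le> \<bar>lq A A\<bar> / 4 * r\<^sup>2" by (intro mult_right_mono) (auto simp: c_def)
        ultimately show "c * r\<^sup>2 \<le> npn (g r t)" by simp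
        have "npn (g r t) \<le> 2 + \<bar>lq A A\<bar> * r\<^sup>2 / 2 + \<bar>\<phi>\<bar> + \<bar>\<eta>\<bar>"
          using npn_le[of \<phi> x 0 \<eta>] corner[OF t'(1,2)] unfolding g4 by (simp add: abs_mult)
        also have "\<dots> \<le> 2 + \<bar>lq A A\<bar> * r\<^sup>2 / 2 + 2 * (r * norm A + t * norm B)"
        proof -
          have "\<bar>\<phi>\<bar> \<le> norm (g r t)" "\<bar>\<eta>\<bar> \<le> norm (g r t)"
            unfolding g4 by (rule abs_le_norm_ncoord)+
          from add_mono[OF order_trans[OF this(1) ng[OF t'(1,2)]] order_trans[OF this(2) ng[OF t'(1,2)]]]
          show ?thesis by simp
        qed
        also have "\<dots> \<le> 2 * r\<^sup>2 + \<bar>lq A A\<bar> * r\<^sup>2 + 2 * (r\<^sup>2 * norm A + r\<^sup>2 * norm B)"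
          using r2 t'(3) by (intro add_mono mult_left_mono mult_right_mono) auto
        also have "\<dots> \<le> C * r\<^sup>2" by (simp add: C_def algebra_simps)
        finally show "npn (g r t) \<le> C * r\<^sup>2" .
      next
        have pd: "npd (g r t) = 1 + (norm (g r t))\<^sup>2 / 4" for t
          using gform[of r t] npd_y0 by metis
        have "norm (g r 0) \<le> r * norm A" using ng[of 0 r] r by simp
        then have "(norm (g r 0))\<^sup>2 \<le> (r * norm A)\<^sup>2" by (intro power_mono) auto
        then have "npd (g r 0) \<le> (1 + (norm A)\<^sup>2 / 4) * r\<^sup>2"
          unfolding pd using r2 by (simp add: power_mult_distrib algebra_simps)
        also have "\<dots> \<le> C * r\<^sup>2" by (intro mult_right_mono) (simp_all add: C_def)
        finally show "npd (g r 0) \<le> C * r\<^sup>2" .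
        have "norm (s r (r\<^sup>2) *\<^sub>R A) \<le> r * norm A"
          using s[of "r\<^sup>2" r] r by (simp add: mult_right_mono)
        moreover have "r\<^sup>2 * norm B = norm (g r (r\<^sup>2) - s r (r\<^sup>2) *\<^sub>R A)" by (simp add: g_def)
        moreover have "norm (g r (r\<^sup>2) - s r (r\<^sup>2) *\<^sub>R A) \<le> norm (g r (r\<^sup>2)) + norm (s r (r\<^sup>2) *\<^sub>R A)"
          by (rule norm_triangle_ineq4)
        moreover have "r * norm A \<le> r\<^sup>2 * norm B / 2"
          using r nB by (simp add: power2_eq_square field_simps)
        ultimately have "r\<^sup>2 * norm B / 2 \<le> norm (g r (r\<^sup>2))" by linarith
        then have "(r\<^sup>2 * norm B / 2)\<^sup>2 \<le> (norm (g r (r\<^sup>2)))\<^sup>2" by (intro power_mono) auto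
        then have "(norm B)\<^sup>2 / 16 * (r\<^sup>2)\<^sup>2 \<le> npd (g r (r\<^sup>2))"
          unfolding pd by (simp add: power_mult_distrib power_divide algebra_simps)
        moreover have "c * (r\<^sup>2)\<^sup>2 \<le> (norm B)\<^sup>2 / 16 * (r\<^sup>2)\<^sup>2" by (intro mult_right_mono) (auto simp: c_def)
        ultimately show "c * (r\<^sup>2)\<^sup>2 \<le> npd (g r (r\<^sup>2))" by linarith
      qed
    qed simp
  qed
  show ?thesis
  proof (cases "lq A B / lq A A \<ge> 0")
    case True
    show ?thesis by (rule main[OF h(3) y(2) q(2,3) True])
  next
    case False
    \<comment> \<open>The sign of \<open>B\<close> is free; a nonnegative \<open>k\<close> is what
      keeps the root \<open>s r t\<close> between 0 and \<open>r\<close>.\<close>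
    have e: "lq A (- B) = - lq A B" "lq (- B) (- B) = lq B B"
      by (cases A rule: prod_cases4, cases B rule: prod_cases4, simp add: lq_def)+
    show ?thesis
    proof (rule main)
      show "- B \<in> h" using h by (simp add: subspace_neg)
      show "fst (snd (snd (- B))) = 0" using y(2) by simp
      show "lq A (- B) / lq A A \<ge> 0" using False by (simp add: e)
    qed (use q in \<open>simp_all add: e\<close>)
  qed
qed

text \<open>With \<open>\<phi> = 0\<close> the size of a scaled element has order
  \<open>r\<^sup>2\<close>, and the Gram term of \<open>npd\<close> has order \<open>r ^ 4\<close>
  unless it vanishes. On the scaled segment from the first to the second element, the Gram term
  starts at 0 and ends nonzero.\<close>

lemma ncrit_phi0:
  assumes h: "subspace h" "(0, xa, ya, ea) \<in> h" "(0, xb, yb, eb) \<in> h"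
    and A: "gram xa ya = 0" "xa \<noteq> 0 \<or> ya \<noteq> 0" and B: "gram xb yb \<noteq> 0"
  shows "ncrit h"
proof -
  define X Y H where "X t = (1 - t) *\<^sub>R xa + t *\<^sub>R xb" and "Y t = (1 - t) *\<^sub>R ya + t *\<^sub>R yb"
    and "H t = (1 - t) * ea + t * eb" for t
  define f where "f t = X t \<bullet> X t + Y t \<bullet> Y t" for t
  define F where "F t = 4 + X t \<bullet> X t + Y t \<bullet> Y t + \<bar>H t\<bar> + \<bar>X t \<bullet> Y t\<bar> + (H t)\<^sup>2" for t
  have gh: "(0, r *\<^sub>R X t, r *\<^sub>R Y t, r * H t) \<in> h" for r t
  proof -
    have "(0, r *\<^sub>R X t, r *\<^sub>R Y t, r * H t) = r *\<^sub>R ((1 - t) *\<^sub>R (0, xa, ya, ea) + t *\<^sub>R (0, xb, yb, eb))"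
      by (simp add: X_def Y_def H_def)
    also have "\<dots> \<in> h" by (intro subspace_scale subspace_add h)
    finally show ?thesis .
  qed
  \<comment> \<open>A common zero of \<open>X\<close> and \<open>Y\<close> would make the two given
    pairs proportional, but only one of them has vanishing Gram determinant.\<close>
  have fpos: "f t > 0" for t
  proof (rule ccontr)
    assume "\<not> f t > 0"
    then have z: "X t = 0" "Y t = 0"
      unfolding f_def by (metis inner_ge_zero inner_gt_zero_iff add_pos_nonneg add_nonneg_pos)+
    then have "(1 - t) *\<^sub>R xa = (- t) *\<^sub>R xb" "(1 - t) *\<^sub>R ya = (- t) *\<^sub>R yb"
      by (simp_all add: X_def Y_def add_eq_0_iff2)
    then have "gram ((1 - t) *\<^sub>R xa) ((1 - t) *\<^sub>R ya) = gram ((- t) *\<^sub>R xb) ((- t) *\<^sub>R yb)" by simp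
    then have "t = 0"
      using A(1) B gram_scaleR[of "- t" xb "- t" yb] gram_scaleR[of "1 - t" xa "1 - t" ya] by simp
    then show False using z A(2) by (simp add: X_def Y_def)
  qed
  have cf: "continuous_on {0..1} f" "continuous_on {0..1} F"
    unfolding f_def F_def X_def Y_def H_def by (intro continuous_intros)+
  have "\<exists>t0\<in>{0..1}. \<forall>t\<in>{0..1}. f t0 \<le> f t" by (intro continuous_attains_inf cf) auto
  then obtain t0 where t0: "\<And>t. t \<in> {0..1} \<Longrightarrow> f t0 \<le> f t" by blast
  have "\<exists>t1\<in>{0..1}. \<forall>t\<in>{0..1}. F t \<le> F t1" by (intro continuous_attains_sup cf) auto
  then obtain t1 where t1: "\<And>t. t \<in> {0..1} \<Longrightarrow> F t \<le> F t1" by blast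
  define c where "c = min (f t0 / 8) (gram xb yb / 16)"
  show ?thesis
  proof (rule ncrit_sweeps[of h 2 c 1 "F t1"])
    show "0 \<in> h" using h(1) subspace_0 by blast
    show "c > 0" using fpos B gram_nonneg[of xb yb] by (simp add: c_def)
    fix r :: real assume r: "r \<ge> 1"
    have r2: "r \<le> r\<^sup>2" "1 \<le> r\<^sup>2" using r self_le_power[of r 2] one_le_power[of r 2] by simp_all
    have ar: "\<bar>r\<bar> = r" using r by simp
    show "sweeps h c (F t1) (r\<^sup>2)" unfolding sweeps_def
    proof (rule exI[of _ "\<lambda>t. (0, r *\<^sub>R X t, r *\<^sub>R Y t, r * H t)"], rule exI[of _ 0], rule exI[of _ 1], intro conjI ballI)
      show "continuous_on {0..1} (\<lambda>t. (0::real, r *\<^sub>R X t, r *\<^sub>R Y t, r * H t))"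
        unfolding X_def Y_def H_def by (intro continuous_intros)
      fix t :: real assume t: "t \<in> {0..1}"
      show "(0, r *\<^sub>R X t, r *\<^sub>R Y t, r * H t) \<in> h" by (rule gh)
      have cr: "corner (0, r *\<^sub>R X t, r *\<^sub>R Y t, r * H t) = - r\<^sup>2 * (X t \<bullet> X t) / 2"
        by (simp add: corner_def power2_eq_square)
      have "c * r\<^sup>2 \<le> f t / 8 * r\<^sup>2"
        using t0[OF t] by (intro mult_right_mono) (auto simp: c_def)
      also have "\<dots> \<le> npn (0, r *\<^sub>R X t, r *\<^sub>R Y t, r * H t)"
        using npn_ge(1)[of 0 "r *\<^sub>R X t" "r *\<^sub>R Y t" "r * H t"] npn_ge(2)[of "r *\<^sub>R Y t" 0 "r *\<^sub>R X t" "r * H t"] unfolding cr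
        by (simp add: f_def abs_mult power2_eq_square algebra_simps)
      finally show "c * r\<^sup>2 \<le> npn (0, r *\<^sub>R X t, r *\<^sub>R Y t, r * H t)" .
      have "\<bar>r * H t\<bar> \<le> r\<^sup>2 * \<bar>H t\<bar>" using r2 r by (simp add: abs_mult mult_right_mono)
      moreover have "\<bar>(r *\<^sub>R X t) \<bullet> (r *\<^sub>R Y t)\<bar> = r\<^sup>2 * \<bar>X t \<bullet> Y t\<bar>"
        by (simp add: abs_mult power2_eq_square)
      moreover have "0 \<le> r\<^sup>2 * (X t \<bullet> X t)" "0 \<le> r\<^sup>2 * (H t)\<^sup>2" by simp_all
      ultimately have "npn (0, r *\<^sub>R X t, r *\<^sub>R Y t, r * H t) \<le> F t * r\<^sup>2"
        using npn_le[of 0 "r *\<^sub>R X t" "r *\<^sub>R Y t" "r * H t"] r2 unfolding cr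
        by (simp add: F_def abs_mult power2_eq_square ar algebra_simps)
      also have "\<dots> \<le> F t1 * r\<^sup>2" using t1[OF t] by (intro mult_right_mono) auto
      finally show "npn (0, r *\<^sub>R X t, r *\<^sub>R Y t, r * H t) \<le> F t1 * r\<^sup>2" .
    next
      have "npd (0, r *\<^sub>R X 0, r *\<^sub>R Y 0, r * H 0) = 1 + (xa \<bullet> xa + ya \<bullet> ya + ea\<^sup>2) / 4 * r\<^sup>2"
        using A(1) gram_scaleR[of r xa r ya]
        by (simp add: npd_def X_def Y_def H_def power2_eq_square algebra_simps add_divide_distrib)
      also have "\<dots> \<le> (1 + (xa \<bullet> xa + ya \<bullet> ya + ea\<^sup>2) / 4) * r\<^sup>2"
        using r2 by (simp add: algebra_simps)
      also have "\<dots> \<le> F 0 * r\<^sup>2"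
      proof (rule mult_right_mono)
        have "0 \<le> xa \<bullet> xa" "0 \<le> ya \<bullet> ya" "0 \<le> ea\<^sup>2" "0 \<le> \<bar>ea\<bar>" "0 \<le> \<bar>xa \<bullet> ya\<bar>" by simp_all
        moreover have "F 0 = 4 + xa \<bullet> xa + ya \<bullet> ya + \<bar>ea\<bar> + \<bar>xa \<bullet> ya\<bar> + ea\<^sup>2"
          by (simp add: F_def X_def Y_def H_def)
        ultimately show "1 + (xa \<bullet> xa + ya \<bullet> ya + ea\<^sup>2) / 4 \<le> F 0" by argo
      qed simp
      also have "\<dots> \<le> F t1 * r\<^sup>2" using t1[of 0] by (intro mult_right_mono) auto
      finally show "npd (0, r *\<^sub>R X 0, r *\<^sub>R Y 0, r * H 0) \<le> F t1 * r\<^sup>2" .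
      have "c * (r\<^sup>2)\<^sup>2 \<le> gram xb yb / 16 * (r\<^sup>2)\<^sup>2" by (intro mult_right_mono) (auto simp: c_def)
      also have "\<dots> \<le> npd (0, r *\<^sub>R X 1, r *\<^sub>R Y 1, r * H 1)"
        using npd_ge(1)[of "r *\<^sub>R xb" "r *\<^sub>R yb" 0 "r * eb"]
        by (simp add: gram_scaleR X_def Y_def H_def power2_eq_square[of "r\<^sup>2"] mult.commute)
      finally show "c * (r\<^sup>2)\<^sup>2 \<le> npd (0, r *\<^sub>R X 1, r *\<^sub>R Y 1, r * H 1)" .
    qed simp
  qed simp
qed

text \<open>For \<open>\<phi> = 0\<close>, \<eta> is absent from \<open>corner\<close> but
  contributes \<open>\<eta>\<^sup>2 / 4\<close> to \<open>npd\<close>. Raising it to order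
  \<open>r\<^sup>2\<close> leaves the size at that order.\<close>

lemma ncrit_eta:
  assumes h: "subspace h" "(0, xa, ya, ea) \<in> h" "(0, 0, 0, 1) \<in> h"
    and A: "gram xa ya = 0" "xa \<noteq> 0 \<or> ya \<noteq> 0"
  shows "ncrit h"
proof -
  define q where "q = xa \<bullet> xa + ya \<bullet> ya"
  have q: "q > 0" using A(2) unfolding q_def by (metis inner_ge_zero inner_gt_zero_iff add_pos_nonneg add_nonneg_pos)
  have gh: "(0, r *\<^sub>R xa, r *\<^sub>R ya, r * ea + t) \<in> h" for r t
  proof -
    have "(0, r *\<^sub>R xa, r *\<^sub>R ya, r * ea + t) = r *\<^sub>R (0, xa, ya, ea) + t *\<^sub>R (0, 0, 0, 1)" by simp
    also have "\<dots> \<in> h" by (intro subspace_scale subspace_add h)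
    finally show ?thesis .
  qed
  define C where "C = 3 + q + \<bar>ea\<bar> + \<bar>xa \<bullet> ya\<bar> + ea\<^sup>2"
  define c where "c = min (q / 8) (1 / 16)"
  show ?thesis
  proof (rule ncrit_sweeps[of h 2 c "2 * \<bar>ea\<bar>" C])
    show "0 \<in> h" using h(1) subspace_0 by blast
    show "c > 0" using q by (simp add: c_def)
    fix r :: real assume r: "r \<ge> 2 * \<bar>ea\<bar>" "r \<ge> 1"
    have r2: "r \<le> r\<^sup>2" "1 \<le> r\<^sup>2" using r self_le_power[of r 2] one_le_power[of r 2] by simp_all
    have ar: "\<bar>r\<bar> = r" using r by simp
    show "sweeps h c C (r\<^sup>2)" unfolding sweeps_def
    proof (rule exI[of _ "\<lambda>t. (0, r *\<^sub>R xa, r *\<^sub>R ya, r * ea + t)"], rule exI[of _ 0], rule exI[of _ "r\<^sup>2"], intro conjI ballI)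
      show "continuous_on {0..r\<^sup>2} (\<lambda>t. (0::real, r *\<^sub>R xa, r *\<^sub>R ya, r * ea + t))"
        by (intro continuous_intros)
      fix t :: real assume t: "t \<in> {0..r\<^sup>2}"
      show "(0, r *\<^sub>R xa, r *\<^sub>R ya, r * ea + t) \<in> h" by (rule gh)
      have cr: "corner (0, r *\<^sub>R xa, r *\<^sub>R ya, r * ea + t) = - r\<^sup>2 * (xa \<bullet> xa) / 2"
        by (simp add: corner_def power2_eq_square)
      have "c * r\<^sup>2 \<le> q / 8 * r\<^sup>2" by (intro mult_right_mono) (auto simp: c_def)
      also have "\<dots> \<le> npn (0, r *\<^sub>R xa, r *\<^sub>R ya, r * ea + t)"
        using npn_ge(1)[of 0 "r *\<^sub>R xa" "r *\<^sub>R ya" "r * ea + t"] npn_ge(2)[of "r *\<^sub>R ya" 0 "r *\<^sub>R xa" "r * ea + t"] unfolding cr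
        by (simp add: q_def abs_mult power2_eq_square algebra_simps)
      finally show "c * r\<^sup>2 \<le> npn (0, r *\<^sub>R xa, r *\<^sub>R ya, r * ea + t)" .
      have "\<bar>r * ea + t\<bar> \<le> r\<^sup>2 * \<bar>ea\<bar> + r\<^sup>2"
      proof -
        have "\<bar>r * ea\<bar> \<le> r\<^sup>2 * \<bar>ea\<bar>" using r2 r by (simp add: abs_mult mult_right_mono)
        then show ?thesis using t by auto
      qed
      moreover have "\<bar>(r *\<^sub>R xa) \<bullet> (r *\<^sub>R ya)\<bar> = r\<^sup>2 * \<bar>xa \<bullet> ya\<bar>"
        by (simp add: abs_mult power2_eq_square)
      moreover have "0 \<le> r\<^sup>2 * (xa \<bullet> xa)" "0 \<le> r\<^sup>2 * ea\<^sup>2" by simp_all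
      ultimately show "npn (0, r *\<^sub>R xa, r *\<^sub>R ya, r * ea + t) \<le> C * r\<^sup>2"
        using npn_le[of 0 "r *\<^sub>R xa" "r *\<^sub>R ya" "r * ea + t"] r2 unfolding cr
        by (simp add: C_def q_def abs_mult power2_eq_square ar algebra_simps)
    next
      have "npd (0, r *\<^sub>R xa, r *\<^sub>R ya, r * ea + 0) = 1 + (xa \<bullet> xa + ya \<bullet> ya + ea\<^sup>2) / 4 * r\<^sup>2"
        using A(1) gram_scaleR[of r xa r ya]
        by (simp add: npd_def power2_eq_square algebra_simps add_divide_distrib)
      also have "\<dots> \<le> (1 + (xa \<bullet> xa + ya \<bullet> ya + ea\<^sup>2) / 4) * r\<^sup>2"
        using r2 by (simp add: algebra_simps)
      also have "\<dots> \<le> C * r\<^sup>2"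
      proof (rule mult_right_mono)
        have "0 \<le> xa \<bullet> xa" "0 \<le> ya \<bullet> ya" "0 \<le> ea\<^sup>2" "0 \<le> \<bar>ea\<bar>" "0 \<le> \<bar>xa \<bullet> ya\<bar>" by simp_all
        then show "1 + (xa \<bullet> xa + ya \<bullet> ya + ea\<^sup>2) / 4 \<le> C" unfolding C_def q_def by argo
      qed simp
      finally show "npd (0, r *\<^sub>R xa, r *\<^sub>R ya, r * ea + 0) \<le> C * r\<^sup>2" .
      have "\<bar>r * ea\<bar> \<le> r\<^sup>2 / 2"
        using r by (simp add: abs_mult power2_eq_square)
      then have "r\<^sup>2 / 2 \<le> r * ea + r\<^sup>2" by linarith
      then have "(r\<^sup>2 / 2)\<^sup>2 \<le> (r * ea + r\<^sup>2)\<^sup>2" by (intro power_mono) auto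
      moreover have "(r * ea + r\<^sup>2)\<^sup>2 / 4 \<le> npd (0, r *\<^sub>R xa, r *\<^sub>R ya, r * ea + r\<^sup>2)"
        using npd_ge(2)[of "r * ea + r\<^sup>2" 0 "r *\<^sub>R ya" "r *\<^sub>R xa"] by simp
      moreover have "c * (r\<^sup>2)\<^sup>2 \<le> 1 / 16 * (r\<^sup>2)\<^sup>2" by (intro mult_right_mono) (auto simp: c_def)
      ultimately show "c * (r\<^sup>2)\<^sup>2 \<le> npd (0, r *\<^sub>R xa, r *\<^sub>R ya, r * ea + r\<^sup>2)"
        by (simp add: power_divide)
    qed simp
  qed simp
qed

text \<open>Along the first element alone the size would grow like \<open>s ^ 4\<close>. The
  \<eta>-axis cancels this term, so the size stays of order \<open>R = r ^ 12\<close> for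
  \<open>s\<close> between \<open>r ^ 3\<close> and \<open>r ^ 4\<close>, while the shifted square
  in \<open>npd\<close> grows to order \<open>R\<^sup>2\<close>.\<close>

lemma ncrit_phi1_eta:
  assumes h: "subspace h" "(1, x, y, 0) \<in> h" "(0, 0, 0, 1) \<in> h" and y: "y \<noteq> 0"
  shows "ncrit h"
proof -
  define Y q m where "Y = y \<bullet> y" and "q = x \<bullet> x" and "m = x \<bullet> y"
  have Y: "Y > 0" using y by (simp add: Y_def)
  have q: "q \<ge> 0" by (simp add: q_def)
  \<comment> \<open>chosen such that \<open>corner (g r s) = r ^ 12 * Y / 8\<close>\<close>
  define E where "E r s = (- (r ^ 12 * Y / 8) - s\<^sup>2 * q / 2 + s ^ 4 * Y / 24) / s" for r s :: real
  define g where "g r s = (s, s *\<^sub>R x, s *\<^sub>R y, E r s)" for r s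
  have gh: "g r s \<in> h" for r s
  proof -
    have "g r s = s *\<^sub>R (1, x, y, 0) + E r s *\<^sub>R (0, 0, 0, 1)" by (simp add: g_def)
    also have "\<dots> \<in> h" by (intro subspace_scale subspace_add h)
    finally show ?thesis .
  qed
  define C where "C = 4 + 4 * Y + 2 * q + \<bar>m\<bar> + q\<^sup>2 + gram x y"
  define c where "c = min (Y / 16) (Y\<^sup>2 / 1024)"
  have C0: "0 \<le> q" "0 \<le> Y" "0 \<le> \<bar>m\<bar>" "0 \<le> q\<^sup>2" "0 \<le> gram x y"
    using q Y gram_nonneg by simp_all
  show ?thesis
  proof (rule ncrit_sweeps[of h 12 c "max 2 (16 * q / Y)" C])
    show "0 \<in> h" using h(1) subspace_0 by blast
    show "c > 0" using Y by (simp add: c_def)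
    fix r :: real assume r0: "r \<ge> max 2 (16 * q / Y)" "r \<ge> 1"
    have r: "r \<ge> 2" "16 * q \<le> r * Y" using r0 Y by (simp_all add: pos_divide_le_eq)
    have rp: "r ^ i \<le> r ^ 12" if "i \<le> 12" for i using that r by (intro power_increasing) auto
    have R1: "1 \<le> r ^ 12" using r by (intro one_le_power) auto
    show "sweeps h c C (r ^ 12)" unfolding sweeps_def
    proof (rule exI[of _ "g r"], rule exI[of _ "r ^ 3"], rule exI[of _ "r ^ 4"], intro conjI ballI)
      show "r ^ 3 \<le> r ^ 4" using r by (intro power_increasing) auto
      have "r ^ 3 > 0" using r by simp
      then show "continuous_on {r ^ 3..r ^ 4} (g r)"
        unfolding g_def E_def by (intro continuous_intros) auto
      fix s assume s: "s \<in> {r ^ 3..r ^ 4}"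
      have "1 \<le> r ^ 3" using r by (intro one_le_power) auto
      then have s1: "1 \<le> s" using s by simp
      have sp: "s ^ i \<le> r ^ 12" if "i \<le> 3" for i
      proof -
        have "s ^ i \<le> (r ^ 4) ^ i" using s s1 by (intro power_mono) auto
        also have "\<dots> = r ^ (4 * i)" by (simp add: power_mult)
        also have "\<dots> \<le> r ^ 12" using that by (intro rp) auto
        finally show ?thesis .
      qed
      note sp' = sp[of 1, simplified] sp[of 2, simplified] sp[of 3, simplified]
      show "g r s \<in> h" by (rule gh)
      have Es: "s * E r s = - (r ^ 12 * Y / 8) - s\<^sup>2 * q / 2 + s ^ 4 * Y / 24"
        using s1 by (simp add: E_def)
      have cr: "corner (g r s) = r ^ 12 * Y / 8"
        using Es by (simp add: g_def corner_def q_def Y_def power2_eq_square power4_eq_xxxx algebra_simps)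
      have "c * r ^ 12 \<le> Y / 16 * r ^ 12" using R1 by (intro mult_right_mono) (auto simp: c_def)
      also have "\<dots> \<le> npn (g r s)"
        using npn_ge(1)[of s "s *\<^sub>R x" "s *\<^sub>R y" "E r s", folded g_def] Y R1 unfolding cr by (simp add: mult.commute[of Y])
      finally show "c * r ^ 12 \<le> npn (g r s)" .
      have e1: "\<bar>E r s\<bar> \<le> r ^ 12 * Y / 8 + r ^ 12 * q / 2 + r ^ 12 * Y / 24"
      proof -
        have "E r s = - ((r ^ 12 * Y / 8) / s) - s * q / 2 + s ^ 3 * Y / 24"
          using s1 by (simp add: E_def field_simps power2_eq_square power3_eq_cube power4_eq_xxxx)
        moreover have "\<bar>(r ^ 12 * Y / 8) / s\<bar> \<le> r ^ 12 * Y / 8"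
        proof -
          have p: "0 \<le> r ^ 12 * Y / 8" using Y R1 by simp
          have "(r ^ 12 * Y / 8) / s \<le> (r ^ 12 * Y / 8) / 1" using s1 p by (intro divide_left_mono) auto
          moreover have "0 \<le> (r ^ 12 * Y / 8) / s" using s1 p by simp
          ultimately show ?thesis by (simp only: abs_of_nonneg div_by_1)
        qed
        moreover have "\<bar>s * q / 2\<bar> \<le> r ^ 12 * q / 2" "\<bar>s ^ 3 * Y / 24\<bar> \<le> r ^ 12 * Y / 24"
          using s1 q Y sp' by (auto simp: abs_mult intro!: mult_right_mono)
        ultimately show ?thesis by linarith
      qed
      have "npn (g r s) \<le> 2 + r ^ 12 * Y / 8 + s + \<bar>E r s\<bar> + s\<^sup>2 * \<bar>m\<bar> + s ^ 3 * Y + s\<^sup>2 * Y"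
        using npn_le[of s "s *\<^sub>R x" "s *\<^sub>R y" "E r s", folded g_def] Y R1 s1 unfolding cr
        by (simp add: abs_mult m_def Y_def power2_eq_square power3_eq_cube mult_ac)
      also have "\<dots> \<le> 2 * r ^ 12 + r ^ 12 * Y / 8 + r ^ 12
          + (r ^ 12 * Y / 8 + r ^ 12 * q / 2 + r ^ 12 * Y / 24) + r ^ 12 * \<bar>m\<bar> + r ^ 12 * Y + r ^ 12 * Y"
        using R1 sp' e1 C0 by (intro add_mono mult_right_mono) auto
      also have "\<dots> = (3 + Y * (1/8 + 1/8 + 1/24 + 2) + q / 2 + \<bar>m\<bar>) * r ^ 12" by (simp add: algebra_simps)
      also have "\<dots> \<le> C * r ^ 12"
        using R1 C0 unfolding C_def by (intro mult_right_mono) argo+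
      finally show "npn (g r s) \<le> C * r ^ 12" .
    next
      have r3: "r ^ 3 > 0" using r by simp
      \<comment> \<open>The factor 1/8 in \<open>E\<close> is 1/24 + 1/12: at
        \<open>s = r ^ 3\<close> it makes the terms of order \<open>r ^ 9\<close> in the shifted
        \<eta> cancel.\<close>
      have M0: "E r (r ^ 3) + r ^ 3 * ((r ^ 3 *\<^sub>R y) \<bullet> (r ^ 3 *\<^sub>R y)) / 12 = - (r ^ 3 * q / 2)"
        using r3 unfolding E_def inner_scaleR_left inner_scaleR_right Y_def[symmetric]
        by (simp add: field_simps power2_eq_square)
      have "npd (g r (r ^ 3)) = 1 + (r ^ 6 + r ^ 6 * q + r ^ 6 * Y) / 4 + r ^ 12 * Y / 16 + r ^ 6 * q\<^sup>2 / 16 + r ^ 12 * gram x y / 16"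
        unfolding g_def npd_def prod.case M0 gram_scaleR
        by (simp add: q_def Y_def power_mult_distrib power_divide flip: power_mult power_add mult.assoc)
      also have "\<dots> \<le> r ^ 12 + (r ^ 12 + r ^ 12 * q + r ^ 12 * Y) / 4 + r ^ 12 * Y / 16 + r ^ 12 * q\<^sup>2 / 16 + r ^ 12 * gram x y / 16"
        using R1 rp[of 6] C0 by (intro add_mono divide_right_mono mult_right_mono) auto
      also have "\<dots> = (1 + (1 + q + Y) / 4 + Y / 16 + q\<^sup>2 / 16 + gram x y / 16) * r ^ 12" by (simp add: algebra_simps)
      also have "\<dots> \<le> C * r ^ 12"
        using R1 C0 unfolding C_def by (intro mult_right_mono) argo+
      finally show "npd (g r (r ^ 3)) \<le> C * r ^ 12" .
      have r4: "r ^ 4 > 0" using r by simp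
      have M1: "E r (r ^ 4) + r ^ 4 * ((r ^ 4 *\<^sub>R y) \<bullet> (r ^ 4 *\<^sub>R y)) / 12 = r ^ 12 * Y / 8 - r ^ 8 * Y / 8 - r ^ 4 * q / 2"
        using r4 unfolding E_def inner_scaleR_left inner_scaleR_right Y_def[symmetric]
        by (simp add: field_simps power2_eq_square)
      \<comment> \<open>The thresholds on \<open>r\<close> serve this end: each of the two negative
        terms takes at most a quarter of \<open>r ^ 12 * Y / 8\<close>.\<close>
      have "r ^ 8 * 4 \<le> r ^ 8 * r ^ 4" using power_mono[of 2 r 4] r by (intro mult_left_mono) auto
      then have "4 * r ^ 8 * Y \<le> r ^ 12 * Y" using Y by (intro mult_right_mono) (auto simp flip: power_add)
      moreover have "16 * (r ^ 4 * q) \<le> r ^ 12 * Y"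
      proof -
        have "r ^ 4 * (16 * q) \<le> r ^ 4 * (r * Y)" using r by (intro mult_left_mono) auto
        also have "\<dots> = r ^ 5 * Y" by (simp add: power_numeral_reduce mult_ac)
        also have "\<dots> \<le> r ^ 12 * Y" using rp[of 5] Y by (intro mult_right_mono) auto
        finally show ?thesis by simp
      qed
      ultimately have "r ^ 12 * Y / 16 \<le> r ^ 12 * Y / 8 - r ^ 8 * Y / 8 - r ^ 4 * q / 2" by argo
      then have "(r ^ 12 * Y / 16)\<^sup>2 \<le> (r ^ 12 * Y / 8 - r ^ 8 * Y / 8 - r ^ 4 * q / 2)\<^sup>2"
        using Y R1 by (intro power_mono) auto
      moreover have "(r ^ 12 * Y / 8 - r ^ 8 * Y / 8 - r ^ 4 * q / 2)\<^sup>2 / 4 \<le> npd (g r (r ^ 4))"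
        unfolding M1[symmetric] g_def by (rule npd_ge(2))
      ultimately have "Y\<^sup>2 / 1024 * (r ^ 12)\<^sup>2 \<le> npd (g r (r ^ 4))"
        by (simp add: power_mult_distrib power_divide mult_ac)
      moreover have "c * (r ^ 12)\<^sup>2 \<le> Y\<^sup>2 / 1024 * (r ^ 12)\<^sup>2" by (intro mult_right_mono) (auto simp: c_def)
      ultimately show "c * (r ^ 12)\<^sup>2 \<le> npd (g r (r ^ 4))" by linarith
    qed
  qed simp
qed

text \<open>The degree 4 term of \<open>corner\<close> is balanced by the square of the coefficient
  \<open>T r s\<close> of \<open>xa\<close>, which has order \<open>s\<^sup>2\<close> for large
  \<open>s\<close>. As \<open>xa\<close> is orthogonal to \<open>y\<close>, this raises the Gram
  determinant to order \<open>s ^ 6\<close> without raising \<open>x \<bullet> y\<close>. With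
  \<open>s\<close> up to \<open>r\<^sup>2\<close> and size of order \<open>r ^ 6\<close>, the far
  end has \<open>npd\<close> of order \<open>r ^ 12\<close>. The sign hypothesis keeps the cross
  term of \<open>corner\<close> from cancelling the term \<open>r ^ 6 / 2\<close>.\<close>

lemma ncrit_phi1_orth:
  assumes h: "subspace h" "(0, xa, 0, ea) \<in> h" "(1, x, y, e) \<in> h"
    and xa: "xa \<bullet> xa = 1" "xa \<bullet> y = 0" and y: "y \<noteq> 0" and sgn: "ea + x \<bullet> xa \<ge> 0"
  shows "ncrit h"
proof -
  define Y q m z d where "Y = y \<bullet> y" and "q = x \<bullet> x" and "m = x \<bullet> y" and "z = x \<bullet> xa" and "d = ea + z"
  have Y: "Y > 0" using y by (simp add: Y_def)
  have q: "q \<ge> 0" by (simp add: q_def)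
  have d: "d \<ge> 0" using sgn by (simp add: d_def z_def)
  \<comment> \<open>chosen such that the terms \<open>- (T r s)\<^sup>2 / 2\<close> and \<open>s ^ 4 * Y / 24\<close> of \<open>corner (g r s)\<close> add up to \<open>- r ^ 6 / 2\<close>\<close>
  define T where "T r s = sqrt (r ^ 6 + s ^ 4 * Y / 12)" for r s :: real
  define g where "g r s = (s, s *\<^sub>R x + T r s *\<^sub>R xa, s *\<^sub>R y, s * e + T r s * ea)" for r s
  have gh: "g r s \<in> h" for r s
  proof -
    have "g r s = s *\<^sub>R (1, x, y, e) + T r s *\<^sub>R (0, xa, 0, ea)" by (simp add: g_def)
    also have "\<dots> \<in> h" by (intro subspace_scale subspace_add h)
    finally show ?thesis .
  qed
  define K where "K = sqrt (1 + Y)"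
  define w where "w = sqrt (Y / 12)"
  have w: "w > 0" "w\<^sup>2 = Y / 12" using Y by (simp_all add: w_def)
  have K: "K \<ge> 0" "K\<^sup>2 = 1 + Y" using Y by (simp_all add: K_def)
  define C where "C = 5 + 2 * \<bar>e\<bar> + q / 2 + K * d + K * \<bar>ea\<bar> + \<bar>m\<bar> + 2 * Y + ea\<^sup>2"
  define c where "c = min (1 / 8) (Y\<^sup>2 / 384)"
  have C0: "0 \<le> q" "0 \<le> Y" "0 \<le> \<bar>m\<bar>" "0 \<le> \<bar>e\<bar>" "0 \<le> \<bar>ea\<bar>" "0 \<le> K * d" "0 \<le> K * \<bar>ea\<bar>" "0 \<le> ea\<^sup>2"
    using q Y K d by simp_all
  show ?thesis
  \<comment> \<open>The first threshold gives
    \<open>\<bar>s\<^sup>2 * e\<bar> \<le> r ^ 6 / 4\<close>; the second keeps the cross term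
    \<open>2 * s * t * z\<close> within half of \<open>t\<^sup>2\<close> at the far end.\<close>
  proof (rule ncrit_sweeps[of h 6 c "max (4 * \<bar>e\<bar>) (4 * \<bar>z\<bar> / w)" C])
    show "0 \<in> h" using h(1) subspace_0 by blast
    show "c > 0" using Y by (simp add: c_def)
    fix r :: real assume r0: "r \<ge> max (4 * \<bar>e\<bar>) (4 * \<bar>z\<bar> / w)" "r \<ge> 1"
    have r: "r \<ge> 1" "4 * \<bar>e\<bar> \<le> r" "4 * \<bar>z\<bar> \<le> r * w" using r0 w by (simp_all add: pos_divide_le_eq)
    have rp: "r ^ i \<le> r ^ 6" if "i \<le> 6" for i using that r by (intro power_increasing) auto
    have R1: "1 \<le> r ^ 6" using r by (intro one_le_power) auto
    show "sweeps h c C (r ^ 6)" unfolding sweeps_def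
    proof (rule exI[of _ "g r"], rule exI[of _ "0"], rule exI[of _ "r\<^sup>2"], intro conjI ballI)
      show "0 \<le> r\<^sup>2" by simp
      show "continuous_on {0..r\<^sup>2} (g r)"
        unfolding g_def T_def by (intro continuous_intros) auto
      fix s assume s: "s \<in> {0..r\<^sup>2}"
      have s0: "0 \<le> s" using s by simp
      have spp: "s ^ i \<le> r ^ (2 * i)" for i
        using power_mono[of s "r\<^sup>2" i] s by (simp add: power_mult)
      have sp: "s ^ i \<le> r ^ 6" if "i \<le> 3" for i
        using spp[of i] rp[of "2 * i"] that by linarith
      note sp' = sp[of 1, simplified] sp[of 2, simplified] sp[of 3, simplified]
      show "g r s \<in> h" by (rule gh)
      have arg: "0 \<le> r ^ 6 + s ^ 4 * Y / 12" using r s0 Y by simp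
      have T2: "T r s * T r s = r ^ 6 + s ^ 4 * Y / 12" using arg by (simp add: T_def)
      have T0: "0 \<le> T r s" using arg by (simp add: T_def)
      have TK: "T r s \<le> K * r ^ 4"
      proof (rule power2_le_imp_le)
        have "s ^ 4 * Y / 12 \<le> r ^ 8 * Y"
          using spp[of 4] Y s0 mult_mono[of "s ^ 4" "r ^ 8" "Y / 12" Y] by simp
        moreover have "r ^ 6 \<le> r ^ 8" using r by (intro power_increasing) auto
        ultimately have "(T r s)\<^sup>2 \<le> (1 + Y) * r ^ 8"
          using T2 by (simp add: power2_eq_square algebra_simps)
        then show "(T r s)\<^sup>2 \<le> (K * r ^ 4)\<^sup>2"
          by (simp add: power_mult_distrib K(2) flip: power_mult)
      qed (use K r in simp)
      have T6: "T r s \<le> K * r ^ 6"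
        using TK mult_left_mono[OF rp[of 4] K(1)] by simp
      have sT: "s * T r s \<le> K * r ^ 6"
      proof -
        have "s * T r s \<le> r\<^sup>2 * (K * r ^ 4)" using s s0 TK T0 by (intro mult_mono) auto
        then show ?thesis by (simp add: mult_ac flip: power_add)
      qed
      have cr: "corner (g r s) = - (s\<^sup>2 * e) - s\<^sup>2 * q / 2 - s * T r s * d - r ^ 6 / 2"
      proof -
        have "corner (g r s) = - (s\<^sup>2 * e) - s * T r s * ea - (s\<^sup>2 * q + 2 * (s * T r s * z) + T r s * T r s) / 2 + s ^ 4 * Y / 24"
          using xa by (simp add: g_def corner_def q_def Y_def z_def inner_expand inner_commute[of xa x]
              power2_eq_square power4_eq_xxxx algebra_simps)
        then show ?thesis unfolding T2 d_def by (simp add: algebra_simps add_divide_distrib)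
      qed
      have sTd: "0 \<le> s * T r s * d" "s * T r s * d \<le> K * r ^ 6 * d"
        using s0 T0 d sT by (auto intro: mult_right_mono)
      have sq: "0 \<le> s\<^sup>2 * q" "s\<^sup>2 * q \<le> r ^ 6 * q" using q sp' by (auto intro: mult_right_mono)
      have se: "\<bar>s\<^sup>2 * e\<bar> \<le> r ^ 6 / 4"
      proof -
        have "\<bar>s\<^sup>2 * e\<bar> \<le> r ^ 4 * (r / 4)"
          unfolding abs_mult using spp[of 2] r by (intro mult_mono) auto
        also have "\<dots> = r ^ 5 / 4" by (simp add: power_numeral_reduce)
        also have "\<dots> \<le> r ^ 6 / 4" using rp[of 5] by simp
        finally show ?thesis .
      qed
      have "c * r ^ 6 \<le> 1 / 8 * r ^ 6" using R1 by (intro mult_right_mono) (auto simp: c_def)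
      also have "\<dots> \<le> \<bar>corner (g r s)\<bar> / 2" unfolding cr using sTd sq se by argo
      also have "\<dots> \<le> npn (g r s)" unfolding g_def by (rule npn_ge(1))
      finally show "c * r ^ 6 \<le> npn (g r s)" .
      have ab: "\<bar>corner (g r s)\<bar> \<le> r ^ 6 / 4 + r ^ 6 * q / 2 + K * r ^ 6 * d + r ^ 6 / 2"
        unfolding cr using sTd sq se by argo
      have et: "\<bar>s * e + T r s * ea\<bar> \<le> r ^ 6 * \<bar>e\<bar> + K * r ^ 6 * \<bar>ea\<bar>"
      proof -
        have "\<bar>s * e\<bar> \<le> r ^ 6 * \<bar>e\<bar>" "\<bar>T r s * ea\<bar> \<le> K * r ^ 6 * \<bar>ea\<bar>"
          unfolding abs_mult using s0 T0 sp' T6 by (auto intro!: mult_right_mono)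
        then show ?thesis by linarith
      qed
      have xy: "(s *\<^sub>R x + T r s *\<^sub>R xa) \<bullet> (s *\<^sub>R y) = s\<^sup>2 * m"
        using xa by (simp add: inner_expand m_def power2_eq_square)
      have "npn (g r s) \<le> 2 + \<bar>corner (g r s)\<bar> + s + \<bar>s * e + T r s * ea\<bar> + s\<^sup>2 * \<bar>m\<bar> + s ^ 3 * Y + s\<^sup>2 * Y"
        using npn_le[of s "s *\<^sub>R x + T r s *\<^sub>R xa" "s *\<^sub>R y" "s * e + T r s * ea", folded g_def] s0 
        unfolding xy by (simp add: abs_mult Y_def power2_eq_square power3_eq_cube mult_ac)
      also have "\<dots> \<le> 2 * r ^ 6 + (r ^ 6 / 4 + r ^ 6 * q / 2 + K * r ^ 6 * d + r ^ 6 / 2) + r ^ 6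
          + (r ^ 6 * \<bar>e\<bar> + K * r ^ 6 * \<bar>ea\<bar>) + r ^ 6 * \<bar>m\<bar> + r ^ 6 * Y + r ^ 6 * Y"
        using R1 sp' ab et C0 by (intro add_mono mult_right_mono) auto
      also have "\<dots> = (3 + 3 / 4 + q / 2 + K * d + \<bar>e\<bar> + K * \<bar>ea\<bar> + \<bar>m\<bar> + 2 * Y) * r ^ 6" by (simp add: algebra_simps)
      also have "\<dots> \<le> C * r ^ 6"
        using R1 C0 unfolding C_def by (intro mult_right_mono) argo+
      finally show "npn (g r s) \<le> C * r ^ 6" .
    next
      have "T r 0 = r ^ 3" using r by (simp add: T_def real_sqrt_unique flip: power_mult)
      then have "npd (g r 0) = 1 + (1 + ea\<^sup>2) / 4 * r ^ 6"
        using xa by (simp add: g_def npd_def power_mult_distrib algebra_simps add_divide_distrib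
            flip: power_mult power_add)
      also have "\<dots> \<le> (1 + (1 + ea\<^sup>2) / 4) * r ^ 6" using R1 by (simp add: algebra_simps)
      also have "\<dots> \<le> C * r ^ 6" using R1 C0 unfolding C_def by (intro mult_right_mono) argo+
      finally show "npd (g r 0) \<le> C * r ^ 6" .
      define s t where "s = r\<^sup>2" and "t = T r s"
      have s: "s > 0" "r \<le> s" using r self_le_power[of r 2] by (simp_all add: s_def)
      have t0: "0 \<le> t" using r Y s by (simp add: t_def T_def)
      have "t\<^sup>2 = r ^ 6 + s ^ 4 * Y / 12" using r Y s by (simp add: t_def T_def)
      then have t2: "s ^ 4 * Y / 12 \<le> t\<^sup>2" using r by simp
      have "(s\<^sup>2 * w)\<^sup>2 \<le> t\<^sup>2" using t2 by (simp add: power_mult_distrib w flip: power_mult)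
      then have ts: "s\<^sup>2 * w \<le> t" using t0 power2_le_imp_le by blast
      have "4 * \<bar>z\<bar> \<le> s * w" using r(3) mult_right_mono[OF s(2), of w] w by linarith
      then have "s * (4 * \<bar>z\<bar>) \<le> s * (s * w)" using s by (intro mult_left_mono) auto
      also have "\<dots> \<le> t" using ts by (simp add: power2_eq_square mult_ac)
      finally have "t * (s * (4 * \<bar>z\<bar>)) \<le> t * t" using t0 by (intro mult_left_mono) auto
      then have "4 * \<bar>s * t * z\<bar> \<le> t\<^sup>2" using s t0 by (simp add: abs_mult power2_eq_square mult_ac)
      then have half: "t\<^sup>2 / 2 \<le> t\<^sup>2 + 2 * (s * t * z)" by linarith
      have "gram (s *\<^sub>R x + t *\<^sub>R xa) y = s\<^sup>2 * gram x y + (t\<^sup>2 + 2 * (s * t * z)) * Y"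
        using xa by (simp add: gram_def inner_expand inner_commute[of xa x] z_def Y_def power2_eq_square algebra_simps)
      then have "t\<^sup>2 / 2 * Y \<le> gram (s *\<^sub>R x + t *\<^sub>R xa) y"
        using mult_right_mono[OF half, of Y] mult_nonneg_nonneg[OF zero_le_power2[of s] gram_nonneg[of x y]] Y
        by linarith
      moreover have "s ^ 4 * Y / 12 / 2 * Y \<le> t\<^sup>2 / 2 * Y"
        using Y by (intro mult_right_mono divide_right_mono t2) auto
      ultimately have "s ^ 4 * Y / 12 / 2 * Y \<le> gram (s *\<^sub>R x + t *\<^sub>R xa) y" by linarith
      then have "s\<^sup>2 * (s ^ 4 * Y / 12 / 2 * Y) \<le> s\<^sup>2 * gram (s *\<^sub>R x + t *\<^sub>R xa) y"
        by (intro mult_left_mono) auto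
      also have "\<dots> = gram (s *\<^sub>R x + t *\<^sub>R xa) (s *\<^sub>R y)"
        using gram_scaleR[of 1 "s *\<^sub>R x + t *\<^sub>R xa" s y] by simp
      also have "\<dots> \<le> 16 * npd (g r s)"
        unfolding g_def t_def[symmetric] using npd_ge(1) by (simp add: mult.commute)
      finally have "Y\<^sup>2 / 384 * s ^ 6 \<le> npd (g r s)"
        by (simp add: power2_eq_square power_numeral_reduce mult_ac)
      moreover have "s ^ 6 = (r ^ 6)\<^sup>2" by (simp add: s_def flip: power_mult)
      moreover have "c * (r ^ 6)\<^sup>2 \<le> Y\<^sup>2 / 384 * (r ^ 6)\<^sup>2" by (intro mult_right_mono) (auto simp: c_def)
      ultimately show "c * (r ^ 6)\<^sup>2 \<le> npd (g r (r\<^sup>2))" by (simp add: s_def)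
    qed
  qed simp
qed

section \<open>Classification of subalgebras\<close>

text \<open>Condition (a), and in \<open>indep\<close> condition (i), without dimensions: for
  nonzero \<open>y\<close>, \<open>gram x y = 0\<close> says that \<open>x\<close> is a multiple of
  \<open>y\<close>.\<close>

definition dep :: "'k::finite ncoord \<Rightarrow> bool" where
  "dep = (\<lambda>(\<phi>, x, y, \<eta>). (y = 0 \<and> (\<phi> \<noteq> 0 \<or> x \<noteq> 0)) \<or> (y \<noteq> 0 \<and> \<phi> = 0 \<and> gram x y = 0))"

definition indep :: "'k::finite ncoord \<Rightarrow> bool" where
  "indep = (\<lambda>(\<phi>, x, y, \<eta>). y \<noteq> 0 \<and> (\<phi> \<noteq> 0 \<or> gram x y \<noteq> 0))"

lemma dim_span_pair:
  fixes x y :: "real ^ 'k::finite"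
  shows "dim (span {(\<phi>, x), (0, y)}) = 1 \<longleftrightarrow> dep (\<phi>, x, y, \<eta>)"
    "dim (span {(\<phi>, x), (0, y)}) = 2 \<longleftrightarrow> indep (\<phi>, x, y, \<eta>)"
proof -
  let ?p = "(\<phi>, x)" and ?q = "(0 :: real, y)"
  have d: "dim (span {?p, ?q}) = (if ?q = 0 then (if ?p = 0 then 0 else 1)
      else if ?p \<in> span {?q} then 1 else 2)"
    by (auto simp: dim_insert)
  have q: "?q = 0 \<longleftrightarrow> y = 0" "?p = 0 \<longleftrightarrow> \<phi> = 0 \<and> x = 0" by (simp_all add: zero_prod_def)
  have s: "?p \<in> span {?q} \<longleftrightarrow> \<phi> = 0 \<and> gram x y = 0" if "y \<noteq> 0"
  proof -
    have "?p \<in> span {?q} \<longleftrightarrow> \<phi> = 0 \<and> (\<exists>c. x = c *\<^sub>R y)"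
      by (auto simp: span_singleton)
    then show ?thesis using gram_eq_0_iff[OF that] by simp
  qed
  show "dim (span {?p, ?q}) = 1 \<longleftrightarrow> dep (\<phi>, x, y, \<eta>)"
    "dim (span {?p, ?q}) = 2 \<longleftrightarrow> indep (\<phi>, x, y, \<eta>)"
    unfolding d q using s by (auto simp: dep_def indep_def)
qed

definition iso :: "'k::finite ncoord \<Rightarrow> bool" where
  "iso = (\<lambda>(\<phi>, x, y, \<eta>). y = 0 \<and> (norm x)\<^sup>2 = - 2 * \<phi> * \<eta>)"

lemma iso_iff: "iso X \<longleftrightarrow> fst (snd (snd X)) = 0 \<and> lq X X = 0"
  by (cases X rule: prod_cases4) (auto simp: iso_def lq_def power2_norm_eq_inner)

lemma exists_outside_line:
  fixes h :: "'a::euclidean_space set"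
  assumes "dim h \<ge> 2" obtains v where "v \<in> h" "\<And>c. v \<noteq> c *\<^sub>R A"
proof -
  have "\<not> h \<subseteq> span {A}"
  proof
    assume "h \<subseteq> span {A}"
    then have "dim h \<le> dim {A}" using dim_subset dim_span by metis
    also have "\<dots> \<le> 1" using dim_le_card'[of "{A}"] by simp
    finally show False using assms by simp
  qed
  then show ?thesis using that by (auto simp: span_singleton)
qed

locale nsubalgebra =
  fixes h :: "'k::finite ncoord set"
  assumes sub: "subspace h" and nbr_h: "X \<in> h \<Longrightarrow> Y \<in> h \<Longrightarrow> nbr X Y \<in> h"
begin

lemma ad: "X \<in> h \<Longrightarrow> Y \<in> h \<Longrightarrow> X + Y \<in> h" and sc: "X \<in> h \<Longrightarrow> c *\<^sub>R X \<in> h"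
  using sub by (auto intro: subspace_add subspace_scale)

lemma eta_scale:
  assumes "(0, 0, 0, c) \<in> h" "c \<noteq> 0" shows "(0, 0, 0, 1) \<in> h"
  using sc[OF assms(1), of "1/c"] assms(2) by simp

lemma ncrit_y0_eta:
  assumes "A \<in> h" "fst (snd (snd A)) = 0" "lq A A \<noteq> 0" "(0, 0, 0, 1) \<in> h"
  shows "ncrit h"
  by (rule ncrit_y0[OF sub assms(1,4,2) _ assms(3)]) (auto simp: lq_def zero_prod_def)

lemma bracket_eta:
  assumes "(0, x, 0, \<eta>) \<in> h" "(\<phi>', x', y', \<eta>') \<in> h" "x \<bullet> y' \<noteq> 0"
  shows "(0, 0, 0, 1) \<in> h"
  using nbr_h[OF assms(1,2)] assms(3) by (intro eta_scale[of "- (x \<bullet> y')"]) (simp_all add: nbr_def)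

text \<open>The first bracket has \<open>x\<close>-part \<open>\<phi> *\<^sub>R y'\<close> and
  \<open>y = 0\<close>; bracketing it with the same element again gives
  \<open>- \<phi> * (y' \<bullet> y')\<close> on the \<eta>-axis.\<close>

lemma double_bracket_eta:
  assumes "(\<phi>, x, 0, \<eta>) \<in> h" "(\<phi>', x', y', \<eta>') \<in> h" "\<phi> \<noteq> 0" "y' \<noteq> 0"
  shows "(0, 0, 0, 1) \<in> h"
  using nbr_h[OF assms(1,2)] assms(3,4)
  by (intro bracket_eta[of "\<phi> *\<^sub>R y'" _ \<phi>' x' y' \<eta>'] assms(2)) (simp_all add: nbr_def)

text \<open>Only an isotropic \<open>A\<close> with \<open>y = 0\<close>, hence
  \<open>\<phi> \<noteq> 0\<close>, has to be replaced, with the help of a second direction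
  \<open>v\<close>. If \<open>v\<close> has nonzero \<open>y\<close>, its bracket with
  \<open>A\<close> is anisotropic. Otherwise clear its \<phi>: either a nonzero \<open>x\<close>
  remains, or a vector of the \<eta>-axis whose addition to \<open>A\<close> changes
  \<open>lq\<close>.\<close>

lemma exists_anisotropic:
  assumes "dim h \<ge> 2" "A \<in> h" "dep A"
  shows "\<exists>A\<in>h. (fst (snd (snd A)) = 0 \<and> lq A A \<noteq> 0) \<or> (\<exists>x y \<eta>. A = (0, x, y, \<eta>) \<and> y \<noteq> 0 \<and> gram x y = 0)"
proof -
  obtain \<phi> x y \<eta> where A: "A = (\<phi>, x, y, \<eta>)" by (metis prod_cases4)
  show ?thesis
  proof (cases "y = 0 \<and> lq A A = 0")
    case False
    then show ?thesis using assms(2,3) by (intro bexI[of _ A]) (auto simp: A dep_def)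
  next
    case True
    then have q: "2 * \<phi> * \<eta> + x \<bullet> x = 0" and y: "y = 0" by (auto simp: A lq_def mult_ac)
    have phi: "\<phi> \<noteq> 0" using assms(3) q y by (auto simp: A dep_def)
    obtain v where v: "v \<in> h" "\<And>c. v \<noteq> c *\<^sub>R A" using exists_outside_line[OF assms(1)] by blast
    obtain \<phi>v xv yv \<eta>v where v4: "v = (\<phi>v, xv, yv, \<eta>v)" by (metis prod_cases4)
    show ?thesis
    proof (cases "yv = 0")
      case False
      have "nbr A v \<in> h" by (rule nbr_h[OF assms(2) v(1)])
      then show ?thesis using False phi y by (intro bexI[of _ "nbr A v"]) (auto simp: A v4 nbr_def lq_def)
    next
      case True
      define x' \<eta>' where "x' = xv - (\<phi>v / \<phi>) *\<^sub>R x" and "\<eta>' = \<eta>v - (\<phi>v / \<phi>) * \<eta>"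
      have "(0, x', 0, \<eta>') = v + (- (\<phi>v / \<phi>)) *\<^sub>R A"
        using phi y True by (simp add: x'_def \<eta>'_def A v4)
      also have "\<dots> \<in> h" using v(1) assms(2) by (intro ad sc)
      finally have w: "(0, x', 0, \<eta>') \<in> h" .
      show ?thesis
      proof (cases "x' = 0")
        case False
        then show ?thesis using w by (intro bexI[of _ "(0, x', 0, \<eta>')"]) (auto simp: lq_def)
      next
        case x0: True
        have "\<eta>' \<noteq> 0"
        proof
          assume "\<eta>' = 0"
          then have "v = (\<phi>v / \<phi>) *\<^sub>R A"
            using x0 True y phi by (simp add: x'_def \<eta>'_def A v4)
          then show False using v(2) by blast
        qed
        moreover have "(\<phi>, x, 0, \<eta> + \<eta>') \<in> h"
          using ad[OF assms(2) w] by (simp add: A y x0)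
        ultimately show ?thesis
          using phi q by (intro bexI[of _ "(\<phi>, x, 0, \<eta> + \<eta>')"]) (auto simp: lq_def algebra_simps)
      qed
    qed
  qed
qed

text \<open>If \<open>h\<close> contains the \<eta>-axis, the axis can play the part of
  \<open>B\<close>. Otherwise every bracket that would produce the axis must vanish, and the
  resulting constraints lead to one of the curve lemmas.\<close>

lemma ncrit_case2:
  assumes "dim h \<ge> 2" "A0 \<in> h" "dep A0" and B: "B \<in> h" "B \<noteq> 0" "indep B \<or> iso B"
  shows "ncrit h"
proof -
  obtain b xb yb eb where B4: "B = (b, xb, yb, eb)" by (metis prod_cases4)
  consider (A1) a xa ea where "(a, xa, 0, ea) \<in> h" "2 * a * ea + xa \<bullet> xa \<noteq> 0"
    | (A2) x y \<eta> where "(0, x, y, \<eta>) \<in> h" "y \<noteq> 0" "gram x y = 0"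
  proof -
    obtain A where A: "A \<in> h" "(fst (snd (snd A)) = 0 \<and> lq A A \<noteq> 0) \<or> (\<exists>x y \<eta>. A = (0, x, y, \<eta>) \<and> y \<noteq> 0 \<and> gram x y = 0)"
      using exists_anisotropic[OF assms(1-3)] by blast
    obtain a xa ya ea where "A = (a, xa, ya, ea)" by (metis prod_cases4)
    then show ?thesis using A that by (auto simp: lq_def mult_ac)
  qed
  then show ?thesis
  proof cases
    case A1
    have lqA: "lq (a, xa, 0, ea) (a, xa, 0, ea) \<noteq> 0" using A1(2) by (simp add: lq_def mult_ac)
    show ?thesis
    proof (cases "yb = 0")
      case True
      then have "iso B" using B(3) by (auto simp: B4 indep_def)
      then show ?thesis
        using ncrit_y0[OF sub A1(1) B(1) _ _ lqA B(2)] True by (simp add: iso_iff B4)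
    next
      case yb: False
      then have "indep B" using B(3) by (auto simp: B4 iso_def)
      show ?thesis
      proof (cases "(0, 0, 0, 1) \<in> h")
        case True
        then show ?thesis using ncrit_y0_eta[OF A1(1) _ lqA] by simp
      next
        case False
        have a0: "a = 0" using double_bracket_eta[OF A1(1), of b xb yb eb] B(1) B4 yb False by blast
        have xa: "xa \<noteq> 0" using A1(2) a0 by auto
        have orth: "xa \<bullet> yb = 0"
          using bracket_eta[of xa ea b xb yb eb] A1(1) B(1) B4 a0 False by blast
        show ?thesis
        proof (cases "b = 0")
          case True
          then have "gram xb yb \<noteq> 0" using \<open>indep B\<close> by (auto simp: B4 indep_def)
          then show ?thesis
            using ncrit_phi0[OF sub, of xa 0 ea xb yb eb] A1(1) B(1) a0 True xa by (simp add: B4)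
        next
          case b0: False
          have Bh: "(1, (1/b) *\<^sub>R xb, (1/b) *\<^sub>R yb, eb / b) \<in> h"
            using sc[OF B(1), of "1/b"] b0 by (simp add: B4)
          \<comment> \<open>\<open>xa\<close> may be normalized to either of two unit vectors;
            \<open>s\<close> is chosen to meet the sign hypothesis of
            \<open>ncrit_phi1_orth\<close>.\<close>
          have main: "ncrit h" if s: "\<bar>s\<bar> = 1" "s * (ea / norm xa + ((1/b) *\<^sub>R xb) \<bullet> ((1 / norm xa) *\<^sub>R xa)) \<ge> 0" for s
          proof (rule ncrit_phi1_orth[OF sub _ Bh])
            show "(0, (s / norm xa) *\<^sub>R xa, 0, s * ea / norm xa) \<in> h"
              using sc[OF A1(1), of "s / norm xa"] a0 by simp
            have "s * s = 1" using s(1) by (metis abs_mult_self_eq mult_1_right)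
            then show "((s / norm xa) *\<^sub>R xa) \<bullet> ((s / norm xa) *\<^sub>R xa) = 1"
              using xa by (simp add: power2_norm_eq_inner[symmetric] power2_eq_square field_simps)
            show "((s / norm xa) *\<^sub>R xa) \<bullet> ((1/b) *\<^sub>R yb) = 0" using orth by simp
            show "(1/b) *\<^sub>R yb \<noteq> 0" using yb b0 by simp
            show "s * ea / norm xa + ((1/b) *\<^sub>R xb) \<bullet> ((s / norm xa) *\<^sub>R xa) \<ge> 0"
              using s(2) by (simp add: algebra_simps)
          qed
          show ?thesis
            using main[of 1] main[of "-1"] by (cases "ea / norm xa + ((1/b) *\<^sub>R xb) \<bullet> ((1 / norm xa) *\<^sub>R xa) \<ge> 0") auto
        qed
      qed
    qed
  next
    case A2
    show ?thesis
    proof (cases "(0, 0, 0, 1) \<in> h")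
      case True
      then show ?thesis using ncrit_eta[OF sub A2(1) _ A2(3)] A2(2) by blast
    next
      case False
      \<comment> \<open>Otherwise bracketing \<open>B\<close> twice with the element
        \<open>(0, x, y, \<eta>)\<close> yields a nonzero multiple of the \<eta>-axis.\<close>
      have b_y: "b = 0 \<or> yb = 0"
      proof (rule ccontr)
        assume "\<not> ?thesis"
        then have bn: "b \<noteq> 0" by simp
        have "nbr B (0, x, y, \<eta>) \<in> h" by (rule nbr_h[OF B(1) A2(1)])
        then have "(0, b *\<^sub>R y, 0, x \<bullet> yb - xb \<bullet> y) \<in> h" by (simp add: B4 nbr_def)
        moreover have "(b *\<^sub>R y) \<bullet> y \<noteq> 0" using bn A2(2) by simp
        ultimately show False using bracket_eta A2(1) False by blast
      qed
      show ?thesis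
      proof (cases "b = 0")
        case True
        have "yb \<noteq> 0"
        proof
          assume yb: "yb = 0"
          then have "iso B" using B(3) by (auto simp: B4 indep_def)
          then have "xb = 0" using True by (simp add: B4 iso_def)
          then have "(0, 0, 0, eb) \<in> h" "eb \<noteq> 0" using B(1,2) True yb by (auto simp: B4 zero_prod_def)
          then show False using eta_scale False by blast
        qed
        then have "gram xb yb \<noteq> 0" using B(3) True by (auto simp: B4 indep_def iso_def)
        then show ?thesis
          using ncrit_phi0[OF sub A2(1), of xb yb eb] B(1) A2 True by (simp add: B4)
      next
        case b: False
        then have yb: "yb = 0" using b_y by simp
        then show ?thesis
          using double_bracket_eta[of b xb eb 0 x y \<eta>] B(1) A2 b False by (simp add: B4)
      qed
    qed
  qed
qed

lemma ncrit_case1: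
  assumes "(0, 0, 0, 1) \<in> h" "(\<phi>, x, y, \<eta>) \<in> h" "\<phi> \<noteq> 0" "y \<noteq> 0"
  shows "ncrit h"
proof (rule ncrit_phi1_eta[OF sub _ assms(1)])
  have "(1/\<phi>) *\<^sub>R (\<phi>, x, y, \<eta>) + (- (\<eta> / \<phi>)) *\<^sub>R (0, 0, 0, 1) \<in> h"
    by (intro ad sc assms(1,2))
  then show "(1, (1/\<phi>) *\<^sub>R x, (1/\<phi>) *\<^sub>R y, 0) \<in> h" using assms(3) by simp
  show "(1/\<phi>) *\<^sub>R y \<noteq> 0" using assms by simp
qed

end

section \<open>Growth estimates that refute the criterion\<close>

lemma homogeneous_lower_bound:
  fixes S :: "'a::euclidean_space set" and f :: "'a \<Rightarrow> real"
  assumes S: "subspace S" and f: "continuous_on UNIV f" "\<And>t x. f (t *\<^sub>R x) = \<bar>t\<bar> ^ n * f x"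
    and pos: "\<And>x. x \<in> S \<Longrightarrow> x \<noteq> 0 \<Longrightarrow> f x > 0" and n: "n > 0"
  obtains c where "c > 0" "\<And>x. x \<in> S \<Longrightarrow> c * norm x ^ n \<le> f x"
proof (cases "S \<inter> sphere 0 1 = {}")
  case True
  have z: "x = 0" if "x \<in> S" for x
  proof (rule ccontr)
    assume "x \<noteq> 0"
    then have "(1 / norm x) *\<^sub>R x \<in> S \<inter> sphere 0 1" using that S by (simp add: subspace_scale)
    then show False using True by blast
  qed
  have "f 0 = 0" using f(2)[of 0 0] n by (simp add: power_0_left)
  then have "1 * norm x ^ n \<le> f x" if "x \<in> S" for x
    using z[OF that] n by (simp add: power_0_left)
  then show ?thesis using that[of 1] by simp
next
  case False
  have "compact (S \<inter> sphere 0 1)" using S by (intro closed_Int_compact closed_subspace) auto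
  then have "\<exists>x0\<in>S \<inter> sphere 0 1. \<forall>x\<in>S \<inter> sphere 0 1. f x0 \<le> f x"
    using False f(1) by (intro continuous_attains_inf) (auto intro: continuous_on_subset)
  then obtain x0 where x0: "x0 \<in> S \<inter> sphere 0 1" "\<And>x. x \<in> S \<inter> sphere 0 1 \<Longrightarrow> f x0 \<le> f x" by blast
  have "x0 \<noteq> 0" using x0(1) by auto
  then have p: "f x0 > 0" using x0(1) pos by blast
  have "f x0 * norm x ^ n \<le> f x" if x: "x \<in> S" for x
  proof (cases "x = 0")
    case True
    then show ?thesis using f(2)[of 0 0] n by (simp add: power_0_left)
  next
    case False
    have "f x0 \<le> f ((1 / norm x) *\<^sub>R x)"
      using x False S by (intro x0(2)) (simp add: subspace_scale)
    then have "norm x ^ n * f x0 \<le> norm x ^ n * f ((1 / norm x) *\<^sub>R x)" by (intro mult_left_mono) auto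
    also have "\<dots> = f (norm x *\<^sub>R ((1 / norm x) *\<^sub>R x))" by (simp only: f(2) abs_norm_cancel)
    finally show ?thesis using False by (simp add: mult.commute)
  qed
  then show ?thesis using that p by blast
qed

text \<open>The wall \<open>b = 1\<close> of the chamber; \<open>ncrit_large\<close> is the wall
  \<open>b = a\<close>. Here \<open>a\<close> includes a factor \<open>B\<close> so that the size is
  still at least \<open>R\<close> after the loss in the criterion.\<close>

lemma ncrit_small:
  assumes "ncrit h"
  obtains B where "B \<ge> 0" "\<And>R. \<exists>X\<in>h. R \<le> npn X \<and> npd X \<le> B * npn X"
proof -
  obtain B where B: "B \<ge> 1" "\<And>a b. 1 \<le> b \<Longrightarrow> b \<le> a \<Longrightarrow>
    \<exists>X\<in>h. a \<le> B * npn X \<and> npn X \<le> B * a \<and> a * b \<le> B * npd X \<and> npd X \<le> B * (a * b)"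
    using assms unfolding ncrit_def by blast
  have "\<exists>X\<in>h. R \<le> npn X \<and> npd X \<le> (B * B) * npn X" for R
  proof -
    have "1 \<le> B * max 1 R" using B(1) mult_mono[of 1 B 1 "max 1 R"] by simp
    then obtain X where X: "X \<in> h" "B * max 1 R \<le> B * npn X" "npd X \<le> B * (B * max 1 R)"
      using B(2)[of 1 "B * max 1 R"] by auto
    have m: "max 1 R \<le> npn X" using X(2) B(1) by simp
    have "B * (B * max 1 R) \<le> B * (B * npn X)" using m B(1) by (intro mult_left_mono) auto
    then show ?thesis using X m by (intro bexI[of _ X]) auto
  qed
  then show ?thesis using that[of "B * B"] by auto
qed

lemma ncrit_large:
  assumes "ncrit h"
  obtains B where "B \<ge> 0" "\<And>R. \<exists>X\<in>h. R \<le> npn X \<and> (npn X)\<^sup>2 \<le> B * npd X"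
proof -
  obtain B where B: "B \<ge> 1" "\<And>a b. 1 \<le> b \<Longrightarrow> b \<le> a \<Longrightarrow>
    \<exists>X\<in>h. a \<le> B * npn X \<and> npn X \<le> B * a \<and> a * b \<le> B * npd X \<and> npd X \<le> B * (a * b)"
    using assms unfolding ncrit_def by blast
  have "\<exists>X\<in>h. R \<le> npn X \<and> (npn X)\<^sup>2 \<le> (B\<^sup>2 * B) * npd X" for R
  proof -
    define a where "a = B * max 1 R"
    have "1 \<le> a" using B(1) mult_mono[of 1 B 1 "max 1 R"] by (simp add: a_def)
    then obtain X where X: "X \<in> h" "a \<le> B * npn X" "npn X \<le> B * a" "a * a \<le> B * npd X"
      using B(2)[of a a] by auto
    have m: "max 1 R \<le> npn X" using X(2) B(1) by (simp add: a_def)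
    have "(npn X)\<^sup>2 \<le> (B * a)\<^sup>2" using X(3) npn_ge_1[of X] by (intro power_mono) auto
    also have "\<dots> = B\<^sup>2 * (a * a)" by (simp add: power2_eq_square)
    also have "\<dots> \<le> B\<^sup>2 * (B * npd X)" using X(4) by (intro mult_left_mono) auto
    finally show ?thesis using X m by (intro bexI[of _ X]) auto
  qed
  then show ?thesis using that[of "B\<^sup>2 * B"] B(1) by auto
qed

lemma not_ncrit_small:
  assumes "\<And>X. X \<in> h \<Longrightarrow> npd X \<le> C * npn X" shows "\<not> ncrit h"
proof
  assume nc: "ncrit h"
  obtain B where B: "B \<ge> 0" "\<And>R. \<exists>X\<in>h. R \<le> npn X \<and> (npn X)\<^sup>2 \<le> B * npd X"
    using ncrit_large[OF nc] by blast
  obtain X where X: "X \<in> h" "B * C + 1 \<le> npn X" "(npn X)\<^sup>2 \<le> B * npd X" using B(2) by blast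
  have "npn X * npn X \<le> B * (C * npn X)"
    using X(3) mult_left_mono[OF assms[OF X(1)] B(1)] by (simp add: power2_eq_square)
  then have "npn X * npn X \<le> (B * C) * npn X" by (simp add: mult.assoc)
  then have "npn X \<le> B * C" using npn_ge_1[of X] by simp
  then show False using X(2) by simp
qed

lemma not_ncrit_large:
  assumes "\<And>X. X \<in> h \<Longrightarrow> (npn X)\<^sup>2 \<le> C * npd X" shows "\<not> ncrit h"
proof
  assume nc: "ncrit h"
  obtain B where B: "B \<ge> 0" "\<And>R. \<exists>X\<in>h. R \<le> npn X \<and> npd X \<le> B * npn X"
    using ncrit_small[OF nc] by blast
  obtain X where X: "X \<in> h" "\<bar>C\<bar> * B + 1 \<le> npn X" "npd X \<le> B * npn X" using B(2) by blast
  have "npn X * npn X \<le> C * npd X" using assms[OF X(1)] by (simp add: power2_eq_square)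
  also have "\<dots> \<le> \<bar>C\<bar> * npd X" using npd_ge_1[of X] by (intro mult_right_mono) auto
  also have "\<dots> \<le> \<bar>C\<bar> * (B * npn X)" using X(3) by (intro mult_left_mono) auto
  finally have "npn X * npn X \<le> (\<bar>C\<bar> * B) * npn X" by (simp add: mult.assoc)
  then have "npn X \<le> \<bar>C\<bar> * B" using npn_ge_1[of X] by simp
  then show False using X(2) by simp
qed

lemma gram_le: "2 * \<bar>x \<bullet> y\<bar> \<le> x \<bullet> x + y \<bullet> y"
proof -
  have "0 \<le> (x + y) \<bullet> (x + y)" "0 \<le> (x - y) \<bullet> (x - y)" by simp_all
  then show ?thesis by (simp add: inner_expand inner_commute[of y x] abs_le_iff)
qed

text \<open>By compactness the Gram determinant is at least \<open>c\<close> times the fourth power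
  of the length of \<open>(x, y)\<close>, so \<open>npd\<close> dominates the squared size. The
  projection \<open>p\<close> drops \<eta> because \<open>h\<close> may contain the \<eta>-axis;
  \<eta> is controlled by its own square in \<open>npd\<close>.\<close>

lemma not_ncrit_gram:
  assumes h: "subspace h" and phi: "\<And>X. X \<in> h \<Longrightarrow> fst X = 0"
    and gr: "\<And>x y \<eta>. (0, x, y, \<eta>) \<in> h \<Longrightarrow> x \<noteq> 0 \<or> y \<noteq> 0 \<Longrightarrow> gram x y \<noteq> 0"
  shows "\<not> ncrit (h :: 'k::finite ncoord set)"
proof -
  define p where "p X = (fst (snd X), fst (snd (snd X)))" for X :: "'k ncoord"
  have lin: "linear p" by (rule linearI) (simp_all add: p_def)
  define f where "f w = gram (fst w) (snd w)" for w :: "(real ^ 'k) \<times> (real ^ 'k)"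
  obtain c where c: "c > 0" "\<And>w. w \<in> p ` h \<Longrightarrow> c * norm w ^ 4 \<le> f w"
  proof (rule homogeneous_lower_bound[of "p ` h" f 4])
    show "subspace (p ` h)" using linear_subspace_image[OF lin h] .
    show "continuous_on UNIV f" unfolding f_def gram_def by (intro continuous_intros)
    show "f (t *\<^sub>R w) = \<bar>t\<bar> ^ 4 * f w" for t w
      using gram_scaleR[of t "fst w" t "snd w"] by (simp add: f_def flip: power_add)
    show "f w > 0" if "w \<in> p ` h" "w \<noteq> 0" for w
    proof -
      obtain X where X: "X \<in> h" "w = p X" using \<open>w \<in> p ` h\<close> by blast
      obtain x y \<eta> where X4: "X = (0, x, y, \<eta>)" using phi[OF X(1)] by (metis prod_cases4 fst_conv)
      then have "gram x y \<noteq> 0" using gr[of x y \<eta>] X that by (auto simp: p_def zero_prod_def)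
      then show ?thesis using gram_nonneg[of x y] by (simp add: f_def X X4 p_def)
    qed
  qed auto
  have "(npn X)\<^sup>2 \<le> (12 + 192 / c) * npd X" if X: "X \<in> h" for X
  proof -
    obtain x y \<eta> where X4: "X = (0, x, y, \<eta>)" using phi[OF X] by (metis prod_cases4 fst_conv)
    define w where "w = x \<bullet> x + y \<bullet> y"
    have w0: "0 \<le> w" by (simp add: w_def)
    have "(norm (x, y))\<^sup>2 = w" by (simp add: w_def norm_Pair power2_norm_eq_inner)
    then have "norm (x, y) ^ 4 = w\<^sup>2" by (metis power2_eq_square power4_eq_xxxx mult.assoc)
    then have g: "c * w\<^sup>2 \<le> gram x y" using c(2)[of "(x, y)"] X by (force simp: f_def p_def X4)
    have "npn X \<le> 2 + \<bar>x \<bullet> x\<bar> / 2 + \<bar>\<eta>\<bar> + \<bar>x \<bullet> y\<bar> + y \<bullet> y"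
      using npn_le[of 0 x y \<eta>] by (simp add: X4 corner_def)
    also have "\<dots> \<le> 2 + 2 * w + \<bar>\<eta>\<bar>"
    proof -
      have "0 \<le> x \<bullet> x" "0 \<le> y \<bullet> y" by simp_all
      then show ?thesis using gram_le[of x y] unfolding w_def by argo
    qed
    finally have "(npn X)\<^sup>2 \<le> (2 + 2 * w + \<bar>\<eta>\<bar>)\<^sup>2" using npn_ge_1[of X] by (intro power_mono) auto
    also have "\<dots> \<le> 12 + 12 * w\<^sup>2 + 3 * \<eta>\<^sup>2"
    proof -
      have "(a + b + c)\<^sup>2 \<le> 3 * a\<^sup>2 + 3 * b\<^sup>2 + 3 * c\<^sup>2" for a b c :: real
      proof -
        have "0 \<le> (a - b)\<^sup>2 + (b - c)\<^sup>2 + (a - c)\<^sup>2" by simp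
        then show ?thesis by (simp add: power2_eq_square algebra_simps)
      qed
      from this[of 2 "2 * w" "\<bar>\<eta>\<bar>"] show ?thesis by (simp add: power_mult_distrib)
    qed
    \<comment> \<open>The 12 absorbs the constant and \<eta>; the rest comes from
      \<open>12 * w\<^sup>2 = (192 / c) * (c * w\<^sup>2 / 16)\<close>.\<close>
    also have "\<dots> \<le> (12 + 192 / c) * (1 + \<eta>\<^sup>2 / 4 + c * w\<^sup>2 / 16)"
    proof -
      have "(12 + 192 / c) * (1 + \<eta>\<^sup>2 / 4 + c * w\<^sup>2 / 16) = 12 + 12 * w\<^sup>2 + 3 * \<eta>\<^sup>2 + (192 / c + 48 * \<eta>\<^sup>2 / c + 12 * c * w\<^sup>2 / 16)"
        using c(1) by (simp add: field_simps)
      moreover have "0 \<le> 192 / c + 48 * \<eta>\<^sup>2 / c + 12 * c * w\<^sup>2 / 16" using c(1) by simp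
      ultimately show ?thesis by linarith
    qed
    also have "\<dots> \<le> (12 + 192 / c) * npd X"
    proof (rule mult_left_mono)
      have "npd X = 1 + w / 4 + \<eta>\<^sup>2 / 4 + gram x y / 16" by (simp add: X4 npd_def w_def)
      then show "1 + \<eta>\<^sup>2 / 4 + c * w\<^sup>2 / 16 \<le> npd X" using g w0 by simp
    qed (use c(1) in simp)
    finally show ?thesis .
  qed
  then show ?thesis by (rule not_ncrit_large)
qed

text \<open>\<open>corner\<close> vanishes on such elements, so the size grows only linearly while
  \<open>npd\<close> grows like the squared norm.\<close>

lemma not_ncrit_iso:
  assumes "\<And>X. X \<in> h \<Longrightarrow> iso X" shows "\<not> ncrit (h :: 'k::finite ncoord set)"
proof -
  have "(npn X)\<^sup>2 \<le> 32 * npd X" if Xh: "X \<in> h" for X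
  proof -
    obtain \<phi> x \<eta> where X4: "X = (\<phi>, x, 0, \<eta>)" and q: "x \<bullet> x = - 2 * \<phi> * \<eta>"
      using assms[OF Xh] by (cases X rule: prod_cases4) (auto simp: iso_def power2_norm_eq_inner)
    have "npn X \<le> 2 + \<bar>\<phi>\<bar> + \<bar>\<eta>\<bar>"
      using npn_le[of \<phi> x 0 \<eta>] q by (simp add: X4 corner_def)
    also have "\<dots> \<le> 2 + 2 * norm X"
      using abs_le_norm_ncoord(1,2)[where \<phi> = \<phi> and \<eta> = \<eta> and x = x and y = "0 :: real ^ 'k"] unfolding X4 by linarith
    finally have "(npn X)\<^sup>2 \<le> (2 + 2 * norm X)\<^sup>2" using npn_ge_1[of X] by (intro power_mono) auto
    also have "\<dots> \<le> 8 + 8 * (norm X)\<^sup>2"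
    proof -
      have "0 \<le> (2 - 2 * norm X)\<^sup>2" by simp
      then show ?thesis by (simp add: power2_eq_square algebra_simps)
    qed
    also have "\<dots> \<le> 32 * npd X" unfolding X4 npd_y0 by simp
    finally show ?thesis .
  qed
  then show ?thesis by (rule not_ncrit_large)
qed

lemma not_ncrit_line:
  assumes h: "\<And>X. X \<in> h \<Longrightarrow> \<exists>t. X = t *\<^sub>R (\<phi>, x, y, \<eta>)" and nz: "\<phi> \<noteq> 0" "y \<noteq> 0"
  shows "\<not> ncrit (h :: 'k::finite ncoord set)"
proof
  assume nc: "ncrit h"
  obtain B where B: "B \<ge> 0" "\<And>R. \<exists>X\<in>h. R \<le> npn X \<and> npd X \<le> B * npn X"
    using ncrit_small[OF nc] by blast
  define Y where "Y = y \<bullet> y"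
  define k where "k = \<bar>\<phi>\<bar> * Y"
  have Y: "Y > 0" using nz by (simp add: Y_def)
  have k: "k > 0" using nz Y by (simp add: k_def)
  define C where "C = 2 + \<bar>\<phi> * \<eta>\<bar> + x \<bullet> x + \<phi>\<^sup>2 * Y + \<bar>\<phi>\<bar> + \<bar>\<eta>\<bar> + \<bar>x \<bullet> y\<bar> + k + Y"
  have C0: "C \<ge> 0" using Y k by (simp add: C_def add_nonneg_nonneg)
  have up: "npn (t *\<^sub>R (\<phi>, x, y, \<eta>)) \<le> C * (1 + t ^ 4)" for t
  proof -
    define u where "u = \<bar>t\<bar>"
    have u: "0 \<le> u" "t\<^sup>2 = u\<^sup>2" "t ^ 4 = u ^ 4" by (simp_all add: u_def power_even_abs)
    have ui: "u ^ i \<le> 1 + u ^ 4" if "i \<le> 4" for i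
    proof (cases "u \<le> 1")
      case True
      then have "u ^ i \<le> 1" using u(1) by (intro power_le_one) auto
      then show ?thesis using zero_le_power[OF u(1), of 4] by linarith
    next
      case False
      then have "u ^ i \<le> u ^ 4" using that by (intro power_increasing) auto
      then show ?thesis by simp
    qed
    have "\<bar>corner (t *\<^sub>R (\<phi>, x, y, \<eta>))\<bar> \<le> u ^ 2 * \<bar>\<phi> * \<eta>\<bar> + u ^ 2 * (x \<bullet> x) + u ^ 4 * (\<phi>\<^sup>2 * Y)"
    proof -
      have "corner (t *\<^sub>R (\<phi>, x, y, \<eta>)) = - (t\<^sup>2 * (\<phi> * \<eta>)) - t\<^sup>2 * (x \<bullet> x) / 2 + t ^ 4 * (\<phi>\<^sup>2 * Y) / 24"
        by (simp add: corner_def Y_def power2_eq_square power4_eq_xxxx algebra_simps)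
      moreover have "\<bar>t\<^sup>2 * (\<phi> * \<eta>)\<bar> = u\<^sup>2 * \<bar>\<phi> * \<eta>\<bar>" by (simp add: abs_mult u_def)
      moreover have "0 \<le> t\<^sup>2 * (x \<bullet> x)" "0 \<le> t ^ 4 * (\<phi>\<^sup>2 * Y)" using Y by simp_all
      ultimately show ?thesis unfolding u(2,3) by argo
    qed
    moreover have "npn (t *\<^sub>R (\<phi>, x, y, \<eta>)) \<le> 2 + \<bar>corner (t *\<^sub>R (\<phi>, x, y, \<eta>))\<bar> + u * \<bar>\<phi>\<bar> + u * \<bar>\<eta>\<bar>
        + u\<^sup>2 * \<bar>x \<bullet> y\<bar> + u ^ 3 * k + u\<^sup>2 * Y"
    proof -
      have "npn (t *\<^sub>R (\<phi>, x, y, \<eta>)) \<le> 2 + \<bar>corner (t *\<^sub>R (\<phi>, x, y, \<eta>))\<bar> + \<bar>t * \<phi>\<bar> + \<bar>t * \<eta>\<bar>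
        + \<bar>t\<^sup>2 * (x \<bullet> y)\<bar> + \<bar>t * \<phi>\<bar> * (t\<^sup>2 * Y) + t\<^sup>2 * Y"
        using npn_le[of "t * \<phi>" "t *\<^sub>R x" "t *\<^sub>R y" "t * \<eta>"]
        by (simp add: Y_def power2_eq_square mult.assoc)
      moreover have "\<bar>t * \<phi>\<bar> = u * \<bar>\<phi>\<bar>" "\<bar>t * \<eta>\<bar> = u * \<bar>\<eta>\<bar>" by (simp_all add: abs_mult u_def)
      moreover have "\<bar>t\<^sup>2 * (x \<bullet> y)\<bar> = u\<^sup>2 * \<bar>x \<bullet> y\<bar>" by (simp add: abs_mult u_def)
      moreover have "u * \<bar>\<phi>\<bar> * (u\<^sup>2 * Y) = u ^ 3 * k"
        by (simp add: k_def power2_eq_square power3_eq_cube)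
      ultimately show ?thesis by (simp only: u(2))
    qed
    ultimately have "npn (t *\<^sub>R (\<phi>, x, y, \<eta>)) \<le> 2 + (u ^ 2 * \<bar>\<phi> * \<eta>\<bar> + u ^ 2 * (x \<bullet> x) + u ^ 4 * (\<phi>\<^sup>2 * Y))
        + u * \<bar>\<phi>\<bar> + u * \<bar>\<eta>\<bar> + u\<^sup>2 * \<bar>x \<bullet> y\<bar> + u ^ 3 * k + u\<^sup>2 * Y" by linarith
    also have "\<dots> \<le> 2 * (1 + u ^ 4) + ((1 + u ^ 4) * \<bar>\<phi> * \<eta>\<bar> + (1 + u ^ 4) * (x \<bullet> x) + (1 + u ^ 4) * (\<phi>\<^sup>2 * Y))
        + (1 + u ^ 4) * \<bar>\<phi>\<bar> + (1 + u ^ 4) * \<bar>\<eta>\<bar> + (1 + u ^ 4) * \<bar>x \<bullet> y\<bar> + (1 + u ^ 4) * k + (1 + u ^ 4) * Y"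
      using ui[of 1] ui[of 2] ui[of 3] ui[of 4] Y k u(1) by (intro add_mono mult_right_mono) auto
    also have "\<dots> = C * (1 + t ^ 4)" unfolding u(3) C_def by (simp add: algebra_simps)
    finally show ?thesis .
  qed
  \<comment> \<open>Beyond the threshold \<open>U\<close> the shifted \<eta> has absolute value at
    least \<open>\<bar>t\<bar> * t\<^sup>2 * k / 24\<close>. A quarter of its square gives
    \<open>d * t ^ 6\<close>, as 2304 = 4 * 24 * 24.\<close>
  define d where "d = k\<^sup>2 / 2304"
  have d: "d > 0" using k by (simp add: d_def)
  define U where "U = 1 + 24 * \<bar>\<eta>\<bar> / k + 2 * (B * C) / d"
  have UU: "0 \<le> 24 * \<bar>\<eta>\<bar> / k" "0 \<le> 2 * (B * C) / d" using k d B(1) C0 by simp_all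
  obtain X where X: "X \<in> h" "C * (1 + U\<^sup>2) + 1 \<le> npn X" "npd X \<le> B * npn X" using B(2) by blast
  obtain t where t: "X = t *\<^sub>R (\<phi>, x, y, \<eta>)" using h[OF X(1)] by blast
  have "t\<^sup>2 \<le> U"
  proof (rule ccontr)
    assume "\<not> t\<^sup>2 \<le> U"
    then have big: "t\<^sup>2 > U" by simp
    have b1: "t\<^sup>2 > 1" "24 * \<bar>\<eta>\<bar> \<le> t\<^sup>2 * k" "2 * (B * C) < t\<^sup>2 * d"
    proof -
      show "t\<^sup>2 > 1" using big UU by (simp add: U_def)
      have "24 * \<bar>\<eta>\<bar> / k \<le> t\<^sup>2" "2 * (B * C) / d < t\<^sup>2" using big UU by (simp_all add: U_def)
      then show "24 * \<bar>\<eta>\<bar> \<le> t\<^sup>2 * k" "2 * (B * C) < t\<^sup>2 * d"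
        using k d by (simp_all add: pos_divide_le_eq pos_divide_less_eq)
    qed
    define M where "M = \<eta> + t\<^sup>2 * (\<phi> * Y) / 12"
    have "t\<^sup>2 * k / 24 \<le> \<bar>M\<bar>"
    proof -
      have "\<bar>t\<^sup>2 * (\<phi> * Y) / 12\<bar> = t\<^sup>2 * k / 12" using Y by (simp add: k_def abs_mult)
      moreover have "\<bar>t\<^sup>2 * (\<phi> * Y) / 12\<bar> \<le> \<bar>M\<bar> + \<bar>\<eta>\<bar>" unfolding M_def by linarith
      ultimately show ?thesis using b1(2) by linarith
    qed
    then have "(t\<^sup>2 * k / 24)\<^sup>2 \<le> \<bar>M\<bar>\<^sup>2" using k by (intro power_mono) auto
    then have "t\<^sup>2 * (t\<^sup>2 * k / 24)\<^sup>2 / 4 \<le> t\<^sup>2 * M\<^sup>2 / 4" by (simp add: mult_left_mono)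
    also have "t\<^sup>2 * M\<^sup>2 / 4 \<le> npd X"
    proof -
      have "t\<^sup>2 * M\<^sup>2 = (t * \<eta> + t * \<phi> * ((t *\<^sub>R y) \<bullet> (t *\<^sub>R y)) / 12)\<^sup>2"
        unfolding power_mult_distrib[symmetric] by (simp add: M_def Y_def power2_eq_square algebra_simps)
      then show ?thesis using npd_ge(2)[of "t * \<eta>" "t * \<phi>" "t *\<^sub>R y" "t *\<^sub>R x"] by (simp add: t)
    qed
    also have "npd X \<le> B * (C * (1 + t ^ 4))"
      using X(3) mult_left_mono[OF up[of t] B(1)] by (simp add: t)
    also have "\<dots> \<le> B * (C * (2 * t ^ 4))"
      using b1(1) one_le_power[of "t\<^sup>2" 2] B(1) C0 by (intro mult_left_mono) (auto simp flip: power_mult)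
    also have "\<dots> = 2 * (B * C) * t ^ 4" by simp
    also have "\<dots> < t\<^sup>2 * d * t ^ 4" using b1 by (intro mult_strict_right_mono) auto
    finally show False
      by (simp add: d_def power_mult_distrib power_divide power2_eq_square power4_eq_xxxx mult_ac)
  qed
  then have "(t\<^sup>2)\<^sup>2 \<le> U\<^sup>2" by (intro power_mono) auto
  then have "C * (1 + t ^ 4) \<le> C * (1 + U\<^sup>2)" using C0 by (intro mult_left_mono) (auto simp flip: power_mult)
  then show False using up[of t] X(2) unfolding t by linarith
qed

lemma lq_scaleR: "lq (t *\<^sub>R X) (t *\<^sub>R X) = t\<^sup>2 * lq X X"
  by (cases X rule: prod_cases4) (simp add: lq_def power2_eq_square algebra_simps)

section \<open>Necessity of the conditions\<close>

context nsubalgebra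
begin

text \<open>Without elements of type (b), a quadratic form bounded by \<open>npn\<close> has no
  nontrivial zero on \<open>h\<close>: \<open>lq\<close> if \<phi> is not identically zero, the
  squared length of \<open>(x, y)\<close> otherwise. By compactness it bounds the squared norm, and
  then \<open>npd = O(npn)\<close> misses the wall \<open>b = a\<close>.\<close>

lemma exists_large:
  assumes "ncrit h"
  shows "\<exists>B\<in>h. B \<noteq> 0 \<and> (indep B \<or> iso B)"
proof (rule ccontr)
  assume neg: "\<not> ?thesis"
  have ni: "y = 0 \<or> (\<phi> = 0 \<and> gram x y = 0)" if "(\<phi>, x, y, \<eta>) \<in> h" for \<phi> x y \<eta>
    using neg that by (force simp: indep_def zero_prod_def)
  have niso: "\<not> iso X" if "X \<in> h" "X \<noteq> 0" for X using neg that by blast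
  have "\<exists>C. \<forall>X\<in>h. npd X \<le> C * npn X"
  proof (cases "\<exists>u\<in>h. fst u \<noteq> 0")
    case True
    then obtain a xu yu eu where u: "(a, xu, yu, eu) \<in> h" "a \<noteq> 0" by force
    then have yu: "yu = 0" using ni by blast
    \<comment> \<open>Adding \<open>u\<close> to an element with nonzero \<open>y\<close> would make
      both \<phi> and \<open>y\<close> nonzero, which is type (b).\<close>
    have y0: "y = 0" if "(\<phi>, x, y, \<eta>) \<in> h" for \<phi> x y \<eta>
    proof (rule ccontr)
      assume y: "y \<noteq> 0"
      then have "\<phi> = 0" using ni that by blast
      then have "(a, xu + x, y, eu + \<eta>) \<in> h" using ad[OF u(1) that] yu by simp
      then show False using ni y u(2) by blast
    qed
    define f where "f X = \<bar>lq X X\<bar>" for X :: "'k ncoord"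
    obtain c where c: "c > 0" "\<And>X. X \<in> h \<Longrightarrow> c * norm X ^ 2 \<le> f X"
    proof (rule homogeneous_lower_bound[of h f 2])
      have "f = (\<lambda>X. \<bar>fst X * snd (snd (snd X)) + snd (snd (snd X)) * fst X + fst (snd X) \<bullet> fst (snd X)\<bar>)"
        by (auto simp: f_def lq_def fun_eq_iff)
      then show "continuous_on UNIV f" by (simp only:) (intro continuous_intros)
      show "f (t *\<^sub>R X) = \<bar>t\<bar>\<^sup>2 * f X" for t X
        by (simp add: f_def abs_mult lq_scaleR)
      show "f X > 0" if "X \<in> h" "X \<noteq> 0" for X
      proof -
        obtain \<phi> x y \<eta> where X4: "X = (\<phi>, x, y, \<eta>)" by (metis prod_cases4)
        then have "fst (snd (snd X)) = 0" using y0 that(1) by simp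
        then show ?thesis using niso[OF that] by (simp add: iso_iff f_def)
      qed
    qed (use sub in auto)
    have "npd X \<le> (1 + 1 / c) * npn X" if X: "X \<in> h" for X
    proof -
      obtain \<phi> x y \<eta> where X4: "X = (\<phi>, x, y, \<eta>)" by (metis prod_cases4)
      then have X4': "X = (\<phi>, x, 0, \<eta>)" using y0 X by blast
      have "lq X X = - 2 * corner X" unfolding X4' corner_y0 by (simp add: lq_def algebra_simps)
      then have "f X / 4 \<le> npn X" using npn_ge(1)[of \<phi> x 0 \<eta>] by (simp add: f_def X4' abs_mult)
      then have "f X / c \<le> (4 * npn X) / c" using c(1) by (intro divide_right_mono) auto
      moreover have "(norm X)\<^sup>2 \<le> f X / c" using c(1) c(2)[OF X] by (simp add: pos_le_divide_eq mult.commute)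
      ultimately have "(norm X)\<^sup>2 \<le> 4 * (npn X / c)" by simp
      moreover have "npd X = 1 + (norm X)\<^sup>2 / 4" unfolding X4' by (rule npd_y0)
      ultimately have "npd X \<le> 1 + npn X / c" by linarith
      then show ?thesis using npn_ge_1[of X] by (simp add: algebra_simps)
    qed
    then show ?thesis by blast
  next
    case False
    then have phi: "fst X = 0" if "X \<in> h" for X using that by blast
    define f where "f X = fst (snd X) \<bullet> fst (snd X) + fst (snd (snd X)) \<bullet> fst (snd (snd X))" for X :: "'k ncoord"
    obtain c where c: "c > 0" "\<And>X. X \<in> h \<Longrightarrow> c * norm X ^ 2 \<le> f X"
    proof (rule homogeneous_lower_bound[of h f 2])
      show "continuous_on UNIV f" unfolding f_def by (intro continuous_intros)
      show "f (t *\<^sub>R X) = \<bar>t\<bar>\<^sup>2 * f X" for t X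
        by (simp add: f_def power2_eq_square algebra_simps)
      show "f X > 0" if Xh: "X \<in> h" "X \<noteq> 0" for X
      proof (rule ccontr)
        assume "\<not> f X > 0"
        obtain x y \<eta> where X4: "X = (0, x, y, \<eta>)" using phi[OF Xh(1)] by (metis prod_cases4 fst_conv)
        have "0 \<le> x \<bullet> x" "0 \<le> y \<bullet> y" by simp_all
        then have "x \<bullet> x = 0" "y \<bullet> y = 0" using \<open>\<not> f X > 0\<close> unfolding X4 f_def fst_conv snd_conv by linarith+
        then show False using niso[OF Xh] by (simp add: X4 iso_def)
      qed
    qed (use sub in auto)
    have "npd X \<le> (3 + 2 / c) * npn X" if X: "X \<in> h" for X
    proof -
      obtain x y \<eta> where X4: "X = (0, x, y, \<eta>)" using phi[OF X] by (metis prod_cases4 fst_conv)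
      have g0: "gram x y = 0" using ni[of 0 x y \<eta>] X by (auto simp: X4)
      define w where "w = x \<bullet> x + y \<bullet> y"
      have fw: "f X = w" by (simp add: f_def X4 w_def)
      have "0 \<le> x \<bullet> x" by simp
      then have w: "w \<le> 8 * npn X"
        using npn_ge(1)[of 0 x y \<eta>] npn_ge(2)[of y 0 x \<eta>] by (simp add: X4 corner_def w_def)
      have "(norm X)\<^sup>2 = w + \<eta>\<^sup>2" unfolding X4 norm_ncoord by (simp add: w_def)
      moreover have "0 \<le> w" by (simp add: w_def)
      moreover have "(norm X)\<^sup>2 \<le> w / c" using c(1) c(2)[OF X] fw by (simp add: pos_le_divide_eq mult.commute)
      moreover have "w / c \<le> 8 * npn X / c" using w c(1) by (intro divide_right_mono) auto
      ultimately have "\<eta>\<^sup>2 \<le> 8 * (npn X / c)" by simp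
      moreover have "npd X = 1 + w / 4 + \<eta>\<^sup>2 / 4" by (simp add: X4 npd_def g0 w_def)
      ultimately have "npd X \<le> 3 * npn X + 2 * (npn X / c)" using w npn_ge_1[of X] by linarith
      then show ?thesis by (simp add: algebra_simps)
    qed
    then show ?thesis by blast
  qed
  then show False using not_ncrit_small assms by blast
qed

text \<open>By \<open>exists_large\<close>, a smaller \<open>h\<close> would be the line of an
  element of type (b). Each possible line misses the wall \<open>b = 1\<close>: isotropic,
  \<open>\<phi> = 0\<close> with independent \<open>x\<close> and \<open>y\<close>, or \<phi> and
  \<open>y\<close> both nonzero.\<close>

lemma dim_ge_2:
  assumes "ncrit h" shows "dim h \<ge> 2"
proof (rule ccontr)
  assume "\<not> dim h \<ge> 2"
  obtain B where B: "B \<in> h" "B \<noteq> 0" "indep B \<or> iso B" using exists_large[OF assms] by blast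
  have "span {B} = h"
  proof (rule subspace_dim_equal)
    show "span {B} \<subseteq> h" using B(1) sub by (simp add: span_minimal)
    show "dim h \<le> dim (span {B})" using \<open>\<not> dim h \<ge> 2\<close> B(2) by (simp add: dim_insert)
  qed (use sub in auto)
  then have hB: "\<exists>t. X = t *\<^sub>R B" if "X \<in> h" for X using that by (auto simp: span_singleton)
  obtain \<phi> x y \<eta> where B4: "B = (\<phi>, x, y, \<eta>)" by (metis prod_cases4)
  show False
  proof (cases "iso B")
    case True
    have "iso X" if "X \<in> h" for X
      using hB[OF that] True by (auto simp: iso_iff lq_scaleR)
    then show False using not_ncrit_iso assms by blast
  next
    case False
    then have ind: "y \<noteq> 0" "\<phi> \<noteq> 0 \<or> gram x y \<noteq> 0" using B(3) by (auto simp: B4 indep_def)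
    show False
    proof (cases "\<phi> = 0")
      case True
      have "\<not> ncrit h"
      proof (rule not_ncrit_gram[OF sub])
        show "fst X = 0" if "X \<in> h" for X using hB[OF that] True by (auto simp: B4)
        show "gram x' y' \<noteq> 0" if "(0, x', y', \<eta>') \<in> h" "x' \<noteq> 0 \<or> y' \<noteq> 0" for x' y' \<eta>'
          using hB[OF that(1)] that(2) ind True by (auto simp: B4 gram_scaleR)
      qed
      then show False using assms by blast
    next
      case False
      then show False using not_ncrit_line[of h \<phi> x y \<eta>] hB ind(1) assms by (auto simp: B4)
    qed
  qed
qed

text \<open>Some \<open>u\<close> has \<open>\<phi> \<noteq> 0\<close>, else the Gram estimate
  applies. Subtract a multiple of \<open>u\<close> from any \<open>v\<close> to clear \<phi>; the
  bracket with \<open>u\<close> then has \<open>y = 0\<close>, and the absence of type (a) forces it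
  onto the \<eta>-axis. This makes \<open>v\<close> a combination of \<open>u\<close> and the
  axis.\<close>

lemma no_dep:
  assumes "ncrit h" "\<And>A. A \<in> h \<Longrightarrow> \<not> dep A"
  shows "dim h = 2 \<and> (0, 0, 0, 1) \<in> h \<and> (\<exists>\<phi> x y \<eta>. (\<phi>, x, y, \<eta>) \<in> h \<and> \<phi> \<noteq> 0 \<and> y \<noteq> 0)"
proof -
  have nd: "(y = 0 \<longrightarrow> \<phi> = 0 \<and> x = 0) \<and> (y \<noteq> 0 \<longrightarrow> \<phi> \<noteq> 0 \<or> gram x y \<noteq> 0)"
    if "(\<phi>, x, y, \<eta>) \<in> h" for \<phi> x y \<eta>
    using assms(2)[OF that] by (auto simp: dep_def)
  have "\<exists>u\<in>h. fst u \<noteq> 0"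
  proof (rule ccontr)
    assume f: "\<not> ?thesis"
    have "\<not> ncrit h"
    proof (rule not_ncrit_gram[OF sub])
      show "gram x y \<noteq> 0" if "(0, x, y, \<eta>) \<in> h" "x \<noteq> 0 \<or> y \<noteq> 0" for x y \<eta>
        using nd[OF that(1)] that(2) by auto
    qed (use f in blast)
    then show False using assms(1) by blast
  qed
  then obtain \<phi> x y \<eta> where u: "(\<phi>, x, y, \<eta>) \<in> h" "\<phi> \<noteq> 0" by force
  then have y: "y \<noteq> 0" using nd by blast
  have all: "\<exists>c d. v = c *\<^sub>R (\<phi>, x, y, \<eta>) + d *\<^sub>R (0, 0, 0, 1)" if v: "v \<in> h" for v
  proof -
    obtain \<phi>v xv yv \<eta>v where v4: "v = (\<phi>v, xv, yv, \<eta>v)" by (metis prod_cases4)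
    define c where "c = \<phi>v / \<phi>"
    have w: "(0, xv - c *\<^sub>R x, yv - c *\<^sub>R y, \<eta>v - c * \<eta>) \<in> h"
      using ad[OF v sc[OF u(1), of "- c"]] u(2) by (simp add: v4 c_def)
    have "nbr (\<phi>, x, y, \<eta>) (0, xv - c *\<^sub>R x, yv - c *\<^sub>R y, \<eta>v - c * \<eta>) \<in> h"
      by (rule nbr_h[OF u(1) w])
    then have "(0, \<phi> *\<^sub>R (yv - c *\<^sub>R y), 0, (xv - c *\<^sub>R x) \<bullet> y - x \<bullet> (yv - c *\<^sub>R y)) \<in> h"
      by (simp add: nbr_def)
    from nd[OF this] have "\<phi> *\<^sub>R (yv - c *\<^sub>R y) = 0" by simp
    then have yv: "yv - c *\<^sub>R y = 0" using u(2) by simp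
    then have xv: "xv - c *\<^sub>R x = 0" using nd[OF w] by blast
    have "v = c *\<^sub>R (\<phi>, x, y, \<eta>) + (\<eta>v - c * \<eta>) *\<^sub>R (0, 0, 0, 1)"
      using u(2) xv yv by (simp add: v4 c_def)
    then show ?thesis by blast
  qed
  have d2: "dim h \<ge> 2" by (rule dim_ge_2[OF assms(1)])
  obtain v where v: "v \<in> h" "\<And>c. v \<noteq> c *\<^sub>R (\<phi>, x, y, \<eta>)" using exists_outside_line[OF d2] by blast
  obtain c d where cd: "v = c *\<^sub>R (\<phi>, x, y, \<eta>) + d *\<^sub>R (0, 0, 0, 1)" using all[OF v(1)] by blast
  have "d \<noteq> 0"
  proof
    assume "d = 0"
    then have "v = c *\<^sub>R (\<phi>, x, y, \<eta>)" using cd by simp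
    then show False using v(2) by blast
  qed
  moreover have "v + (- c) *\<^sub>R (\<phi>, x, y, \<eta>) \<in> h" by (rule ad[OF v(1) sc[OF u(1)]])
  then have "(0, 0, 0, d) \<in> h" using cd by simp
  ultimately have E: "(0, 0, 0, 1) \<in> h" using eta_scale by blast
  have "h \<subseteq> span {(\<phi>, x, y, \<eta>), (0, 0, 0, 1)}"
  proof
    fix v assume "v \<in> h"
    then obtain c d where "v = c *\<^sub>R (\<phi>, x, y, \<eta>) + d *\<^sub>R (0, 0, 0, 1)" using all by blast
    moreover have "c *\<^sub>R (\<phi>, x, y, \<eta>) + d *\<^sub>R (0, 0, 0, 1) \<in> span {(\<phi>, x, y, \<eta>), (0, 0, 0, 1)}"
      by (intro span_add span_scale span_base) auto
    ultimately show "v \<in> span {(\<phi>, x, y, \<eta>), (0, 0, 0, 1)}" by (simp only:)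
  qed
  then have "dim h \<le> card {(\<phi>, x, y, \<eta>), (0, 0, 0, 1)}" by (intro dim_le_card) auto
  also have "\<dots> \<le> 2" by (simp add: card_insert_if)
  finally show ?thesis using d2 E u y by auto
qed

theorem ncrit_iff:
  "ncrit h \<longleftrightarrow> (dim h = 2 \<and> (0, 0, 0, 1) \<in> h \<and> (\<exists>\<phi> x y \<eta>. (\<phi>, x, y, \<eta>) \<in> h \<and> \<phi> \<noteq> 0 \<and> y \<noteq> 0)) \<or>
    (dim h \<ge> 2 \<and> (\<exists>A\<in>h. dep A) \<and> (\<exists>B\<in>h. B \<noteq> 0 \<and> (indep B \<or> iso B)))" (is "_ \<longleftrightarrow> ?P \<or> ?Q")
proof
  assume n: "ncrit h"
  show "?P \<or> ?Q"
  proof (cases "\<exists>A\<in>h. dep A")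
    case True
    then show ?thesis using dim_ge_2[OF n] exists_large[OF n] by blast
  next
    case False
    then show ?thesis using no_dep[OF n] by blast
  qed
next
  assume "?P \<or> ?Q"
  then show "ncrit h" using ncrit_case1 ncrit_case2 by blast
qed

end

lemma closed_subgroup_N2n_SO2n:
  assumes "closed_subgroup H (N2n :: 'k::{finite,linorder} mat2n monoid)"
  shows "closed_subgroup H SO2n"
proof -
  have sub: "subgroup H N2n" and cl: "closedin (top_of_set (carrier N2n)) H"
    using assms by (auto simp: closed_subgroup_def)
  have HN: "H \<subseteq> carrier N2n" using subgroup.subset[OF sub] .
  have NS: "carrier (N2n :: 'k mat2n monoid) \<subseteq> carrier SO2n" by (auto simp: N2n_def)
  have ops: "(\<otimes>\<^bsub>N2n\<^esub>) = ((\<otimes>\<^bsub>SO2n\<^esub>) :: 'k mat2n \<Rightarrow> _)" "\<one>\<^bsub>N2n\<^esub> = (\<one>\<^bsub>SO2n\<^esub> :: 'k mat2n)"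
    by (simp_all add: N2n_def)
  have opsS: "(\<otimes>\<^bsub>SO2n\<^esub>) = ((**) :: 'k mat2n \<Rightarrow> _)" "\<one>\<^bsub>SO2n\<^esub> = (mat 1 :: 'k mat2n)"
    by (simp_all add: SO2n_def)
  have "subgroup H SO2n"
  proof
    show "H \<subseteq> carrier SO2n" using HN NS by blast
    show "x \<otimes>\<^bsub>SO2n\<^esub> y \<in> H" if "x \<in> H" "y \<in> H" for x y
      using subgroup.m_closed[OF sub that] by (simp add: ops)
    show "\<one>\<^bsub>SO2n\<^esub> \<in> H" using subgroup.one_closed[OF sub] by (simp add: ops)
    show "inv\<^bsub>SO2n\<^esub> x \<in> H" if "x \<in> H" for x
    proof -
      obtain X where X: "x = expn X" using HN \<open>x \<in> H\<close> by (auto simp: carrier_N2n)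
      have "inv\<^bsub>N2n\<^esub> x = expn (- X)" unfolding X by (rule expn_inv) (simp_all add: carrier_N2n ops opsS)
      moreover have "inv\<^bsub>SO2n\<^esub> x = expn (- X)"
        unfolding X by (rule expn_inv) (use NS in \<open>simp_all add: carrier_N2n opsS\<close>)
      ultimately show ?thesis using subgroup.m_inv_closed[OF sub \<open>x \<in> H\<close>] by simp
    qed
  qed
  moreover have "closed (carrier (N2n :: 'k mat2n monoid))"
    by (simp add: N2n_def closed_Int closed_SO2n closed_upper_unipotent)
  then have "closed H" using cl closedin_closed_trans by blast
  then have "closedin (top_of_set (carrier SO2n)) H" using HN NS by (intro closed_subset) auto
  ultimately show ?thesis by (simp add: closed_subgroup_def)
qed

theorem theorem5p3:
  fixes n :: nat and H :: "'k::{finite,linorder} mat2n set"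
  assumes "n \<ge> 3" and "CARD('k) = n - 2"
    and "closed_subgroup H N2n" and "connected H"
  shows "Cartan_decomposition_subgroup H SO2n \<longleftrightarrow>
    (Lie_dim H = 2 \<and> u_alpha_2beta \<subseteq> Lie_algebra H \<and>
      (\<exists>\<phi> x y \<eta>. n_elt \<phi> x y \<eta> \<in> Lie_algebra H \<and> \<phi> \<noteq> 0 \<and> y \<noteq> 0))
    \<or>
    (Lie_dim H \<ge> 2 \<and>
      (\<exists>\<phi> x y \<eta>. n_elt \<phi> x y \<eta> \<in> Lie_algebra H \<and> dim (span {(\<phi>, x), (0, y)}) = 1) \<and>
      (\<exists>\<phi> x y \<eta>. n_elt \<phi> x y \<eta> \<in> Lie_algebra H \<and> n_elt \<phi> x y \<eta> \<noteq> 0 \<and>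
        (dim (span {(\<phi>, x), (0, y)}) = 2 \<or> (y = 0 \<and> (norm x)\<^sup>2 = - 2 * \<phi> * \<eta>))))"
proof -
  obtain h where h: "subspace h" "\<And>X Y. X \<in> h \<Longrightarrow> Y \<in> h \<Longrightarrow> nbr X Y \<in> h"
    "H = expn ` h" "Lie_algebra H = nm ` h" "Lie_dim H = dim h"
    using connected_subgroup_N2n[OF assms(3,4)] by blast
  interpret nsubalgebra h by standard (rule h(1), rule h(2))
  have SO: "closed_subgroup H SO2n" by (rule closed_subgroup_N2n_SO2n[OF assms(3)])
  have HS: "H \<subseteq> carrier SO2n" using SO subgroup.subset by (auto simp: closed_subgroup_def)
  have "Cartan_decomposition_subgroup H SO2n \<longleftrightarrow> Cartan_criterion H"
    unfolding Cartan_decomposition_subgroup_def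
    using SO assms(4) Cartan_imp_criterion[OF HS] criterion_imp_Cartan[OF HS] by blast
  also have "\<dots> \<longleftrightarrow> ncrit h" by (simp add: h(3) Cartan_criterion_expn)
  finally have crit: "Cartan_decomposition_subgroup H SO2n \<longleftrightarrow> ncrit h" .
  have mem: "n_elt \<phi> x y \<eta> \<in> Lie_algebra H \<longleftrightarrow> (\<phi>, x, y, \<eta>) \<in> h" for \<phi> x y \<eta>
  proof -
    have "n_elt \<phi> x y \<eta> = nm (\<phi>, x, y, \<eta>)" by (simp add: nm_def)
    moreover have "inj (nm :: 'k ncoord \<Rightarrow> _)" by (simp add: inj_def nm_inject)
    ultimately show ?thesis by (simp add: h(4) inj_image_mem_iff)
  qed
  have zero: "n_elt \<phi> x y \<eta> = 0 \<longleftrightarrow> (\<phi>, x, y, \<eta>) = 0" for \<phi> \<eta> and x y :: "(real, 'k) vec"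
    using nm_inject[of "(\<phi>, x, y, \<eta>)" 0] by (simp add: linear_0[OF nm_linear]) (simp add: nm_def)
  have u: "u_alpha_2beta \<subseteq> Lie_algebra H \<longleftrightarrow> (0, 0, 0, 1) \<in> h"
  proof
    assume "u_alpha_2beta \<subseteq> Lie_algebra H"
    moreover have "n_elt 0 0 0 1 \<in> u_alpha_2beta" by (simp add: u_alpha_2beta_def)
    ultimately show "(0, 0, 0, 1) \<in> h" using mem by blast
  next
    assume "(0, 0, 0, 1) \<in> h"
    then have "(0, 0, 0, t) \<in> h" for t using sc[of "(0, 0, 0, 1)" t] by simp
    then show "u_alpha_2beta \<subseteq> Lie_algebra H" by (auto simp: u_alpha_2beta_def mem)
  qed
  have dp: "(\<exists>A\<in>h. dep A) \<longleftrightarrow> (\<exists>\<phi> x y \<eta>. (\<phi>, x, y, \<eta>) \<in> h \<and> dep (\<phi>, x, y, \<eta>))"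
    and ip: "(\<exists>B\<in>h. B \<noteq> 0 \<and> (indep B \<or> iso B)) \<longleftrightarrow> (\<exists>\<phi> x y \<eta>. (\<phi>, x, y, \<eta>) \<in> h \<and> (\<phi>, x, y, \<eta>) \<noteq> 0 \<and>
      (indep (\<phi>, x, y, \<eta>) \<or> iso (\<phi>, x, y, \<eta>)))"
    by (force simp del: zero_prod_def)+
  have "iso (\<phi>, x, y, \<eta>) \<longleftrightarrow> y = 0 \<and> (norm x)\<^sup>2 = - 2 * \<phi> * \<eta>" for \<phi> \<eta> and x y :: "(real, 'k) vec"
    by (simp add: iso_def)
  \<comment> \<open>\<open>dep\<close> and \<open>indep\<close> ignore \<eta>, so the dimension
    conditions may be translated at \<open>\<eta> = 0\<close>.\<close>
  then show ?thesis
    unfolding crit ncrit_iff h(5) mem u dp ip zero dim_span_pair(1)[where \<eta> = 0] dim_span_pair(2)[where \<eta> = 0]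
    by (simp add: dep_def indep_def)
qed

end
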